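(* Let $\delta>0$ be such that $d_V^{-1}(\delta)$ is a hypersurface of class $C^2$. For $P\in V^{-1}(E)$ and $\lambda>0$ (such that $\gamma(P,\lambda)$ is defined at the parameter value $\delta/\sqrt{\lambda}$), let $\gamma_\delta(P,\lambda)$ be the maximal Jacobi geodesic solving the Cauchy problem for the Jacobi geodesic equation with initial position $\gamma_\delta(P,\lambda)(0)=\gamma(P,\lambda)\big(\tfrac{\delta}{\sqrt\lambda}\big)$ and initial velocity $\dot\gamma_\delta(P,\lambda)(0)=\dot\gamma(P,\lambda)\big(\tfrac{\delta}{\sqrt\lambda}\big)$. Then for any $s>0$ (in the domain of $\gamma(P,\lambda)$) $$\gamma(P,\lambda)(s)=\gamma_\delta(P,\lambda)\Big(s-\frac{\delta}{\sqrt{\lambda}}\Big),$$ and, for any $s>0$, the map $(P,\lambda)\mapsto \exp^{\perp}(P,\lambda)(s)$ is of class $C^1$ on its domain.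
   Context: Setting. $(M,g)$ is a Riemannian manifold of class $C^3$, $V:M\to\mathbb{R}$ is a function of class $C^2$, and $E\in\mathbb{R}$ satisfies $E>\inf_M V$. Standing assumptions: $V$ is of class $C^2$ in a neighborhood of $V^{-1}(]-\infty,E[)$; $E$ is a regular value of $V$; the sublevel $V^{-1}(]-\infty,E])$ is compact. The Jacobi metric is $g_*=\tfrac12(E-V)g$, defined on the open sublevel $V^{-1}(]-\infty,E[)$; it degenerates on $V^{-1}(E)$. For $Q\in V^{-1}(]-\infty,E[)$, $d_V(Q)$ denotes the distance of $Q$ from $V^{-1}(E)$ with respect to $g_*$, i.e. the infimum of the $g_*$-lengths of curves joining $V^{-1}(E)$ to $Q$. Jacobi geodesics. A Jacobi geodesic is a geodesic $x$ of $g_*$ in $V^{-1}(]-\infty,E[)$, i.e. a solution of $$\big(E-V(x)\big)\tfrac{\mathrm D}{\mathrm ds}\dot x-g(\nabla V(x),\dot x)\dot x+\tfrac12 g(\dot x,\dot x)\nabla V(x)=0,$$ where $\nabla V$ is the $g$-gradient and $\tfrac{\mathrm D}{\mathrm ds}$ is the covariant derivative along $x$ for the Levi-Civita connection of $g$. Along a nonconstant Jacobi geodesic $\gamma$ the quantity $\lambda_\gamma=\tfrac12(E-V(\gamma))g(\dot\gamma,\dot\gamma)$ is a positive constant. The geodesics $\gamma(P,\lambda)$. For $P\in V^{-1}(E)$ and $\lambda>0$, $\gamma(P,\lambda)$ denotes the unique (maximally extended for $s>0$) Jacobi geodesic $\gamma$ defined for $s>0$ with $\lim_{s\downarrow0}\gamma(s)=P$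 and $\lambda_\gamma=\lambda$. It is a reparameterization of the solution $t\mapsto q(t,P)$ of $\tfrac{\mathrm D}{\mathrm dt}\dot q+\nabla V(q)=0$, $q(0)=P$, $\dot q(0)=0$, namely $\gamma(P,\lambda)(s)=q(t(s),P)$ with $t(s)=\int_0^s\frac{\sqrt\lambda\,\mathrm dr}{E-V(\gamma(P,\lambda)(r))}$. Normal exponential map. For $s>0$, $\lambda>0$ and $P\in V^{-1}(E)$, $\exp^{\perp}(P,\lambda)(s)=\gamma(P,\lambda)(s)$. For fixed $s>0$, $\exp^\perp(\cdot,\cdot)(s)$ is regarded as a map into $V^{-1}(]-\infty,E[)$ defined on the set of those $(P,\lambda)\in V^{-1}(E)\times\,]0,+\infty[$ for which $\gamma(P,\lambda)$ is defined at $s$. *)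

theory Defs
  imports "HOL-Analysis.Analysis"
begin

section \<open>Functions of class C^k on open subsets of Euclidean spaces\<close>

text \<open>In finite dimension, continuity of all iterated directional derivatives up to order k is
  the same as continuity of the derivatives of order at most k as multilinear maps.\<close>

primrec Ck_on :: "nat \<Rightarrow> ('a::euclidean_space \<Rightarrow> 'b::real_normed_vector) \<Rightarrow> 'a set \<Rightarrow> bool" where
  "Ck_on 0 = (\<lambda>f S. continuous_on S f)"
| "Ck_on (Suc k) = (\<lambda>f S. (\<forall>x\<in>S. f differentiable (at x)) \<and>
     (\<forall>v. Ck_on k (\<lambda>x. frechet_derivative f (at x) v) S))"

section \<open>Manifolds, given by an atlas on a topological space\<close>

text \<open>A chart is a pair of a domain and a coordinate map; the values of the coordinate map outside
  the domain are irrelevant.\<close>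

type_synonym ('m, 'e) chart = "'m set \<times> ('m \<Rightarrow> 'e)"

definition cdom :: "('m, 'e) chart \<Rightarrow> 'm set" where
  "cdom c = fst c"

definition cmap :: "('m, 'e) chart \<Rightarrow> 'm \<Rightarrow> 'e" where
  "cmap c = snd c"

definition cimg :: "('m, 'e) chart \<Rightarrow> 'e set" where
  "cimg c = cmap c ` cdom c"

definition cinv :: "('m, 'e) chart \<Rightarrow> 'e \<Rightarrow> 'm" where
  "cinv c = inv_into (cdom c) (cmap c)"

definition is_chart :: "('m::topological_space, 'e::euclidean_space) chart \<Rightarrow> bool" where
  "is_chart c \<longleftrightarrow> open (cdom c) \<and> open (cimg c) \<and> homeomorphism (cdom c) (cimg c) (cmap c) (cinv c)"

definition Ck_compatible ::
  "nat \<Rightarrow> ('m::topological_space, 'e::euclidean_space) chart \<Rightarrow> ('m, 'e) chart \<Rightarrow> bool" where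
  "Ck_compatible k c d \<longleftrightarrow>
     Ck_on k (cmap d \<circ> cinv c) (cmap c ` (cdom c \<inter> cdom d)) \<and>
     Ck_on k (cmap c \<circ> cinv d) (cmap d ` (cdom c \<inter> cdom d))"

definition Ck_atlas :: "nat \<Rightarrow> ('m::topological_space, 'e::euclidean_space) chart set \<Rightarrow> bool" where
  "Ck_atlas k A \<longleftrightarrow> (\<forall>c\<in>A. is_chart c) \<and> (\<forall>c\<in>A. \<forall>d\<in>A. Ck_compatible k c d) \<and>
     (\<Union>c\<in>A. cdom c) = UNIV"

definition Ck_function ::
  "nat \<Rightarrow> ('m::topological_space, 'e::euclidean_space) chart set \<Rightarrow> ('m \<Rightarrow> real) \<Rightarrow> bool" where
  "Ck_function k A f \<longleftrightarrow> (\<forall>c\<in>A. Ck_on k (f \<circ> cinv c) (cimg c))"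

definition regular_value ::
  "('m::topological_space, 'e::euclidean_space) chart set \<Rightarrow> ('m \<Rightarrow> real) \<Rightarrow> real \<Rightarrow> bool" where
  "regular_value A f a \<longleftrightarrow> (\<forall>p. f p = a \<longrightarrow>
     (\<forall>c\<in>A. p \<in> cdom c \<longrightarrow> frechet_derivative (f \<circ> cinv c) (at (cmap c p)) \<noteq> (\<lambda>_. 0)))"

text \<open>Embedded hypersurfaces, through slice charts of class C^k (k at most the class of the
  atlas): in such a chart the hypersurface is cut out by the vanishing of one coordinate.\<close>

definition slice_chart ::
  "nat \<Rightarrow> ('m::topological_space, 'e::euclidean_space) chart set \<Rightarrow> 'm set \<Rightarrow> ('m, 'e) chart \<Rightarrow> 'e \<Rightarrow> bool"
  where
  "slice_chart k A H d b \<longleftrightarrow> is_chart d \<and> (\<forall>c\<in>A. Ck_compatible k c d) \<and> b \<in> Basis \<and>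
     cdom d \<inter> H = {p \<in> cdom d. cmap d p \<bullet> b = 0}"

definition Ck_hypersurface ::
  "nat \<Rightarrow> ('m::topological_space, 'e::euclidean_space) chart set \<Rightarrow> 'm set \<Rightarrow> bool" where
  "Ck_hypersurface k A H \<longleftrightarrow> (\<forall>p\<in>H. \<exists>d b. slice_chart k A H d b \<and> p \<in> cdom d)"

text \<open>Maps of class C^1 from an open subset of H \<times> \<real> to M, where H is a hypersurface of class C^2.
  The domain of the map is the domain of f as a partial function. Coordinates on H near P are
  the restriction of a slice chart d, with values in the hyperplane orthogonal to b; the local
  representation of f is extended to an open subset of the whole Euclidean space by making it
  constant in the direction b, which does not affect its being of class C^1. That the extended
  representation is defined on the open set N expresses that the domain of f is open in H \<times> \<real>.\<close>

definition hyperplane_proj :: "'e::euclidean_space \<Rightarrow> 'e \<Rightarrow> 'e" where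
  "hyperplane_proj b y = y - (y \<bullet> b) *\<^sub>R b"

definition C1_map_hypersurface_real ::
  "('m::topological_space, 'e::euclidean_space) chart set \<Rightarrow> 'm set \<Rightarrow> ('m \<times> real \<rightharpoonup> 'm) \<Rightarrow> bool" where
  "C1_map_hypersurface_real A H f \<longleftrightarrow> dom f \<subseteq> H \<times> UNIV \<and>
     (\<forall>(P, r) \<in> dom f. \<exists>d b c N.
        slice_chart 2 A H d b \<and> P \<in> cdom d \<and> c \<in> A \<and>
        open N \<and> (cmap d P, r) \<in> N \<and>
        (\<forall>(y, u) \<in> N. hyperplane_proj b y \<in> cimg d \<and>
           (\<exists>q \<in> cdom c. f (cinv d (hyperplane_proj b y), u) = Some q)) \<and>
        Ck_on 1 (\<lambda>(y, u). cmap c (the (f (cinv d (hyperplane_proj b y), u)))) N)"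

section \<open>Riemannian metrics\<close>

text \<open>Tensors are given by their components: g c x v w is the value at the point with coordinates x
  in the chart c on the tangent vectors with components v and w in c, subject to the
  transformation law under change of chart.\<close>

type_synonym ('m, 'e) metric = "('m, 'e) chart \<Rightarrow> 'e \<Rightarrow> 'e \<Rightarrow> 'e \<Rightarrow> real"

definition riemannian_metric ::
  "nat \<Rightarrow> ('m::topological_space, 'e::euclidean_space) chart set \<Rightarrow> ('m, 'e) metric \<Rightarrow> bool" where
  "riemannian_metric k A g \<longleftrightarrow>
     (\<forall>c\<in>A. \<forall>x\<in>cimg c. bilinear (g c x) \<and> (\<forall>v w. g c x v w = g c x w v) \<and>
        (\<forall>v. v \<noteq> 0 \<longrightarrow> 0 < g c x v v)) \<and>
     (\<forall>c\<in>A. \<forall>v w. Ck_on k (\<lambda>x. g c x v w) (cimg c)) \<and>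
     (\<forall>c\<in>A. \<forall>d\<in>A. \<forall>p\<in>cdom c \<inter> cdom d. \<forall>v w.
        g c (cmap c p) v w =
          g d (cmap d p) (frechet_derivative (cmap d \<circ> cinv c) (at (cmap c p)) v)
                         (frechet_derivative (cmap d \<circ> cinv c) (at (cmap c p)) w))"

definition gradient ::
  "('m, 'e::euclidean_space) metric \<Rightarrow> ('m \<Rightarrow> real) \<Rightarrow> ('m, 'e) chart \<Rightarrow> 'e \<Rightarrow> 'e" where
  "gradient g f c x = (THE z. \<forall>u. g c x z u = frechet_derivative (f \<circ> cinv c) (at x) u)"

text \<open>The Levi-Civita connection in the chart c: the Christoffel symbols, as a bilinear map, are
  determined by the Koszul formula for vector fields with constant components.\<close>

definition christoffel ::
  "('m, 'e::euclidean_space) metric \<Rightarrow> ('m, 'e) chart \<Rightarrow> 'e \<Rightarrow> 'e \<Rightarrow> 'e \<Rightarrow> 'e" where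
  "christoffel g c x v w = (THE z. \<forall>u. g c x z u =
     (frechet_derivative (\<lambda>y. g c y w u) (at x) v
      + frechet_derivative (\<lambda>y. g c y v u) (at x) w
      - frechet_derivative (\<lambda>y. g c y v w) (at x) u) / 2)"

text \<open>Components in the chart c of the velocity of the curve x at s.\<close>

definition velocity ::
  "(real \<Rightarrow> 'm) \<Rightarrow> real \<Rightarrow> ('m, 'e::euclidean_space) chart \<Rightarrow> 'e" where
  "velocity x s c = vector_derivative (cmap c \<circ> x) (at s)"

text \<open>Covariant derivative at s along x of the field along x with components X in the chart c.\<close>

definition covariant_derivative ::
  "('m, 'e::euclidean_space) metric \<Rightarrow> ('m, 'e) chart \<Rightarrow> (real \<Rightarrow> 'm) \<Rightarrow> (real \<Rightarrow> 'e) \<Rightarrow> real \<Rightarrow> 'e" where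
  "covariant_derivative g c x X s =
     vector_derivative X (at s) + christoffel g c (cmap c (x s)) (velocity x s c) (X s)"

section \<open>The Jacobi metric\<close>

definition jacobi_metric ::
  "('m, 'e::euclidean_space) metric \<Rightarrow> ('m \<Rightarrow> real) \<Rightarrow> real \<Rightarrow> ('m, 'e) metric" where
  "jacobi_metric g V E = (\<lambda>c y v w. (E - V (cinv c y)) / 2 * g c y v w)"

definition piecewise_C1_curve ::
  "('m::topological_space, 'e::euclidean_space) chart set \<Rightarrow> (real \<Rightarrow> 'm) \<Rightarrow> bool" where
  "piecewise_C1_curve A x \<longleftrightarrow> continuous_on {0..1} x \<and>
     (\<exists>S. finite S \<and> (\<forall>c\<in>A. (cmap c \<circ> x) C1_differentiable_on ({0..1} \<inter> x -` cdom c - S)))"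

text \<open>Length of a curve on [0,1]; the integrand does not depend on the chart chosen at x t, except
  possibly at the finitely many points where x is not differentiable.\<close>

definition curve_length ::
  "('m::topological_space, 'e::euclidean_space) chart set \<Rightarrow> ('m, 'e) metric \<Rightarrow> (real \<Rightarrow> 'm) \<Rightarrow> ennreal"
  where
  "curve_length A h x = (\<integral>\<^sup>+ t \<in> {0..1}.
     (let c = (SOME c. c \<in> A \<and> x t \<in> cdom c)
      in ennreal (sqrt (h c (cmap c (x t)) (velocity x t c) (velocity x t c)))) \<partial>lborel)"

text \<open>The distance d_V from the level set of E; it is infinite where no curve from that level set
  arrives.\<close>

definition jacobi_dist ::
  "('m::topological_space, 'e::euclidean_space) chart set \<Rightarrow> ('m, 'e) metric \<Rightarrow> ('m \<Rightarrow> real) \<Rightarrow> real \<Rightarrow> 'm \<Rightarrow> ennreal"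
  where
  "jacobi_dist A g V E Q = Inf {curve_length A (jacobi_metric g V E) x | x.
     piecewise_C1_curve A x \<and> V (x 0) = E \<and> (\<forall>t\<in>{0<..1}. V (x t) < E) \<and> x 1 = Q}"

section \<open>Jacobi geodesics\<close>

text \<open>Geodesics are partial curves whose domain is an open interval. The equation is required
  in every chart around every point of the curve; both derivatives of the coordinate curve are
  required to exist, and are then continuous by the equation.\<close>

definition jacobi_geodesic ::
  "('m::topological_space, 'e::euclidean_space) chart set \<Rightarrow> ('m, 'e) metric \<Rightarrow> ('m \<Rightarrow> real) \<Rightarrow> real
     \<Rightarrow> (real \<rightharpoonup> 'm) \<Rightarrow> bool" where
  "jacobi_geodesic A g V E \<gamma> \<longleftrightarrow>
     open (dom \<gamma>) \<and> is_interval (dom \<gamma>) \<and> continuous_on (dom \<gamma>) (the \<circ> \<gamma>) \<and>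
     (\<forall>p \<in> ran \<gamma>. V p < E) \<and>
     (\<forall>s \<in> dom \<gamma>. \<forall>c\<in>A. the (\<gamma> s) \<in> cdom c \<longrightarrow>
        (let x = the \<circ> \<gamma>; y = cmap c (x s); v = (\<lambda>r. velocity x r c); G = gradient g V c y in
           (cmap c \<circ> x) differentiable (at s) \<and> v differentiable (at s) \<and>
           (E - V (x s)) *\<^sub>R covariant_derivative g c x v s
             - g c y G (v s) *\<^sub>R v s + (g c y (v s) (v s) / 2) *\<^sub>R G = 0))"

text \<open>The conserved quantity (E - V(\<gamma>)) g(\<gamma>', \<gamma>') / 2 is constantly equal to l.\<close>

definition has_jacobi_constant ::
  "('m::topological_space, 'e::euclidean_space) chart set \<Rightarrow> ('m, 'e) metric \<Rightarrow> ('m \<Rightarrow> real) \<Rightarrow> real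
     \<Rightarrow> (real \<rightharpoonup> 'm) \<Rightarrow> real \<Rightarrow> bool" where
  "has_jacobi_constant A g V E \<gamma> l \<longleftrightarrow>
     (\<forall>s \<in> dom \<gamma>. \<forall>c\<in>A. the (\<gamma> s) \<in> cdom c \<longrightarrow>
        jacobi_metric g V E c (cmap c (the (\<gamma> s)))
          (velocity (the \<circ> \<gamma>) s c) (velocity (the \<circ> \<gamma>) s c) = l)"

definition maximal_curve :: "((real \<rightharpoonup> 'm) \<Rightarrow> bool) \<Rightarrow> (real \<rightharpoonup> 'm) \<Rightarrow> bool" where
  "maximal_curve Q \<gamma> \<longleftrightarrow> Q \<gamma> \<and> (\<forall>\<gamma>'. Q \<gamma>' \<and> \<gamma> \<subseteq>\<^sub>m \<gamma>' \<longrightarrow> \<gamma>' = \<gamma>)"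

definition geodesic_from_boundary ::
  "('m::topological_space, 'e::euclidean_space) chart set \<Rightarrow> ('m, 'e) metric \<Rightarrow> ('m \<Rightarrow> real) \<Rightarrow> real
     \<Rightarrow> 'm \<Rightarrow> real \<Rightarrow> (real \<rightharpoonup> 'm) \<Rightarrow> bool" where
  "geodesic_from_boundary A g V E P l \<gamma> \<longleftrightarrow> jacobi_geodesic A g V E \<gamma> \<and>
     (\<exists>b::ereal. 0 < b \<and> dom \<gamma> = {s. 0 < s \<and> ereal s < b}) \<and>
     ((the \<circ> \<gamma>) \<longlongrightarrow> P) (at_right 0) \<and> has_jacobi_constant A g V E \<gamma> l"

text \<open>The geodesic \<gamma>(P,l), meaningful for V P = E and l > 0.\<close>

definition gamma ::
  "('m::topological_space, 'e::euclidean_space) chart set \<Rightarrow> ('m, 'e) metric \<Rightarrow> ('m \<Rightarrow> real) \<Rightarrow> real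
     \<Rightarrow> 'm \<Rightarrow> real \<Rightarrow> (real \<rightharpoonup> 'm)" where
  "gamma A g V E P l = (THE \<gamma>. maximal_curve (geodesic_from_boundary A g V E P l) \<gamma>)"

text \<open>Jacobi geodesic with initial position p and initial velocity v; a tangent vector at p is
  represented by its components v c in the charts c around p.\<close>

definition jacobi_cauchy ::
  "('m::topological_space, 'e::euclidean_space) chart set \<Rightarrow> ('m, 'e) metric \<Rightarrow> ('m \<Rightarrow> real) \<Rightarrow> real
     \<Rightarrow> 'm \<Rightarrow> (('m, 'e) chart \<Rightarrow> 'e) \<Rightarrow> (real \<rightharpoonup> 'm) \<Rightarrow> bool" where
  "jacobi_cauchy A g V E p v \<gamma> \<longleftrightarrow> jacobi_geodesic A g V E \<gamma> \<and> \<gamma> 0 = Some p \<and>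
     (\<forall>c\<in>A. p \<in> cdom c \<longrightarrow> velocity (the \<circ> \<gamma>) 0 c = v c)"

text \<open>The geodesic issuing from \<gamma>(P,l) at the parameter \<delta>/\<surd>l, meaningful if \<gamma>(P,l) is defined there.\<close>

definition gamma_delta ::
  "('m::topological_space, 'e::euclidean_space) chart set \<Rightarrow> ('m, 'e) metric \<Rightarrow> ('m \<Rightarrow> real) \<Rightarrow> real
     \<Rightarrow> real \<Rightarrow> 'm \<Rightarrow> real \<Rightarrow> (real \<rightharpoonup> 'm)" where
  "gamma_delta A g V E \<delta> P l =
     (let x = the \<circ> gamma A g V E P l; s0 = \<delta> / sqrt l
      in THE \<gamma>. maximal_curve (jacobi_cauchy A g V E (x s0) (velocity x s0)) \<gamma>)"

definition exp_perp ::
  "('m::topological_space, 'e::euclidean_space) chart set \<Rightarrow> ('m, 'e) metric \<Rightarrow> ('m \<Rightarrow> real) \<Rightarrow> real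
     \<Rightarrow> 'm \<times> real \<Rightarrow> (real \<rightharpoonup> 'm)" where
  "exp_perp A g V E = (\<lambda>(P, l) s. if V P = E \<and> 0 < l then gamma A g V E P l s else None)"

end

theory Submission
  imports Defs
begin

text \<open>The Jacobi equation degenerates on the level set V = E, so neither the geodesics issuing from it nor
  their dependence on the initial point can be read off from the equation itself. The remedy is Maupertuis'
  principle: up to a change of parameter, these geodesics are the solutions of Newton's equation
  q'' + \<Gamma>(q', q') + \<nabla>V = 0 that start at rest. Newton's equation is regular at the boundary, and the
  parameter s is recovered from the time t as the action, the integral of E - V along the motion, divided by
  the square root of \<lambda>. Newton's equation and the action are treated together as a single
  differential equation with right-hand side of class C^1, in one chart around the boundary point
  (newton_to_jacobi).

  Existence of the geodesic with boundary point P and constant \<lambda> follows at once, since the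
  gradient of V does not vanish and motions starting at rest enter the sublevel set (boundary_curve).
  Uniqueness says that nothing else converges to P (boundary_unique): a geodesic that converges to P is run
  backwards with Newton's equation, and the force pushing inwards makes the motion reach P in finite time, at
  rest. Uniqueness shows that the union of all such geodesics is one of them; this union is the only maximal one and
  is what the description of \<gamma>(P, \<lambda>) as "the" maximal geodesic denotes.

  In the open sublevel set the Jacobi equation is an ordinary second-order equation with right-hand side of class
  C^1. Since it transforms like a tangent vector (jac_transform), it may be solved in any chart. Solutions are
  determined by position and velocity at one parameter value (jsol_unique), so a shifted geodesic
  is a part of the maximal solution of the Cauchy problem with its own initial data
  (jacobi_geodesic_restart). This is the first assertion.

  For the second, a small parameter value s1 < s is fixed. The time at which the action equals \<surd>\<lambda> s1 is a
  function of class C^1 of the initial point and of \<lambda>, by the implicit function theorem, as the action has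
  derivative E - V > 0. So position and velocity at s1 are functions of class C^1 of P and \<lambda>. The Jacobi flow carries them from
  s1 to s, again by a map of class C^1, obtained by composing finitely many local flows along the
  given geodesic (flowbox_along). What remains is analysis: differentiability of the flow of a vector field of class
  C^1 with respect to the initial value (ode_local_flow), and charts of class C^2 adapted to the level set
  (ex_slice_chart).\<close>

section \<open>Maps of class C^1 and C^2\<close>

text \<open>The derivative is carried as a map into the space of bounded linear maps, so that the chain rule is
  composition of linear maps.\<close>

definition C1_on :: "('a::real_normed_vector \<Rightarrow> 'b::real_normed_vector) \<Rightarrow> 'a set \<Rightarrow> bool" where
  "C1_on f S \<longleftrightarrow> (\<exists>f'. (\<forall>x\<in>S. (f has_derivative blinfun_apply (f' x)) (at x)) \<and> continuous_on S f')"

lemma C1_onI: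
  assumes "\<And>x. x \<in> S \<Longrightarrow> (f has_derivative blinfun_apply (f' x)) (at x)" "continuous_on S f'"
  shows "C1_on f S"
  using assms unfolding C1_on_def by blast

lemma C1_onE:
  assumes "C1_on f S"
  obtains f' where "\<And>x. x \<in> S \<Longrightarrow> (f has_derivative blinfun_apply (f' x)) (at x)" "continuous_on S f'"
  using assms unfolding C1_on_def by blast

lemma C1_on_subset: "C1_on f T \<Longrightarrow> S \<subseteq> T \<Longrightarrow> C1_on f S"
  unfolding C1_on_def by (meson continuous_on_subset subsetD)

lemma C1_on_cong:
  assumes "C1_on f S" "open S" "\<And>x. x \<in> S \<Longrightarrow> g x = f x"
  shows "C1_on g S"
proof -
  obtain f' where f': "\<And>x. x \<in> S \<Longrightarrow> (f has_derivative blinfun_apply (f' x)) (at x)" "continuous_on S f'"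
    using assms(1) by (rule C1_onE) blast
  show ?thesis
  proof (rule C1_onI)
    show "(g has_derivative blinfun_apply (f' x)) (at x)" if "x \<in> S" for x
      by (rule has_derivative_transform_within_open[OF f'(1)[OF that] assms(2) that]) (simp add: assms(3))
  qed (rule f')
qed

lemma C1_on_differentiable: "C1_on f S \<Longrightarrow> x \<in> S \<Longrightarrow> f differentiable (at x)"
  unfolding C1_on_def differentiable_def by blast

lemma C1_on_continuous_on: "C1_on f S \<Longrightarrow> continuous_on S f"
  by (meson C1_on_differentiable continuous_at_imp_continuous_on differentiable_imp_continuous_within)

lemma C1_on_bounded_linear: "bounded_linear f \<Longrightarrow> C1_on f S"
  by (rule C1_onI[of _ _ "\<lambda>_. Blinfun f"])
    (auto simp: bounded_linear_Blinfun_apply bounded_linear_imp_has_derivative)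

lemma C1_on_const: "C1_on (\<lambda>_. c) S"
  by (rule C1_onI[of _ _ "\<lambda>_. 0"]) (auto simp: zero_blinfun.rep_eq)

lemma C1_on_compose:
  assumes "C1_on g T" "C1_on f S" "f ` S \<subseteq> T"
  shows "C1_on (\<lambda>x. g (f x)) S"
proof -
  obtain f' where f': "\<And>x. x \<in> S \<Longrightarrow> (f has_derivative blinfun_apply (f' x)) (at x)" "continuous_on S f'"
    using assms(2) by (rule C1_onE) blast
  obtain g' where g': "\<And>x. x \<in> T \<Longrightarrow> (g has_derivative blinfun_apply (g' x)) (at x)" "continuous_on T g'"
    using assms(1) by (rule C1_onE) blast
  have [continuous_intros]: "continuous_on S (\<lambda>x. g' (f x))"
    by (rule continuous_on_compose2[OF g'(2) C1_on_continuous_on[OF assms(2)] assms(3)])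
  show ?thesis
  proof (rule C1_onI[of _ _ "\<lambda>x. g' (f x) o\<^sub>L f' x"])
    show "((\<lambda>x. g (f x)) has_derivative blinfun_apply (g' (f x) o\<^sub>L f' x)) (at x)" if "x \<in> S" for x
      using diff_chain_at[OF f'(1)[OF that] g'(1)] that assms(3)
      by (force simp: o_def blinfun_compose.rep_eq)
  qed (intro continuous_intros f')
qed

lemma C1_on_linear_compose:
  assumes "bounded_linear L" "C1_on f S"
  shows "C1_on (\<lambda>x. L (f x)) S"
  using C1_on_compose[OF C1_on_bounded_linear[OF assms(1), of UNIV] assms(2)] by simp

lemma C1_on_Pair:
  assumes "C1_on f S" "C1_on g S"
  shows "C1_on (\<lambda>x. (f x, g x)) S"
proof -
  obtain f' where f': "\<And>x. x \<in> S \<Longrightarrow> (f has_derivative blinfun_apply (f' x)) (at x)" "continuous_on S f'"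
    using assms(1) by (rule C1_onE) blast
  obtain g' where g': "\<And>x. x \<in> S \<Longrightarrow> (g has_derivative blinfun_apply (g' x)) (at x)" "continuous_on S g'"
    using assms(2) by (rule C1_onE) blast
  have l1: "bounded_linear (\<lambda>x::'b. (x, 0::'c))" and l2: "bounded_linear (\<lambda>y::'c. (0::'b, y))"
    by (intro bounded_linear_Pair bounded_linear_ident bounded_linear_zero)+
  show ?thesis
  proof (rule C1_onI)
    let ?F = "\<lambda>x. (Blinfun (\<lambda>x::'b. (x, 0::'c)) o\<^sub>L f' x) + (Blinfun (\<lambda>y::'c. (0::'b, y)) o\<^sub>L g' x)"
    have eq: "blinfun_apply (?F x) = (\<lambda>h. (f' x h, g' x h))" for x
      by (auto simp: blinfun.add_left blinfun_compose.rep_eq bounded_linear_Blinfun_apply l1 l2)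
    show "((\<lambda>x. (f x, g x)) has_derivative blinfun_apply (?F x)) (at x)" if "x \<in> S" for x
      unfolding eq using f'(1)[OF that] g'(1)[OF that] by (rule has_derivative_Pair)
    show "continuous_on S ?F"
      by (intro continuous_intros f' g')
  qed
qed

lemma C1_on_id: "C1_on (\<lambda>x. x) S"
  by (rule C1_on_bounded_linear) (rule bounded_linear_ident)

lemma C1_on_fst: "C1_on f S \<Longrightarrow> C1_on (\<lambda>x. fst (f x)) S"
  by (rule C1_on_linear_compose) (rule bounded_linear_fst)

lemma C1_on_snd: "C1_on f S \<Longrightarrow> C1_on (\<lambda>x. snd (f x)) S"
  by (rule C1_on_linear_compose) (rule bounded_linear_snd)

lemma C1_on_bilinear:
  assumes "bounded_bilinear B" "C1_on f S" "C1_on g S"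
  shows "C1_on (\<lambda>x. B (f x) (g x)) S"
proof -
  interpret bounded_bilinear B by fact
  have "C1_on (\<lambda>p. B (fst p) (snd p)) UNIV"
  proof (rule C1_onI)
    let ?F = "\<lambda>p. (prod_left (snd p) o\<^sub>L fst_blinfun) + (prod_right (fst p) o\<^sub>L snd_blinfun)"
    show "((\<lambda>p. B (fst p) (snd p)) has_derivative blinfun_apply (?F x)) (at x)" for x
      by (rule has_derivative_eq_rhs, rule FDERIV[where f=fst and g=snd])
        (auto intro!: has_derivative_fst[OF has_derivative_ident] has_derivative_snd[OF has_derivative_ident]
           simp: blinfun.add_left blinfun_compose.rep_eq prod_left.rep_eq prod_right.rep_eq add.commute)
    show "continuous_on UNIV ?F"
      by (intro continuous_intros bounded_linear.continuous_on[OF bounded_linear_prod_left]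
            bounded_linear.continuous_on[OF bounded_linear_prod_right])
  qed
  from C1_on_compose[OF this C1_on_Pair[OF assms(2,3)]] show ?thesis by simp
qed

lemmas C1_on_scaleR = C1_on_bilinear[OF bounded_bilinear_scaleR]
lemmas C1_on_mult = C1_on_bilinear[OF bounded_bilinear_mult]
lemmas C1_on_inner = C1_on_bilinear[OF bounded_bilinear_inner]

lemma C1_on_add: "C1_on f S \<Longrightarrow> C1_on g S \<Longrightarrow> C1_on (\<lambda>x. f x + g x) S"
  using C1_on_linear_compose[OF bounded_linear_add[OF bounded_linear_fst bounded_linear_snd] C1_on_Pair[of f S g]]
  by simp

lemma C1_on_minus: "C1_on f S \<Longrightarrow> C1_on (\<lambda>x. - f x) S"
  by (rule C1_on_linear_compose[OF bounded_linear_minus[OF bounded_linear_ident]])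

lemma C1_on_diff: "C1_on f S \<Longrightarrow> C1_on g S \<Longrightarrow> C1_on (\<lambda>x. f x - g x) S"
  using C1_on_add[OF _ C1_on_minus, of f S g] by simp

lemma C1_on_sum:
  assumes "\<And>i. i \<in> I \<Longrightarrow> C1_on (f i) S"
  shows "C1_on (\<lambda>x. \<Sum>i\<in>I. f i x) S"
  using assms by (induction I rule: infinite_finite_induct) (auto intro: C1_on_const C1_on_add)

lemma C1_on_real_function:
  fixes f :: "real \<Rightarrow> real"
  assumes "\<And>x. x \<in> S \<Longrightarrow> (f has_real_derivative f' x) (at x)" "continuous_on S f'"
  shows "C1_on f S"
proof (rule C1_onI)
  show "(f has_derivative blinfun_apply (f' x *\<^sub>R id_blinfun)) (at x)" if "x \<in> S" for x
    using assms(1)[OF that] by (auto simp: has_field_derivative_def scaleR_blinfun.rep_eq)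
qed (intro continuous_intros assms)

lemma C1_on_inverse:
  fixes f :: "'a::real_normed_vector \<Rightarrow> real"
  assumes "C1_on f S" "\<And>x. x \<in> S \<Longrightarrow> f x \<noteq> 0"
  shows "C1_on (\<lambda>x. inverse (f x)) S"
proof (rule C1_on_compose[OF _ assms(1)])
  show "C1_on inverse (- {0::real})"
    by (rule C1_on_real_function[where f' = "\<lambda>x. - (inverse x ^ Suc (Suc 0))"])
      (auto intro!: continuous_intros DERIV_inverse simp del: power_Suc)
qed (use assms(2) in auto)

lemma C1_on_divide:
  fixes f g :: "'a::real_normed_vector \<Rightarrow> real"
  assumes "C1_on f S" "C1_on g S" "\<And>x. x \<in> S \<Longrightarrow> g x \<noteq> 0"
  shows "C1_on (\<lambda>x. f x / g x) S"
  unfolding divide_inverse by (intro C1_on_mult C1_on_inverse assms)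

lemma C1_on_sqrt:
  fixes f :: "'a::real_normed_vector \<Rightarrow> real"
  assumes "C1_on f S" "\<And>x. x \<in> S \<Longrightarrow> f x > 0"
  shows "C1_on (\<lambda>x. sqrt (f x)) S"
proof (rule C1_on_compose[OF _ assms(1)])
  show "C1_on sqrt {0<..}"
    by (rule C1_on_real_function[where f' = "\<lambda>x. inverse (sqrt x) / 2"])
      (auto intro!: continuous_intros DERIV_real_sqrt)
qed (use assms(2) in auto)

lemmas C1_intros = C1_on_const C1_on_id C1_on_fst C1_on_snd C1_on_Pair C1_on_add C1_on_minus C1_on_diff
  C1_on_sum C1_on_scaleR C1_on_mult C1_on_inner

text \<open>In finite dimension a field of linear maps is continuous in norm as soon as it is on each vector.\<close>

lemma C1_on_iff_Ck_on: "C1_on f S \<longleftrightarrow> Ck_on (Suc 0) f S"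
  for f :: "'a::euclidean_space \<Rightarrow> 'b::real_normed_vector"
proof
  assume C: "C1_on f S"
  then obtain f' where f': "\<And>x. x \<in> S \<Longrightarrow> (f has_derivative blinfun_apply (f' x)) (at x)" "continuous_on S f'"
    by (rule C1_onE) blast
  have "continuous_on S (\<lambda>x. frechet_derivative f (at x) v)" for v
  proof -
    have "continuous_on S (\<lambda>x. f' x v)"
      by (intro continuous_intros f')
    then show ?thesis
      by (rule continuous_on_eq) (metis f'(1) frechet_derivative_at)
  qed
  then show "Ck_on (Suc 0) f S"
    using C1_on_differentiable[OF C] by simp
next
  assume C: "Ck_on (Suc 0) f S"
  have D: "(f has_derivative frechet_derivative f (at x)) (at x)" if "x \<in> S" for x
    using C that by (simp add: frechet_derivative_works)
  show "C1_on f S"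
  proof (rule C1_onI)
    show "(f has_derivative blinfun_apply (Blinfun (frechet_derivative f (at x)))) (at x)" if "x \<in> S" for x
      using D[OF that] by (simp add: bounded_linear_Blinfun_apply has_derivative_bounded_linear)
    show "continuous_on S (\<lambda>x. Blinfun (frechet_derivative f (at x)))"
    proof (rule continuous_on_blinfun_componentwise)
      fix i :: 'a
      have "continuous_on S (\<lambda>x. frechet_derivative f (at x) i)"
        using C by simp
      then show "continuous_on S (\<lambda>x. blinfun_apply (Blinfun (frechet_derivative f (at x))) i)"
        by (rule continuous_on_eq) (simp add: bounded_linear_Blinfun_apply has_derivative_bounded_linear[OF D])
    qed
  qed
qed

lemma Ck_on_mono_set: "Ck_on k f T \<Longrightarrow> S \<subseteq> T \<Longrightarrow> Ck_on k f S"
proof (induction k arbitrary: f)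
  case 0
  then show ?case using continuous_on_subset[of T f S] by simp
next
  case (Suc k)
  then show ?case unfolding Ck_on.simps by blast
qed

lemma Ck_on_cong:
  assumes "open S" "\<And>x. x \<in> S \<Longrightarrow> g x = f x" "Ck_on k f S"
  shows "Ck_on k g S"
  using assms(2,3)
proof (induction k arbitrary: f g)
  case 0
  have "continuous_on S f" using 0(2) by simp
  then have "continuous_on S g" by (rule continuous_on_eq) (rule 0(1)[symmetric])
  then show ?case by simp
next
  case (Suc k)
  have d: "g differentiable (at x)" if "x \<in> S" for x
  proof -
    have "f differentiable (at x)"
      using Suc.prems(2) that by simp
    then obtain f' where f': "(f has_derivative f') (at x)"
      unfolding differentiable_def by blast
    have "(g has_derivative f') (at x)"
      by (rule has_derivative_transform_within_open[OF f' assms(1) that]) (simp add: Suc.prems(1))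
    then show ?thesis by (auto simp: differentiable_def)
  qed
  moreover have "Ck_on k (\<lambda>x. frechet_derivative g (at x) v) S" for v
  proof (rule Suc.IH)
    show "frechet_derivative g (at x) v = frechet_derivative f (at x) v" if "x \<in> S" for x
      using frechet_derivative_transform_within_open[OF d[OF that] assms(1) that Suc.prems(1)] by simp
    show "Ck_on k (\<lambda>x. frechet_derivative f (at x) v) S"
      using Suc.prems by simp
  qed
  ultimately show ?case by simp
qed

lemma Ck_on_Suc_imp_Ck_on: "Ck_on (Suc k) f S \<Longrightarrow> Ck_on k f S"
proof (induction k arbitrary: f)
  case 0
  then have "C1_on f S" by (simp only: C1_on_iff_Ck_on)
  then show ?case by (simp add: C1_on_continuous_on)
next
  case (Suc k)
  show ?case
    unfolding Ck_on.simps(2)[of k]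
  proof (intro conjI allI ballI)
    show "f differentiable (at x)" if "x \<in> S" for x
      using Suc.prems that by simp
    show "Ck_on k (\<lambda>x. frechet_derivative f (at x) v) S" for v
      by (rule Suc.IH) (use Suc.prems in simp)
  qed
qed

lemma C2_iff:
  "Ck_on (Suc (Suc 0)) f S \<longleftrightarrow> (\<forall>x\<in>S. f differentiable (at x)) \<and>
     (\<forall>v. C1_on (\<lambda>x. frechet_derivative f (at x) v) S)"
  unfolding Ck_on.simps(2)[of "Suc 0"] C1_on_iff_Ck_on[symmetric] by (rule refl)

declare Ck_on.simps [simp del]

lemma C2_imp_C1: "Ck_on (Suc (Suc 0)) f S \<Longrightarrow> C1_on f S"
  using C1_on_iff_Ck_on Ck_on_Suc_imp_Ck_on by blast

text \<open>A field of linear maps which is of class C^1 on each fixed vector is of class C^1 jointly in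
  the point and the vector, because it is a finite combination over a basis.\<close>

lemma C1_on_linear_field:
  fixes D :: "'p::real_normed_vector \<Rightarrow> 'a::euclidean_space \<Rightarrow> 'b::real_normed_vector"
  assumes "open S" "\<And>x. x \<in> S \<Longrightarrow> linear (D x)" "\<And>v. C1_on (\<lambda>x. D x v) S"
    and "C1_on p T" "C1_on w T" "p ` T \<subseteq> S" "open T"
  shows "C1_on (\<lambda>y. D (p y) (w y)) T"
proof (rule C1_on_cong[where f = "\<lambda>y. \<Sum>i\<in>Basis. (w y \<bullet> i) *\<^sub>R D (p y) i"])
  show "C1_on (\<lambda>y. \<Sum>i\<in>Basis. (w y \<bullet> i) *\<^sub>R D (p y) i) T"
    by (intro C1_intros C1_on_compose[OF assms(3,4)] assms)
  show "D (p y) (w y) = (\<Sum>i\<in>Basis. (w y \<bullet> i) *\<^sub>R D (p y) i)" if "y \<in> T" for y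
  proof -
    have l: "linear (D (p y))" using assms(2,6) that by blast
    show ?thesis
      using linear_sum[OF l, of "\<lambda>i. (w y \<bullet> i) *\<^sub>R i" Basis] linear_cmul[OF l]
      by (simp add: euclidean_representation)
  qed
qed fact

lemma C1_on_frechet_derivative:
  fixes f :: "'a::euclidean_space \<Rightarrow> 'b::real_normed_vector"
  assumes "Ck_on (Suc (Suc 0)) f S" "open S" "C1_on p T" "C1_on w T" "p ` T \<subseteq> S" "open T"
  shows "C1_on (\<lambda>y. frechet_derivative f (at (p y)) (w y)) T"
proof (rule C1_on_linear_field[OF assms(2) _ _ assms(3-6)])
  show "linear (frechet_derivative f (at x))" if "x \<in> S" for x
    using assms(1) that unfolding C2_iff by (blast intro: linear_frechet_derivative)
  show "C1_on (\<lambda>x. frechet_derivative f (at x) v) S" for v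
    using assms(1) unfolding C2_iff by blast
qed

lemma C2_compose:
  fixes f :: "'a::euclidean_space \<Rightarrow> 'b::euclidean_space" and g :: "'b \<Rightarrow> 'c::real_normed_vector"
  assumes "Ck_on (Suc (Suc 0)) g T" "Ck_on (Suc (Suc 0)) f S" "f ` S \<subseteq> T" "open S" "open T"
  shows "Ck_on (Suc (Suc 0)) (g \<circ> f) S"
  unfolding C2_iff
proof (intro conjI ballI allI)
  have f: "f differentiable (at x)" "g differentiable (at (f x))" if "x \<in> S" for x
    using assms(1-3) that unfolding C2_iff by blast+
  show "(g \<circ> f) differentiable (at x)" if "x \<in> S" for x
    using f[OF that] by (simp add: differentiable_chain_at)
  show "C1_on (\<lambda>x. frechet_derivative (g \<circ> f) (at x) v) S" for v
  proof (rule C1_on_cong[OF _ assms(4)])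
    show "C1_on (\<lambda>x. frechet_derivative g (at (f x)) (frechet_derivative f (at x) v)) S"
      using assms(2) unfolding C2_iff
      by (intro C1_on_frechet_derivative[OF assms(1,5) C2_imp_C1[OF assms(2)] _ assms(3,4)]) blast
    show "frechet_derivative (g \<circ> f) (at x) v
        = frechet_derivative g (at (f x)) (frechet_derivative f (at x) v)" if "x \<in> S" for x
      using frechet_derivative_compose[OF f(1)[OF that] f(2)[OF that]] by simp
  qed
qed

subsection \<open>Symmetry of second derivatives\<close>

text \<open>The mean value theorem is applied first in the direction u, then in the direction v.\<close>

lemma mixed_difference_mean_value:
  fixes f :: "'a::euclidean_space \<Rightarrow> real"
  assumes C2: "Ck_on (Suc (Suc 0)) f (ball x r)" and e: "e > 0" "e * (norm u + norm v) < r"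
  shows "\<exists>p \<in> cball x (e * (norm u + norm v)).
      f (x + e *\<^sub>R u + e *\<^sub>R v) - f (x + e *\<^sub>R u) - f (x + e *\<^sub>R v) + f x
      = e * e * frechet_derivative (\<lambda>y. frechet_derivative f (at y) u) (at p) v"
proof -
  have inball: "x + s *\<^sub>R u + t *\<^sub>R v \<in> cball x (e * (norm u + norm v))" if "0 \<le> s" "s \<le> e" "0 \<le> t" "t \<le> e" for s t
  proof -
    have "norm (s *\<^sub>R u + t *\<^sub>R v) \<le> s * norm u + t * norm v"
      using norm_triangle_ineq[of "s *\<^sub>R u" "t *\<^sub>R v"] that by simp
    also have "\<dots> \<le> e * norm u + e * norm v"
      using that by (intro add_mono mult_right_mono) auto
    finally have *: "norm (s *\<^sub>R u + t *\<^sub>R v) \<le> e * (norm u + norm v)" by (simp add: algebra_simps)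
    have "x - (x + s *\<^sub>R u + t *\<^sub>R v) = - (s *\<^sub>R u + t *\<^sub>R v)" by simp
    then show ?thesis using * by (simp only: mem_cball dist_norm norm_minus_cancel)
  qed
  have sub: "cball x (e * (norm u + norm v)) \<subseteq> ball x r"
    using e by auto
  have Df: "(f has_derivative frechet_derivative f (at y)) (at y)"
    and DD: "((\<lambda>y. frechet_derivative f (at y) u) has_derivative
        frechet_derivative (\<lambda>y. frechet_derivative f (at y) u) (at y)) (at y)" if "y \<in> ball x r" for y
    using C2 that by (auto simp: C2_iff frechet_derivative_works[symmetric] intro: C1_on_differentiable)
  have d1: "((\<lambda>s. f (x + s *\<^sub>R u + t *\<^sub>R v)) has_real_derivative
        frechet_derivative f (at (x + s *\<^sub>R u + t *\<^sub>R v)) u) (at s)" if "0 \<le> s" "s \<le> e" "0 \<le> t" "t \<le> e" for s t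
  proof -
    have in': "x + s *\<^sub>R u + t *\<^sub>R v \<in> ball x r" using inball[OF that] sub by blast
    have "((\<lambda>s. f (x + s *\<^sub>R u + t *\<^sub>R v)) has_derivative
        (\<lambda>h. frechet_derivative f (at (x + s *\<^sub>R u + t *\<^sub>R v)) (h *\<^sub>R u))) (at s)"
      by (rule has_derivative_compose[where f="\<lambda>s. x + s *\<^sub>R u + t *\<^sub>R v", OF _ Df[OF in']]) (auto intro!: derivative_eq_intros)
    moreover have "linear (frechet_derivative f (at (x + s *\<^sub>R u + t *\<^sub>R v)))"
      using Df[OF in'] has_derivative_linear by blast
    ultimately show ?thesis
      by (auto simp: has_field_derivative_def linear_cmul elim!: has_derivative_eq_rhs)
  qed
  define \<phi> where "\<phi> s = f (x + s *\<^sub>R u + e *\<^sub>R v) - f (x + s *\<^sub>R u + 0 *\<^sub>R v)" for s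
  have "\<exists>s>0. s < e \<and> \<phi> e - \<phi> 0 = (e - 0) * (frechet_derivative f (at (x + s *\<^sub>R u + e *\<^sub>R v)) u
          - frechet_derivative f (at (x + s *\<^sub>R u + 0 *\<^sub>R v)) u)"
    unfolding \<phi>_def using e
    by (intro MVT2 DERIV_diff d1) auto
  then obtain s where s: "s > 0" "s < e" "\<phi> e - \<phi> 0 = e * (frechet_derivative f (at (x + s *\<^sub>R u + e *\<^sub>R v)) u
          - frechet_derivative f (at (x + s *\<^sub>R u + 0 *\<^sub>R v)) u)" by auto
  have d2: "((\<lambda>t. frechet_derivative f (at (x + s *\<^sub>R u + t *\<^sub>R v)) u) has_real_derivative
        frechet_derivative (\<lambda>y. frechet_derivative f (at y) u) (at (x + s *\<^sub>R u + t *\<^sub>R v)) v) (at t)"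
    if "0 \<le> t" "t \<le> e" for t
  proof -
    have in': "x + s *\<^sub>R u + t *\<^sub>R v \<in> ball x r" using inball[of s t] sub that s by auto
    have "((\<lambda>t. frechet_derivative f (at (x + s *\<^sub>R u + t *\<^sub>R v)) u) has_derivative
        (\<lambda>h. frechet_derivative (\<lambda>y. frechet_derivative f (at y) u) (at (x + s *\<^sub>R u + t *\<^sub>R v)) (h *\<^sub>R v))) (at t)"
      by (rule has_derivative_compose[where f="\<lambda>t. x + s *\<^sub>R u + t *\<^sub>R v", OF _ DD[OF in']]) (auto intro!: derivative_eq_intros)
    moreover have "linear (frechet_derivative (\<lambda>y. frechet_derivative f (at y) u) (at (x + s *\<^sub>R u + t *\<^sub>R v)))"
      using DD[OF in'] has_derivative_linear by blast
    ultimately show ?thesis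
      by (auto simp: has_field_derivative_def linear_cmul elim!: has_derivative_eq_rhs)
  qed
  have "\<exists>t>0. t < e \<and> frechet_derivative f (at (x + s *\<^sub>R u + e *\<^sub>R v)) u
          - frechet_derivative f (at (x + s *\<^sub>R u + 0 *\<^sub>R v)) u
     = (e - 0) * frechet_derivative (\<lambda>y. frechet_derivative f (at y) u) (at (x + s *\<^sub>R u + t *\<^sub>R v)) v"
    using e by (intro MVT2 d2) auto
  then obtain t where t: "t > 0" "t < e" "frechet_derivative f (at (x + s *\<^sub>R u + e *\<^sub>R v)) u
          - frechet_derivative f (at (x + s *\<^sub>R u + 0 *\<^sub>R v)) u
     = e * frechet_derivative (\<lambda>y. frechet_derivative f (at y) u) (at (x + s *\<^sub>R u + t *\<^sub>R v)) v"
    by auto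
  show ?thesis
    using inball[of s t] s t by (intro bexI[of _ "x + s *\<^sub>R u + t *\<^sub>R v"]) (auto simp: \<phi>_def algebra_simps)
qed

text \<open>Both mixed derivatives are limits of the same second difference over shrinking
  parallelograms.\<close>

lemma symmetric_second_derivative_real:
  fixes f :: "'a::euclidean_space \<Rightarrow> real"
  assumes C2: "Ck_on (Suc (Suc 0)) f S" and S: "open S" "x \<in> S"
  shows "frechet_derivative (\<lambda>y. frechet_derivative f (at y) u) (at x) v
       = frechet_derivative (\<lambda>y. frechet_derivative f (at y) v) (at x) u" (is "?A u v x = ?A v u x")
proof -
  obtain r where r: "r > 0" "ball x r \<subseteq> S"
    using S openE by blast
  have C2': "Ck_on (Suc (Suc 0)) f (ball x r)"
    using C2 r(2) Ck_on_mono_set by blast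
  have cont: "continuous (at x) (?A u v)" for u v
  proof -
    have "Ck_on (Suc 0) (\<lambda>y. frechet_derivative f (at y) u) S" using C2 by (simp add: Ck_on.simps)
    then have "continuous_on S (?A u v)" by (simp add: Ck_on.simps)
    then show ?thesis using S continuous_on_eq_continuous_at by blast
  qed
  show ?thesis
  proof (rule ccontr)
    assume neq: "?A u v x \<noteq> ?A v u x"
    define d where "d = dist (?A u v x) (?A v u x) / 2"
    have d: "d > 0" using neq by (simp add: d_def)
    obtain k1 where k1: "k1 > 0" "\<And>y. dist y x < k1 \<Longrightarrow> dist (?A u v y) (?A u v x) < d"
      using cont[of u v] d unfolding continuous_at_eps_delta by (metis dist_norm)
    obtain k2 where k2: "k2 > 0" "\<And>y. dist y x < k2 \<Longrightarrow> dist (?A v u y) (?A v u x) < d"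
      using cont[of v u, unfolded continuous_at_eps_delta] d by blast
    define k where "k = min r (min k1 k2)"
    have "k > 0" using r k1 k2 by (simp add: k_def)
    define e where "e = k / (2 * (norm u + norm v + 1))"
    have e: "e > 0" "e * (norm u + norm v) < k"
    proof -
      show "e > 0" using \<open>k > 0\<close> by (auto simp: e_def intro!: divide_pos_pos add_nonneg_pos)
      then have "0 \<le> e * (norm u + norm v)" by simp
      then have "e * (norm u + norm v) < 2 * e * (norm u + norm v + 1)"
        using \<open>e > 0\<close> unfolding distrib_left by linarith
      also have "\<dots> = k"
      proof -
        have "norm u + norm v + 1 > 0" by (simp add: add_nonneg_pos)
        then show ?thesis unfolding e_def by (simp add: divide_simps)
      qed
      finally show "e * (norm u + norm v) < k" .
    qed
    obtain p where p: "p \<in> cball x (e * (norm u + norm v))"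
      "f (x + e *\<^sub>R u + e *\<^sub>R v) - f (x + e *\<^sub>R u) - f (x + e *\<^sub>R v) + f x = e * e * ?A u v p"
      using mixed_difference_mean_value[OF C2' e(1), of u v] e(2) by (auto simp: k_def)
    obtain q where q: "q \<in> cball x (e * (norm v + norm u))"
      "f (x + e *\<^sub>R v + e *\<^sub>R u) - f (x + e *\<^sub>R v) - f (x + e *\<^sub>R u) + f x = e * e * ?A v u q"
      using mixed_difference_mean_value[OF C2' e(1), of v u] e(2) by (auto simp: k_def add.commute)
    have "e * e * ?A u v p = e * e * ?A v u q"
      using p(2) q(2) by (simp add: algebra_simps)
    then have "?A u v p = ?A v u q" using e by simp
    moreover have "dist (?A u v p) (?A u v x) < d" "dist (?A v u q) (?A v u x) < d"
      using k1(2)[of p] k2(2)[of q] p(1) q(1) e(2) by (auto simp: k_def dist_commute add.commute)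
    ultimately show False
      using dist_triangle_half_r[of "?A u v p" "?A u v x" "dist (?A u v x) (?A v u x)" "?A v u x"]
      unfolding d_def by simp
  qed
qed

lemma symmetric_second_derivative:
  fixes f :: "'a::euclidean_space \<Rightarrow> 'b::euclidean_space"
  assumes C2: "Ck_on (Suc (Suc 0)) f S" and S: "open S" "x \<in> S"
  shows "frechet_derivative (\<lambda>y. frechet_derivative f (at y) u) (at x) v
       = frechet_derivative (\<lambda>y. frechet_derivative f (at y) v) (at x) u"
proof (rule euclidean_eqI)
  fix i :: 'b
  have comp: "frechet_derivative (\<lambda>y. h y \<bullet> i) (at y) w = frechet_derivative h (at y) w \<bullet> i"
    if "h differentiable (at y)" for h :: "'a \<Rightarrow> 'b" and y w
    using frechet_derivative_at[OF has_derivative_inner_left[OF that[unfolded frechet_derivative_works], of i], symmetric]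
    by simp
  have df: "f differentiable (at y)" "(\<lambda>y. frechet_derivative f (at y) w) differentiable (at y)" if "y \<in> S" for y w
    using C2 that unfolding C2_iff by (blast intro: C1_on_differentiable)+
  have C1: "C1_on (\<lambda>y. frechet_derivative (\<lambda>y. f y \<bullet> i) (at y) w) S" for w
  proof (rule C1_on_cong[OF _ S(1)])
    show "C1_on (\<lambda>y. frechet_derivative f (at y) w \<bullet> i) S"
      using C2 by (intro C1_intros) (auto simp: C2_iff)
  qed (use comp df in auto)
  have C2i: "Ck_on (Suc (Suc 0)) (\<lambda>y. f y \<bullet> i) S"
    unfolding C2_iff using C1 df(1) unfolding differentiable_def by (blast intro: has_derivative_inner_left)
  have "frechet_derivative (\<lambda>y. frechet_derivative (\<lambda>y. f y \<bullet> i) (at y) w) (at x) z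
      = frechet_derivative (\<lambda>y. frechet_derivative f (at y) w) (at x) z \<bullet> i" for w z
  proof -
    have "frechet_derivative (\<lambda>y. frechet_derivative (\<lambda>y. f y \<bullet> i) (at y) w) (at x)
        = frechet_derivative (\<lambda>y. frechet_derivative f (at y) w \<bullet> i) (at x)"
      using C1 S comp df by (intro frechet_derivative_transform_within_open) (auto intro: C1_on_differentiable)
    then show ?thesis using comp[OF df(2)[OF S(2)]] by simp
  qed
  then show "frechet_derivative (\<lambda>y. frechet_derivative f (at y) u) (at x) v \<bullet> i
       = frechet_derivative (\<lambda>y. frechet_derivative f (at y) v) (at x) u \<bullet> i"
    using symmetric_second_derivative_real[OF C2i S, of u v] by simp
qed

section \<open>Ordinary differential equations with a right-hand side of class C^1\<close>

subsection \<open>Uniqueness\<close>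

lemma C1_on_locally_lipschitz:
  fixes F :: "'a::euclidean_space \<Rightarrow> 'b::euclidean_space"
  assumes "C1_on F U" "open U" "p \<in> U"
  obtains r L where "r > 0" "cball p r \<subseteq> U" "L \<ge> 0"
    "\<And>x y. x \<in> cball p r \<Longrightarrow> y \<in> cball p r \<Longrightarrow> norm (F x - F y) \<le> L * norm (x - y)"
proof -
  obtain F' where F': "\<And>x. x \<in> U \<Longrightarrow> (F has_derivative blinfun_apply (F' x)) (at x)" "continuous_on U F'"
    using assms(1) by (rule C1_onE) blast
  obtain r where r: "r > 0" "cball p r \<subseteq> U"
    using open_contains_cball_eq[OF assms(2), rule_format, of p] assms(3) by auto
  have "compact (F' ` cball p r)"
    using continuous_on_subset[OF F'(2) r(2)] by (simp add: compact_continuous_image)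
  then obtain L where L: "\<And>x. x \<in> cball p r \<Longrightarrow> norm (F' x) \<le> L"
    using compact_imp_bounded[of "F' ` cball p r"] unfolding bounded_iff by (metis imageI)
  show ?thesis
  proof (rule that[OF r])
    show "L \<ge> 0"
      using order_trans[OF norm_ge_zero L[of p]] r(1) by simp
    show "norm (F x - F y) \<le> L * norm (x - y)" if "x \<in> cball p r" "y \<in> cball p r" for x y
    proof (rule differentiable_bound[OF convex_cball _ _ that])
      show "(F has_derivative blinfun_apply (F' z)) (at z within cball p r)" if "z \<in> cball p r" for z
        using F'(1)[of z] that r(2) has_derivative_at_withinI by blast
      show "onorm (blinfun_apply (F' z)) \<le> L" if "z \<in> cball p r" for z
        using L[OF that] by (simp add: norm_blinfun.rep_eq)
    qed
  qed
qed

text \<open>The squared distance w of two solutions satisfies \<bar>w'\<bar> \<le> 2 L w, where L is a local Lipschitz constant,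
  so w times a suitable exponential is monotone on either side of t0.\<close>

lemma ode_locally_unique:
  fixes F :: "'a::euclidean_space \<Rightarrow> 'a"
  assumes F: "C1_on F U" "open U" and J: "open J" "t0 \<in> J"
    and y: "\<And>t. t \<in> J \<Longrightarrow> y t \<in> U \<and> (y has_vector_derivative F (y t)) (at t)"
    and z: "\<And>t. t \<in> J \<Longrightarrow> z t \<in> U \<and> (z has_vector_derivative F (z t)) (at t)"
    and eq: "y t0 = z t0"
  shows "\<exists>e>0. \<forall>t. \<bar>t - t0\<bar> < e \<longrightarrow> t \<in> J \<and> y t = z t"
proof -
  obtain r L where r: "r > 0" "cball (y t0) r \<subseteq> U" and L: "L \<ge> 0"
    "\<And>p q. p \<in> cball (y t0) r \<Longrightarrow> q \<in> cball (y t0) r \<Longrightarrow> norm (F p - F q) \<le> L * norm (p - q)"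
    using C1_on_locally_lipschitz[OF F, of "y t0"] y J by blast
  have "isCont y t0" "isCont z t0"
    using y z J has_vector_derivative_continuous by blast+
  then have "eventually (\<lambda>t. y t \<in> ball (y t0) r) (at t0)" "eventually (\<lambda>t. z t \<in> ball (y t0) r) (at t0)"
    "eventually (\<lambda>t. t \<in> J) (at t0)"
    using r(1) J eq topological_tendstoD[of y "y t0" "at t0" "ball (y t0) r"]
      topological_tendstoD[of z "y t0" "at t0" "ball (y t0) r"] eventually_at_in_open'[of J t0]
    by (simp_all add: isCont_def)
  then have "eventually (\<lambda>t. y t \<in> cball (y t0) r \<and> z t \<in> cball (y t0) r \<and> t \<in> J) (at t0)"
    by eventually_elim auto
  then obtain e where e: "e > 0" "\<And>t. t \<noteq> t0 \<Longrightarrow> \<bar>t - t0\<bar> < e \<Longrightarrow> y t \<in> cball (y t0) r \<and> z t \<in> cball (y t0) r \<and> t \<in> J"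
    unfolding eventually_at by (auto simp: dist_real_def)
  have in_ball: "y t \<in> cball (y t0) r \<and> z t \<in> cball (y t0) r \<and> t \<in> J" if "\<bar>t - t0\<bar> < e" for t
    using e(2)[OF _ that] r(1) eq J by (cases "t = t0") auto
  define w where "w t = (y t - z t) \<bullet> (y t - z t)" for t
  define w' where "w' t = 2 * ((F (y t) - F (z t)) \<bullet> (y t - z t))" for t
  have w': "(w has_real_derivative w' t) (at t)" if "\<bar>t - t0\<bar> < e" for t
  proof -
    have "((\<lambda>t. y t - z t) has_vector_derivative F (y t) - F (z t)) (at t)"
      using y z in_ball[OF that] by (blast intro: has_vector_derivative_diff)
    then have "(w has_derivative (\<lambda>h. (y t - z t) \<bullet> (h *\<^sub>R (F (y t) - F (z t))) + (h *\<^sub>R (F (y t) - F (z t))) \<bullet> (y t - z t))) (at t)"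
      unfolding w_def has_vector_derivative_def by (intro has_derivative_inner)
    moreover have "(\<lambda>h. (y t - z t) \<bullet> (h *\<^sub>R (F (y t) - F (z t))) + (h *\<^sub>R (F (y t) - F (z t))) \<bullet> (y t - z t)) = (*) (w' t)"
      by (auto simp: w'_def inner_commute algebra_simps)
    ultimately show ?thesis by (simp add: has_field_derivative_def)
  qed
  have w'_le: "\<bar>w' t\<bar> \<le> 2 * L * w t" if "\<bar>t - t0\<bar> < e" for t
  proof -
    have "\<bar>(F (y t) - F (z t)) \<bullet> (y t - z t)\<bar> \<le> norm (F (y t) - F (z t)) * norm (y t - z t)"
      by (rule Cauchy_Schwarz_ineq2)
    also have "\<dots> \<le> (L * norm (y t - z t)) * norm (y t - z t)"
      using L(2) in_ball[OF that] by (intro mult_right_mono) auto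
    finally show ?thesis
      by (simp add: w'_def w_def abs_mult power2_norm_eq_inner[symmetric] power2_eq_square mult_ac)
  qed
  have w0: "w t0 = 0" using eq by (simp add: w_def)
  have "w t \<le> 0" if t: "\<bar>t - t0\<bar> < e" for t
  proof (cases "t0 \<le> t")
    case True
    have "w t * exp (- 2 * L * (t - t0)) \<le> w t0 * exp (- 2 * L * (t0 - t0))"
    proof (rule DERIV_nonpos_imp_nonincreasing[OF True])
      fix s assume s: "t0 \<le> s" "s \<le> t"
      then have s': "\<bar>s - t0\<bar> < e" using t by auto
      have "((\<lambda>s. w s * exp (- 2 * L * (s - t0))) has_real_derivative
          (w' s - 2 * L * w s) * exp (- 2 * L * (s - t0))) (at s)"
        by (rule derivative_eq_intros w'[OF s'] refl)+ (simp add: algebra_simps)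
      moreover have "(w' s - 2 * L * w s) * exp (- 2 * L * (s - t0)) \<le> 0"
        using w'_le[OF s'] by (intro mult_nonpos_nonneg) auto
      ultimately show "\<exists>y. ((\<lambda>s. w s * exp (- 2 * L * (s - t0))) has_real_derivative y) (at s) \<and> y \<le> 0"
        by blast
    qed
    then show ?thesis using w0 by (simp add: mult_le_0_iff)
  next
    case False
    then have le: "t \<le> t0" by simp
    have "w t * exp (2 * L * (t - t0)) \<le> w t0 * exp (2 * L * (t0 - t0))"
    proof (rule DERIV_nonneg_imp_nondecreasing[OF le])
      fix s assume s: "t \<le> s" "s \<le> t0"
      then have s': "\<bar>s - t0\<bar> < e" using t by auto
      have "((\<lambda>s. w s * exp (2 * L * (s - t0))) has_real_derivative
          (w' s + 2 * L * w s) * exp (2 * L * (s - t0))) (at s)"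
        by (rule derivative_eq_intros w'[OF s'] refl)+ (simp add: algebra_simps)
      moreover have "(w' s + 2 * L * w s) * exp (2 * L * (s - t0)) \<ge> 0"
        using w'_le[OF s'] by (intro mult_nonneg_nonneg) auto
      ultimately show "\<exists>y. ((\<lambda>s. w s * exp (2 * L * (s - t0))) has_real_derivative y) (at s) \<and> 0 \<le> y"
        by blast
    qed
    then show ?thesis using w0 by (simp add: mult_le_0_iff)
  qed
  then have "y t = z t" if "\<bar>t - t0\<bar> < e" for t
    using that by (simp add: w_def inner_eq_zero_iff) (metis eq_iff_diff_eq_0 inner_eq_zero_iff inner_ge_zero order_antisym)
  then show ?thesis using e(1) in_ball by blast
qed

lemma ode_unique:
  fixes F :: "'a::euclidean_space \<Rightarrow> 'a"
  assumes F: "C1_on F U" "open U" and J: "open J" "connected J" "t0 \<in> J"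
    and y: "\<And>t. t \<in> J \<Longrightarrow> y t \<in> U \<and> (y has_vector_derivative F (y t)) (at t)"
    and z: "\<And>t. t \<in> J \<Longrightarrow> z t \<in> U \<and> (z has_vector_derivative F (z t)) (at t)"
    and eq: "y t0 = z t0" and t: "t \<in> J"
  shows "y t = z t"
proof -
  let ?A = "{t \<in> J. y t = z t}" and ?B = "{t \<in> J. y t \<noteq> z t}"
  have "open ?A"
  proof (subst open_dist, intro ballI)
    fix t assume "t \<in> ?A"
    then have "t \<in> J" "y t = z t" by auto
    from ode_locally_unique[OF F J(1) this(1) y z this(2)] obtain e where
      "e > 0" "\<forall>s. \<bar>s - t\<bar> < e \<longrightarrow> s \<in> J \<and> y s = z s" by blast
    then show "\<exists>e>0. \<forall>s. dist s t < e \<longrightarrow> s \<in> ?A"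
      by (auto simp: dist_real_def)
  qed
  moreover have "open ?B"
  proof -
    have "continuous_on J y" "continuous_on J z"
      by (intro continuous_at_imp_continuous_on ballI; meson y z has_vector_derivative_continuous)+
    then have "continuous_on J (\<lambda>t. y t - z t)" by (intro continuous_intros)
    then have "open (J \<inter> (\<lambda>t. y t - z t) -` (- {0}))"
      using J(1) by (intro continuous_open_preimage) auto
    also have "J \<inter> (\<lambda>t. y t - z t) -` (- {0}) = ?B" by auto
    finally show ?thesis .
  qed
  ultimately have "?B \<inter> J = {}"
    using connectedD[OF J(2), of ?A ?B] J(3) eq by blast
  then show ?thesis using t by blast
qed

subsection \<open>Integral equations on short intervals\<close>

text \<open>The oriented integral from 0 to t, as a difference of integrals from the left end point, so
  that both signs of t are treated at once.\<close>

definition vint :: "real \<Rightarrow> (real \<Rightarrow> 'b::banach) \<Rightarrow> real \<Rightarrow> 'b" where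
  "vint T u t = integral {-T..t} u - integral {-T..0} u"

text \<open>The factor 3 T, instead of T, comes from estimating the two integrals separately.\<close>

lemma vint_norm_le:
  fixes u :: "real \<Rightarrow> 'b::banach"
  assumes "continuous_on {-T..T} u" "\<And>s. s \<in> {-T..T} \<Longrightarrow> norm (u s) \<le> B" "t \<in> {-T..T}"
  shows "norm (vint T u t) \<le> 3 * T * B"
proof -
  have T: "T \<ge> 0" using assms(3) by auto
  have B: "B \<ge> 0" using assms(2)[OF assms(3)] norm_ge_zero order_trans by blast
  have "norm (integral {-T..t} u) \<le> B * (t - (-T))" "norm (integral {-T..0} u) \<le> B * (0 - (-T))"
    using assms T by (intro integral_bound continuous_on_subset[OF assms(1)]; auto)+
  moreover have "B * (t - (-T)) \<le> B * (2 * T)"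
    using assms(3) B by (intro mult_left_mono) auto
  ultimately show ?thesis
    unfolding vint_def using norm_triangle_ineq4[of "integral {-T..t} u" "integral {-T..0} u"]
    by (simp add: algebra_simps)
qed

lemma vint_diff:
  fixes u w :: "real \<Rightarrow> 'b::banach"
  assumes "continuous_on {-T..T} u" "continuous_on {-T..T} w" "t \<in> {-T..T}"
  shows "vint T (\<lambda>s. u s - w s) t = vint T u t - vint T w t"
proof -
  have *: "v integrable_on {-T..r}" if "continuous_on {-T..T} v" "r \<in> {-T..T}" for v :: "real \<Rightarrow> 'b" and r
    using that by (intro integrable_continuous_real continuous_on_subset[OF that(1)]) auto
  have "0 \<in> {-T..T}" using assms(3) by auto
  then show ?thesis
    unfolding vint_def using assms by (simp add: integral_diff *)
qed

lemma vint_blinfun_apply: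
  fixes u :: "real \<Rightarrow> ('a::real_normed_vector \<Rightarrow>\<^sub>L 'b::banach)"
  assumes "continuous_on {-T..T} u" "t \<in> {-T..T}"
  shows "blinfun_apply (vint T u t) h = vint T (\<lambda>s. blinfun_apply (u s) h) t"
proof -
  have *: "u integrable_on {-T..r}" if "r \<in> {-T..T}" for r
    using that by (intro integrable_continuous_real continuous_on_subset[OF assms(1)]) auto
  have "0 \<in> {-T..T}" using assms(2) by auto
  then show ?thesis
    unfolding vint_def using assms(2) by (simp add: blinfun.diff_left blinfun_apply_integral *)
qed

lemma continuous_on_vint:
  fixes u :: "real \<Rightarrow> 'b::banach"
  assumes "continuous_on {-T..T} u"
  shows "continuous_on {-T..T} (vint T u)"
  unfolding vint_def using assms
  by (intro continuous_intros indefinite_integral_continuous_1 integrable_continuous_real)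

lemma vint_has_vector_derivative:
  fixes u :: "real \<Rightarrow> 'b::banach"
  assumes "continuous_on {-T..T} u" "\<bar>t\<bar> < T"
  shows "(vint T u has_vector_derivative u t) (at t)"
proof -
  have "((\<lambda>t. integral {-T..t} u) has_vector_derivative u t) (at t within {-T..T})"
    using assms by (intro integral_has_vector_derivative) auto
  then have "((\<lambda>t. integral {-T..t} u) has_vector_derivative u t) (at t)"
    using assms(2) at_within_interior[of t "{-T..T}"] by (simp add: abs_less_iff)
  then show ?thesis
    unfolding vint_def by (auto intro!: derivative_eq_intros)
qed

text \<open>On a short interval the integral inequality can be absorbed into its left-hand side. All
  estimates for the flow rest on this substitute for Gronwall's inequality.\<close>

lemma vint_absorb:
  fixes u h :: "real \<Rightarrow> 'b::banach"
  assumes T: "T > 0" "4 * T * L \<le> 1" "0 \<le> L"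
    and u: "continuous_on {-T..T} u" and h: "continuous_on {-T..T} h"
    and le: "\<And>t. t \<in> {-T..T} \<Longrightarrow> norm (u t) \<le> a + norm (vint T h t)"
    and hle: "\<And>t. t \<in> {-T..T} \<Longrightarrow> norm (h t) \<le> L * norm (u t) + b"
    and t: "t \<in> {-T..T}"
  shows "norm (u t) \<le> 4 * a + 12 * T * b"
proof -
  obtain m where m: "m \<in> {-T..T}" "\<And>t. t \<in> {-T..T} \<Longrightarrow> norm (u t) \<le> norm (u m)"
  proof -
    have "continuous_on {-T..T} (\<lambda>t. norm (u t))" using u by (rule continuous_on_norm)
    then have "\<exists>m\<in>{-T..T}. \<forall>t\<in>{-T..T}. norm (u t) \<le> norm (u m)"
      using T(1) by (intro continuous_attains_sup) auto
    then show ?thesis using that by blast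
  qed
  have "norm (vint T h m) \<le> 3 * T * (L * norm (u m) + b)"
  proof (rule vint_norm_le[OF h _ m(1)])
    fix s assume s: "s \<in> {-T..T}"
    have "L * norm (u s) \<le> L * norm (u m)" using m(2)[OF s] T(3) by (rule mult_left_mono)
    then show "norm (h s) \<le> L * norm (u m) + b" using hle[OF s] by linarith
  qed
  moreover have "3 * T * (L * norm (u m)) \<le> 3 / 4 * norm (u m)"
    using mult_right_mono[OF T(2), of "norm (u m)"] by (simp add: algebra_simps)
  ultimately have "norm (u m) \<le> 4 * a + 12 * T * b"
    using le[OF m(1)] by (simp add: algebra_simps)
  then show ?thesis using m(2)[OF t] by linarith
qed

text \<open>Banach's fixed point theorem in the space of bounded continuous functions on the real line; outside
  the interval the candidate solutions are continued as constants.\<close>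

lemma integral_equation_solution:
  fixes f :: "real \<Rightarrow> 'b::banach \<Rightarrow> 'b"
  assumes T: "T > 0" "4 * T * L \<le> 1" "0 \<le> L"
    and cont: "\<And>u. continuous_on {-T..T} u \<Longrightarrow> continuous_on {-T..T} (\<lambda>t. f t (u t))"
    and lip: "\<And>t x y. t \<in> {-T..T} \<Longrightarrow> norm (f t x - f t y) \<le> L * norm (x - y)"
  shows "\<exists>y. continuous_on {-T..T} y \<and> (\<forall>t\<in>{-T..T}. y t = z + vint T (\<lambda>s. f s (y s)) t)"
proof -
  define cl where "cl t = max (-T) (min T t)" for t
  have cl: "cl t \<in> {-T..T}" "t \<in> {-T..T} \<Longrightarrow> cl t = t" for t
    using T by (auto simp: cl_def)
  have ccl: "continuous_on UNIV cl"
    unfolding cl_def by (intro continuous_intros)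
  define \<Phi> where "\<Phi> u = Bcontfun (\<lambda>t. z + vint T (\<lambda>s. f s (apply_bcontfun u s)) (cl t))" for u
  have cu: "continuous_on {-T..T} (\<lambda>s. f s (apply_bcontfun u s))" for u
    by (rule cont) simp
  have bc: "(\<lambda>t. z + vint T (\<lambda>s. f s (apply_bcontfun u s)) (cl t)) \<in> bcontfun" for u
  proof -
    have "continuous_on UNIV (\<lambda>t. vint T (\<lambda>s. f s (apply_bcontfun u s)) (cl t))"
      using cl by (intro continuous_on_compose2[OF continuous_on_vint[OF cu] ccl]) auto
    moreover have "bounded (vint T (\<lambda>s. f s (apply_bcontfun u s)) ` {-T..T})"
      by (intro compact_imp_bounded compact_continuous_image continuous_on_vint cu) simp
    then obtain B where B: "\<And>t. t \<in> {-T..T} \<Longrightarrow> norm (vint T (\<lambda>s. f s (apply_bcontfun u s)) t) \<le> B"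
      unfolding bounded_iff by blast
    ultimately show ?thesis
    proof (intro bcontfun_normI[where b = "norm z + B"] continuous_intros)
      fix t
      show "norm (z + vint T (\<lambda>s. f s (apply_bcontfun u s)) (cl t)) \<le> norm z + B"
        using B[OF cl(1)[of t]] norm_triangle_ineq order_trans add_left_mono by meson
    qed
  qed
  have app: "apply_bcontfun (\<Phi> u) t = z + vint T (\<lambda>s. f s (apply_bcontfun u s)) (cl t)" for u t
    unfolding \<Phi>_def using bc by (simp add: Bcontfun_inverse)
  have "dist (\<Phi> u) (\<Phi> w) \<le> 3 / 4 * dist u w" for u w
  proof (rule dist_bound)
    fix t
    have "dist (apply_bcontfun (\<Phi> u) t) (apply_bcontfun (\<Phi> w) t)
        = norm (vint T (\<lambda>s. f s (apply_bcontfun u s) - f s (apply_bcontfun w s)) (cl t))"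
      by (simp add: app dist_norm vint_diff[OF cu cu cl(1)])
    also have "\<dots> \<le> 3 * T * (L * dist u w)"
    proof (rule vint_norm_le[OF _ _ cl(1)])
      fix s assume s: "s \<in> {-T..T}"
      have "norm (f s (apply_bcontfun u s) - f s (apply_bcontfun w s)) \<le> L * dist (apply_bcontfun u s) (apply_bcontfun w s)"
        using lip[OF s] by (simp add: dist_norm)
      also have "\<dots> \<le> L * dist u w"
        using T(3) by (intro mult_left_mono dist_bounded)
      finally show "norm (f s (apply_bcontfun u s) - f s (apply_bcontfun w s)) \<le> L * dist u w" .
    qed (intro continuous_intros cu)
    also have "\<dots> \<le> 3 / 4 * dist u w"
      using mult_right_mono[OF T(2), of "dist u w"] by (simp add: algebra_simps)
    finally show "dist (apply_bcontfun (\<Phi> u) t) (apply_bcontfun (\<Phi> w) t) \<le> 3 / 4 * dist u w" .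
  qed
  then obtain u where u: "\<Phi> u = u"
    using banach_fix_type[of "3/4" \<Phi>] by auto
  show ?thesis
  proof (intro exI conjI ballI)
    show "continuous_on {-T..T} (apply_bcontfun u)" by simp
    show "apply_bcontfun u t = z + vint T (\<lambda>s. f s (apply_bcontfun u s)) t" if "t \<in> {-T..T}" for t
      using app[of u t] u cl(2)[OF that] by simp
  qed
qed

subsection \<open>The local flow and its dependence on the initial value\<close>

lemma continuous_on_Times_uniform:
  fixes f :: "real \<Rightarrow> 'a::metric_space \<Rightarrow> 'b::metric_space"
  assumes c: "\<And>z. z \<in> B \<Longrightarrow> continuous_on I (\<lambda>t. f t z)"
    and u: "\<And>z e. z \<in> B \<Longrightarrow> e > 0 \<Longrightarrow> \<exists>d>0. \<forall>w\<in>B. dist w z < d \<longrightarrow> (\<forall>t\<in>I. dist (f t w) (f t z) < e)"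
  shows "continuous_on (I \<times> B) (\<lambda>(t, z). f t z)"
  unfolding continuous_on_iff
proof (intro ballI allI impI)
  fix p and e :: real assume "p \<in> I \<times> B" "e > 0"
  then obtain t z where p: "p = (t, z)" and t: "t \<in> I" "z \<in> B" "e > 0" by auto
  obtain d1 where d1: "d1 > 0" "\<forall>w\<in>B. dist w z < d1 \<longrightarrow> (\<forall>t\<in>I. dist (f t w) (f t z) < e / 2)"
    using u[OF t(2), of "e / 2"] t(3) by auto
  obtain d2 where d2: "d2 > 0" "\<forall>s\<in>I. dist s t < d2 \<longrightarrow> dist (f s z) (f t z) < e / 2"
    using c[OF t(2)] t(1,3) unfolding continuous_on_iff by (metis half_gt_zero)
  have "dist (f s w) (f t z) < e" if "s \<in> I" "w \<in> B" "dist (s, w) (t, z) < min d1 d2" for s w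
  proof -
    have "dist s t < d2" "dist w z < d1"
      using that(3) dist_fst_le[of "(s, w)" "(t, z)"] dist_snd_le[of "(s, w)" "(t, z)"] by auto
    then have "dist (f s w) (f s z) < e / 2" "dist (f s z) (f t z) < e / 2"
      using d1(2) d2(2) that by blast+
    then show ?thesis using dist_triangle[of "f s w" "f t z" "f s z"] by linarith
  qed
  then show "\<exists>d>0. \<forall>q\<in>I \<times> B. dist q p < d \<longrightarrow> dist (case q of (t, z) \<Rightarrow> f t z) (case p of (t, z) \<Rightarrow> f t z) < e"
    using d1(1) d2(1) unfolding p by (intro exI[of _ "min d1 d2"]) auto
qed

text \<open>The truncation of the right-hand side outside a ball makes it globally Lipschitz, so the
  integral equation has a solution for every initial value. The derivative with respect to the
  initial value is the solution of the linearized integral equation; the error of the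
  linearization and the modulus of continuity of the derivative are absorbed as above.\<close>

lemma ode_local_flow:
  fixes F :: "'a::euclidean_space \<Rightarrow> 'a"
  assumes F: "C1_on F U" "open U" "z0 \<in> U"
  obtains T r \<phi> where "T > 0" "r > 0" "ball z0 r \<subseteq> U"
    "\<And>z. z \<in> ball z0 r \<Longrightarrow> \<phi> 0 z = z"
    "\<And>z t. z \<in> ball z0 r \<Longrightarrow> t \<in> {-T<..<T} \<Longrightarrow> \<phi> t z \<in> U"
    "\<And>z t. z \<in> ball z0 r \<Longrightarrow> t \<in> {-T<..<T} \<Longrightarrow> ((\<lambda>t. \<phi> t z) has_vector_derivative F (\<phi> t z)) (at t)"
    "C1_on (\<lambda>(t, z). \<phi> t z) ({-T<..<T} \<times> ball z0 r)"
proof -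
  obtain F' where F': "\<And>x. x \<in> U \<Longrightarrow> (F has_derivative blinfun_apply (F' x)) (at x)" "continuous_on U F'"
    using F(1) by (rule C1_onE) blast
  obtain R where R: "R > 0" "cball z0 R \<subseteq> U"
    using open_contains_cball_eq[OF F(2), rule_format, of z0] F(3) by auto
  define C where "C = cball z0 R"
  have C: "compact C" "convex C" "closed C" "C \<noteq> {}" "C \<subseteq> U"
    using R by (auto simp: C_def)
  have cF': "continuous_on C F'" using F'(2) C(5) continuous_on_subset by blast
  have cF: "continuous_on C F" using C1_on_continuous_on[OF F(1)] C(5) continuous_on_subset by blast
  have "bounded (F' ` C)" "bounded (F ` C)"
    using C(1) cF cF' compact_continuous_image compact_imp_bounded by blast+
  then obtain L K where L': "\<forall>x\<in>C. norm (F' x) \<le> L" and K': "\<forall>x\<in>C. norm (F x) \<le> K"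
    unfolding bounded_iff by blast
  then have L: "\<And>x. x \<in> C \<Longrightarrow> norm (F' x) \<le> L" and K: "\<And>x. x \<in> C \<Longrightarrow> norm (F x) \<le> K" by auto
  have z0C: "z0 \<in> C" using R by (auto simp: C_def)
  have L0: "L \<ge> 0" and K0: "K \<ge> 0"
    using L[OF z0C] K[OF z0C] norm_ge_zero order_trans by blast+
  have lipF: "norm (F x - F y) \<le> L * norm (x - y)" if "x \<in> C" "y \<in> C" for x y
  proof (rule differentiable_bound[OF C(2) _ _ that])
    show "(F has_derivative blinfun_apply (F' z)) (at z within C)" if "z \<in> C" for z
      using F'(1)[of z] that C(5) has_derivative_at_withinI by blast
    show "onorm (blinfun_apply (F' z)) \<le> L" if "z \<in> C" for z
      using L[OF that] by (simp add: norm_blinfun.rep_eq)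
  qed
  \<comment> \<open>The projection onto a ball is Lipschitz with constant 1, so the truncated field is globally Lipschitz.\<close>
  define G where "G x = F (closest_point C x)" for x
  have inC: "closest_point C x \<in> C" for x using C by (simp add: closest_point_in_set)
  have GF: "G x = F x" if "x \<in> C" for x using that by (simp add: G_def closest_point_self)
  have lipG: "norm (G x - G y) \<le> L * norm (x - y)" for x y
  proof -
    have "norm (G x - G y) \<le> L * dist (closest_point C x) (closest_point C y)"
      unfolding G_def dist_norm by (rule lipF[OF inC inC])
    also have "\<dots> \<le> L * dist x y"
      using L0 C by (intro mult_left_mono closest_point_lipschitz) auto
    finally show ?thesis by (simp add: dist_norm)
  qed
  have cG: "continuous_on UNIV G"
    unfolding G_def using C inC
    by (intro continuous_on_compose2[OF cF continuous_on_closest_point]) auto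
  define T where "T = min (1 / (4 * (L + 1))) (R / (6 * (K + 1)))"
  have T: "T > 0" using R L0 K0 by (simp add: T_def)
  have TL: "4 * T * L \<le> 1"
  proof -
    have "T * (4 * (L + 1)) \<le> 1"
      using L0 pos_le_divide_eq[of "4 * (L + 1)" T 1] by (simp add: T_def)
    then show ?thesis using T by (simp add: algebra_simps)
  qed
  have TK: "3 * T * K \<le> R / 2"
  proof -
    have "T * (6 * (K + 1)) \<le> R"
      using K0 pos_le_divide_eq[of "6 * (K + 1)" T R] by (simp add: T_def)
    then show ?thesis using T by (simp add: algebra_simps)
  qed
  let ?I = "{-T..T}" and ?J = "{-T<..<T}"
  have "\<exists>y. continuous_on ?I y \<and> (\<forall>t\<in>?I. y t = z + vint T (\<lambda>s. G (y s)) t)" for z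
    by (rule integral_equation_solution[OF T TL L0])
      (auto intro: lipG continuous_on_compose2[OF cG])
  then obtain \<phi> where \<phi>: "\<And>z. continuous_on ?I (\<phi> z)"
    "\<And>z t. t \<in> ?I \<Longrightarrow> \<phi> z t = z + vint T (\<lambda>s. G (\<phi> z s)) t"
    by metis
  have cG\<phi>: "continuous_on ?I (\<lambda>s. G (\<phi> z s))" for z
    by (rule continuous_on_compose2[OF cG \<phi>(1)]) auto
  define B where "B = ball z0 (R / 2)"
  have \<phi>C: "\<phi> z t \<in> C" if "z \<in> B" "t \<in> ?I" for z t
  proof -
    have "norm (vint T (\<lambda>s. G (\<phi> z s)) t) \<le> 3 * T * K"
      using K inC by (intro vint_norm_le[OF cG\<phi> _ that(2)]) (simp add: G_def)
    then have "dist (\<phi> z t) z \<le> R / 2"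
      using \<phi>(2)[OF that(2), of z] TK by (simp add: dist_norm)
    then show ?thesis
      using that(1) dist_triangle[of z0 "\<phi> z t" z] by (simp add: B_def C_def dist_commute)
  qed
  have \<phi>lip: "norm (\<phi> w t - \<phi> z t) \<le> 4 * norm (w - z)" if "t \<in> ?I" for w z t
  proof -
    have "norm (\<phi> w t - \<phi> z t) \<le> 4 * norm (w - z) + 12 * T * 0"
    proof (rule vint_absorb[OF T TL L0 _ _ _ _ that])
      show "continuous_on ?I (\<lambda>t. \<phi> w t - \<phi> z t)" by (intro continuous_intros \<phi>(1))
      show "continuous_on ?I (\<lambda>s. G (\<phi> w s) - G (\<phi> z s))" by (intro continuous_intros cG\<phi>)
      show "norm (\<phi> w t - \<phi> z t) \<le> norm (w - z) + norm (vint T (\<lambda>s. G (\<phi> w s) - G (\<phi> z s)) t)" if "t \<in> ?I" for t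
        using norm_triangle_ineq[of "w - z" "vint T (\<lambda>s. G (\<phi> w s)) t - vint T (\<lambda>s. G (\<phi> z s)) t"]
        by (simp add: \<phi>(2)[OF that, of w] \<phi>(2)[OF that, of z] vint_diff[OF cG\<phi> cG\<phi> that] algebra_simps)
      show "norm (G (\<phi> w t) - G (\<phi> z t)) \<le> L * norm (\<phi> w t - \<phi> z t) + 0" for t
        using lipG by simp
    qed
    then show ?thesis by simp
  qed
  have cF'\<phi>: "continuous_on ?I (\<lambda>s. F' (\<phi> z s))" if "z \<in> B" for z
    using \<phi>C[OF that] by (intro continuous_on_compose2[OF cF' \<phi>(1)]) auto
  have "\<exists>Y. continuous_on ?I Y \<and> (\<forall>t\<in>?I. Y t = id_blinfun + vint T (\<lambda>s. F' (\<phi> z s) o\<^sub>L Y s) t)" if "z \<in> B" for z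
  proof (rule integral_equation_solution[OF T TL L0])
    fix t and X Y :: "'a \<Rightarrow>\<^sub>L 'a" assume t: "t \<in> ?I"
    have "norm (F' (\<phi> z t) o\<^sub>L (X - Y)) \<le> norm (F' (\<phi> z t)) * norm (X - Y)"
      by (rule norm_blinfun_compose)
    also have "\<dots> \<le> L * norm (X - Y)"
      using L[OF \<phi>C[OF that t]] by (rule mult_right_mono) simp
    finally show "norm ((F' (\<phi> z t) o\<^sub>L X) - (F' (\<phi> z t) o\<^sub>L Y)) \<le> L * norm (X - Y)"
      by (simp add: bounded_bilinear.diff_right[OF bounded_bilinear_blinfun_compose])
  qed (intro continuous_intros cF'\<phi>[OF that])
  then obtain Y where Y: "\<And>z. z \<in> B \<Longrightarrow> continuous_on ?I (Y z)"
    "\<And>z t. z \<in> B \<Longrightarrow> t \<in> ?I \<Longrightarrow> Y z t = id_blinfun + vint T (\<lambda>s. F' (\<phi> z s) o\<^sub>L Y z s) t"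
    by metis
  have cFY: "continuous_on ?I (\<lambda>s. F' (\<phi> z s) o\<^sub>L Y z s)" if "z \<in> B" for z
    by (intro continuous_intros cF'\<phi> Y(1) that)
  have comp_le: "norm (A o\<^sub>L X) \<le> c * norm X" if "norm A \<le> c" for A X :: "'a \<Rightarrow>\<^sub>L 'a" and c
    using norm_blinfun_compose[of A X] mult_right_mono[OF that norm_ge_zero[of X]] by linarith
  have Yb: "norm (Y z t) \<le> 4" if "z \<in> B" "t \<in> ?I" for z t
  proof -
    have "norm (Y z t) \<le> 4 * 1 + 12 * T * 0"
    proof (rule vint_absorb[OF T TL L0 Y(1)[OF that(1)] cFY[OF that(1)] _ _ that(2)])
      show "norm (Y z t) \<le> 1 + norm (vint T (\<lambda>s. F' (\<phi> z s) o\<^sub>L Y z s) t)" if "t \<in> ?I" for t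
        using norm_triangle_ineq[of id_blinfun "vint T (\<lambda>s. F' (\<phi> z s) o\<^sub>L Y z s) t"] norm_blinfun_id_le[where 'a='a]
        by (subst Y(2)[OF \<open>z \<in> B\<close> that]) linarith
      show "norm (F' (\<phi> z t) o\<^sub>L Y z t) \<le> L * norm (Y z t) + 0" if "t \<in> ?I" for t
        using comp_le[OF L[OF \<phi>C[OF \<open>z \<in> B\<close> that]]] by simp
    qed
    then show ?thesis by simp
  qed
  have uc: "uniformly_continuous_on C F'"
    by (rule compact_uniformly_continuous[OF cF' C(1)])
  \<comment> \<open>The derivative with respect to the initial value depends continuously on the latter.\<close>
  have Yc: "\<exists>d>0. \<forall>w\<in>B. dist w z < d \<longrightarrow> (\<forall>t\<in>?I. dist (Y w t) (Y z t) < e)" if z: "z \<in> B" and e: "e > 0" for z e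
  proof -
    define e' where "e' = e / (100 * T)"
    have e': "e' > 0" "48 * T * e' < e" using e T by (auto simp: e'_def field_simps)
    obtain d where d: "d > 0" "\<And>x y. x \<in> C \<Longrightarrow> y \<in> C \<Longrightarrow> dist y x < d \<Longrightarrow> dist (F' y) (F' x) < e'"
      using uc e'(1) unfolding uniformly_continuous_on_def by metis
    have "dist (Y w t) (Y z t) < e" if w: "w \<in> B" "dist w z < d / 4" and t: "t \<in> ?I" for w t
    proof -
      have "norm (Y w t - Y z t) \<le> 4 * 0 + 12 * T * (4 * e')"
      proof (rule vint_absorb[OF T TL L0 _ _ _ _ t])
        show "continuous_on ?I (\<lambda>t. Y w t - Y z t)" by (intro continuous_intros Y(1) z w)
        show "continuous_on ?I (\<lambda>s. (F' (\<phi> w s) o\<^sub>L Y w s) - (F' (\<phi> z s) o\<^sub>L Y z s))"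
          by (intro continuous_on_diff cFY z w)
        show "norm (Y w t - Y z t) \<le> 0 + norm (vint T (\<lambda>s. (F' (\<phi> w s) o\<^sub>L Y w s) - (F' (\<phi> z s) o\<^sub>L Y z s)) t)" if "t \<in> ?I" for t
          by (simp add: Y(2)[OF z that] Y(2)[OF w(1) that] vint_diff[OF cFY[OF w(1)] cFY[OF z] that])
        show "norm ((F' (\<phi> w t) o\<^sub>L Y w t) - (F' (\<phi> z t) o\<^sub>L Y z t)) \<le> L * norm (Y w t - Y z t) + 4 * e'" if t: "t \<in> ?I" for t
        proof -
          have "(F' (\<phi> w t) o\<^sub>L Y w t) - (F' (\<phi> z t) o\<^sub>L Y z t)
              = (F' (\<phi> z t) o\<^sub>L (Y w t - Y z t)) + ((F' (\<phi> w t) - F' (\<phi> z t)) o\<^sub>L Y w t)"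
            by (simp add: bounded_bilinear.diff_right[OF bounded_bilinear_blinfun_compose]
                bounded_bilinear.diff_left[OF bounded_bilinear_blinfun_compose])
          moreover have "norm (F' (\<phi> z t) o\<^sub>L (Y w t - Y z t)) \<le> L * norm (Y w t - Y z t)"
            by (rule comp_le[OF L[OF \<phi>C[OF z t]]])
          moreover have "norm ((F' (\<phi> w t) - F' (\<phi> z t)) o\<^sub>L Y w t) \<le> 4 * e'"
          proof -
            have "dist (\<phi> w t) (\<phi> z t) < d"
              using \<phi>lip[OF t, of w z] w(2) by (simp add: dist_norm)
            then have "norm (F' (\<phi> w t) - F' (\<phi> z t)) \<le> e'"
              using d(2)[OF \<phi>C[OF z t] \<phi>C[OF w(1) t]] by (simp add: dist_norm)
            then have "norm ((F' (\<phi> w t) - F' (\<phi> z t)) o\<^sub>L Y w t) \<le> e' * norm (Y w t)"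
              by (rule comp_le)
            also have "\<dots> \<le> e' * 4" using Yb[OF w(1) t] e'(1) by (intro mult_left_mono) auto
            finally show ?thesis by simp
          qed
          ultimately show ?thesis
            using norm_triangle_ineq[of "F' (\<phi> z t) o\<^sub>L (Y w t - Y z t)" "(F' (\<phi> w t) - F' (\<phi> z t)) o\<^sub>L Y w t"]
            by simp
        qed
      qed
      then show ?thesis using e'(2) by (simp add: dist_norm)
    qed
    then show ?thesis using d(1) by (intro exI[of _ "d / 4"]) auto
  qed
  \<comment> \<open>The remainder of the linearization solves an integral inequality with a small inhomogeneous term.\<close>
  have Dz: "((\<lambda>z. \<phi> z t) has_derivative blinfun_apply (Y z t)) (at z)" if z: "z \<in> B" and t: "t \<in> ?I" for z t
    unfolding has_derivative_at_alt
  proof (intro conjI allI impI)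
    show "bounded_linear (blinfun_apply (Y z t))" by (rule blinfun.bounded_linear_right)
    fix e :: real assume e: "e > 0"
    define e' where "e' = e / (100 * T)"
    have e': "e' > 0" "48 * T * e' < e" using e T by (auto simp: e'_def field_simps)
    obtain d where d: "d > 0" "\<And>x y. x \<in> C \<Longrightarrow> y \<in> C \<Longrightarrow> dist y x < d \<Longrightarrow> dist (F' y) (F' x) < e'"
      using uc e'(1) unfolding uniformly_continuous_on_def by metis
    have lin: "norm (F y - F x - F' x (y - x)) \<le> e' * norm (y - x)" if "x \<in> C" "y \<in> C" "dist y x < d" for x y
    proof -
      have seg: "closed_segment x y \<subseteq> C" using that C(2) by (simp add: closed_segment_subset)
      have segd: "dist p x < d" if "p \<in> closed_segment x y" for p
        using \<open>dist y x < d\<close> segment_bound(1)[OF that] by (simp add: dist_norm)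
      have "norm ((\<lambda>y. F y - F' x y) y - (\<lambda>y. F y - F' x y) x) \<le> e' * norm (y - x)"
      proof (rule differentiable_bound[of "closed_segment x y"])
        show "((\<lambda>y. F y - F' x y) has_derivative blinfun_apply (F' p - F' x)) (at p within closed_segment x y)"
          if "p \<in> closed_segment x y" for p
          unfolding minus_blinfun.rep_eq
          by (rule has_derivative_diff[OF has_derivative_at_withinI[OF F'(1)]
                bounded_linear_imp_has_derivative[OF blinfun.bounded_linear_right]])
             (use that seg C(5) in blast)
        show "onorm (blinfun_apply (F' p - F' x)) \<le> e'" if "p \<in> closed_segment x y" for p
          using d(2)[of x p] that seg segd[OF that] \<open>x \<in> C\<close> by (force simp: norm_blinfun.rep_eq[symmetric] dist_norm)
      qed auto
      then show ?thesis by (simp add: blinfun.diff_right algebra_simps)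
    qed
    have openB: "open B" by (simp add: B_def)
    then obtain d0 where d0: "d0 > 0" "ball z d0 \<subseteq> B" using z openE by blast
    have "norm (\<phi> w t - \<phi> z t - Y z t (w - z)) \<le> e * norm (w - z)" if w: "norm (w - z) < min d0 (d / 4)" for w
    proof -
      have wB: "w \<in> B" using w d0(2) by (auto simp: dist_norm norm_minus_commute)
      have cYh: "continuous_on ?I (\<lambda>s. F' (\<phi> z s) (Y z s (w - z)))"
        by (intro continuous_intros cF'\<phi> Y(1) z)
      have "norm (\<phi> w t - \<phi> z t - Y z t (w - z)) \<le> 4 * 0 + 12 * T * (4 * e' * norm (w - z))"
      proof (rule vint_absorb[OF T TL L0 _ _ _ _ t])
        show "continuous_on ?I (\<lambda>t. \<phi> w t - \<phi> z t - Y z t (w - z))" by (intro continuous_intros \<phi>(1) Y(1) z)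
        show "continuous_on ?I (\<lambda>s. G (\<phi> w s) - G (\<phi> z s) - F' (\<phi> z s) (Y z s (w - z)))"
          by (intro continuous_intros cG\<phi> cYh)
        show "norm (\<phi> w t - \<phi> z t - Y z t (w - z)) \<le> 0 + norm (vint T (\<lambda>s. G (\<phi> w s) - G (\<phi> z s) - F' (\<phi> z s) (Y z s (w - z))) t)"
          if t: "t \<in> ?I" for t
        proof -
          have "Y z t (w - z) = (w - z) + vint T (\<lambda>s. F' (\<phi> z s) (Y z s (w - z))) t"
            by (subst Y(2)[OF z t]) (simp add: blinfun.add_left vint_blinfun_apply[OF cFY[OF z] t])
          then have "\<phi> w t - \<phi> z t - Y z t (w - z) = vint T (\<lambda>s. G (\<phi> w s) - G (\<phi> z s) - F' (\<phi> z s) (Y z s (w - z))) t"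
            by (subst vint_diff[OF _ cYh t], intro continuous_intros cG\<phi>)
              (simp add: \<phi>(2)[OF t, of w] \<phi>(2)[OF t, of z] vint_diff[OF cG\<phi> cG\<phi> t])
          then show ?thesis by simp
        qed
        show "norm (G (\<phi> w t) - G (\<phi> z t) - F' (\<phi> z t) (Y z t (w - z)))
            \<le> L * norm (\<phi> w t - \<phi> z t - Y z t (w - z)) + 4 * e' * norm (w - z)" if t: "t \<in> ?I" for t
        proof -
          have dl: "norm (\<phi> w t - \<phi> z t) \<le> 4 * norm (w - z)" by (rule \<phi>lip[OF t])
          then have "dist (\<phi> w t) (\<phi> z t) < d" using w by (simp add: dist_norm)
          then have "norm (F (\<phi> w t) - F (\<phi> z t) - F' (\<phi> z t) (\<phi> w t - \<phi> z t)) \<le> e' * norm (\<phi> w t - \<phi> z t)"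
            using lin \<phi>C z wB t by blast
          also have "\<dots> \<le> e' * (4 * norm (w - z))" using dl e'(1) by (intro mult_left_mono) auto
          finally have "norm (F (\<phi> w t) - F (\<phi> z t) - F' (\<phi> z t) (\<phi> w t - \<phi> z t)) \<le> e' * (4 * norm (w - z))" .
          moreover have "norm (F' (\<phi> z t) (\<phi> w t - \<phi> z t - Y z t (w - z))) \<le> L * norm (\<phi> w t - \<phi> z t - Y z t (w - z))"
            using norm_blinfun[of "F' (\<phi> z t)" "\<phi> w t - \<phi> z t - Y z t (w - z)"] L[OF \<phi>C[OF z t]]
            by (meson mult_right_mono norm_ge_zero order_trans)
          moreover have "G (\<phi> w t) - G (\<phi> z t) - F' (\<phi> z t) (Y z t (w - z))
             = (F (\<phi> w t) - F (\<phi> z t) - F' (\<phi> z t) (\<phi> w t - \<phi> z t)) + F' (\<phi> z t) (\<phi> w t - \<phi> z t - Y z t (w - z))"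
            using GF \<phi>C z wB t by (simp add: blinfun.diff_right)
          ultimately show ?thesis
            using norm_triangle_ineq[of "F (\<phi> w t) - F (\<phi> z t) - F' (\<phi> z t) (\<phi> w t - \<phi> z t)" "F' (\<phi> z t) (\<phi> w t - \<phi> z t - Y z t (w - z))"]
            by simp
        qed
      qed
      also have "\<dots> = 48 * T * e' * norm (w - z)" by simp
      also have "\<dots> \<le> e * norm (w - z)" using e'(2) by (intro mult_right_mono) auto
      finally show ?thesis .
    qed
    then show "\<exists>d>0. \<forall>w. norm (w - z) < d \<longrightarrow> norm (\<phi> w t - \<phi> z t - Y z t (w - z)) \<le> e * norm (w - z)"
      using d0(1) d(1) by (intro exI[of _ "min d0 (d / 4)"]) auto
  qed
  have Dt: "(\<phi> z has_vector_derivative F (\<phi> z t)) (at t)" if "z \<in> B" "t \<in> ?J" for z t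
  proof -
    have "((\<lambda>t. z + vint T (\<lambda>s. G (\<phi> z s)) t) has_vector_derivative 0 + G (\<phi> z t)) (at t)"
      using that(2) by (intro has_vector_derivative_add has_vector_derivative_const vint_has_vector_derivative cG\<phi>) auto
    then have "(\<phi> z has_vector_derivative 0 + G (\<phi> z t)) (at t)"
      by (rule has_vector_derivative_transform_within_open[where S="?J"]) (use that \<phi>(2)[of _ z] in auto)
    then show ?thesis using GF[OF \<phi>C[OF that(1)], of t] that(2) by simp
  qed
  have c\<phi>: "continuous_on (?J \<times> B) (\<lambda>(t, z). \<phi> z t)"
  proof (rule continuous_on_Times_uniform)
    show "continuous_on ?J (\<phi> z)" for z by (rule continuous_on_subset[OF \<phi>(1)]) auto
    show "\<exists>d>0. \<forall>w\<in>B. dist w z < d \<longrightarrow> (\<forall>t\<in>?J. dist (\<phi> w t) (\<phi> z t) < e)" if "e > 0" for z e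
    proof (intro exI[of _ "e / 4"] conjI ballI impI)
      fix w t assume "dist w z < e / 4" "t \<in> ?J"
      then show "dist (\<phi> w t) (\<phi> z t) < e" using \<phi>lip[of t w z] by (simp add: dist_norm)
    qed (use that in simp)
  qed
  have cY: "continuous_on (?J \<times> B) (\<lambda>(t, z). Y z t)"
  proof (rule continuous_on_Times_uniform)
    show "continuous_on ?J (Y z)" if "z \<in> B" for z by (rule continuous_on_subset[OF Y(1)[OF that]]) auto
    show "\<exists>d>0. \<forall>w\<in>B. dist w z < d \<longrightarrow> (\<forall>t\<in>?J. dist (Y w t) (Y z t) < e)" if "z \<in> B" "e > 0" for z e
      using Yc[OF that] by (meson greaterThanLessThan_subseteq_atLeastAtMost_iff less_imp_le order_refl subsetD)
  qed
  have "C1_on (\<lambda>(t, z). \<phi> z t) (?J \<times> B)"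
  proof (rule C1_onI)
    let ?D = "\<lambda>p. (blinfun_scaleR_left (F (\<phi> (snd p) (fst p))) o\<^sub>L fst_blinfun) + (Y (snd p) (fst p) o\<^sub>L snd_blinfun)"
    show "((\<lambda>(t, z). \<phi> z t) has_derivative blinfun_apply (?D p)) (at p)" if pJ: "p \<in> ?J \<times> B" for p
    proof -
      obtain t z where p: "p = (t, z)" "t \<in> ?J" "z \<in> B" using pJ by auto
      have "((\<lambda>(t, z). \<phi> z t) has_derivative (\<lambda>(h, k). h *\<^sub>R F (\<phi> z t) + Y z t k)) (at (t, z) within ?J \<times> B)"
      proof (rule has_derivative_partialsI)
        show "((\<lambda>t. \<phi> z t) has_derivative (\<lambda>h. h *\<^sub>R F (\<phi> z t))) (at t within ?J)"
          by (rule has_derivative_at_withinI[OF Dt[OF p(3,2), unfolded has_vector_derivative_def]])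
        show "((\<lambda>z. \<phi> z t) has_derivative blinfun_apply (Y z t)) (at z within B)" if "t \<in> ?J" "z \<in> B" for t z
          by (rule has_derivative_at_withinI[OF Dz]) (use that in auto)
        show "continuous (at (t, z) within ?J \<times> B) (\<lambda>(t, z). Y z t)"
          using cY p(2,3) unfolding continuous_on_eq_continuous_within by blast
      qed (use p in \<open>auto simp: B_def\<close>)
      moreover have "at (t, z) within ?J \<times> B = at (t, z)"
        using p by (intro at_within_open) (auto simp: B_def open_Times)
      moreover have "blinfun_apply (?D p) = (\<lambda>(h, k). h *\<^sub>R F (\<phi> z t) + Y z t k)"
        by (auto simp: p(1) blinfun.add_left blinfun_compose.rep_eq)
      ultimately show ?thesis unfolding p(1) by simp
    qed
    have "continuous_on (?J \<times> B) (\<lambda>p. F (\<phi> (snd p) (fst p)))"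
      using \<phi>C c\<phi> by (intro continuous_on_compose2[OF cF]) (auto simp: case_prod_unfold)
    then show "continuous_on (?J \<times> B) ?D"
      using cY unfolding case_prod_unfold
      by (intro continuous_intros bounded_linear.continuous_on[OF bounded_linear_blinfun_scaleR_left])
  qed
  moreover have "\<phi> z 0 = z" for z using \<phi>(2)[of 0 z] T by (simp add: vint_def)
  moreover have "\<phi> z t \<in> U" if "z \<in> B" "t \<in> ?J" for z t
    using \<phi>C[of z t] C(5) that by auto
  moreover have "B \<subseteq> U" using C(5) R(1) by (auto simp: B_def C_def)
  ultimately show ?thesis
    using that[of T "R / 2" "\<lambda>t z. \<phi> z t"] T R(1) Dt unfolding B_def by auto
qed

section \<open>Inverse and implicit functions of class C^1\<close>

lemma C1_on_local:
  assumes "\<And>x. x \<in> S \<Longrightarrow> \<exists>T. open T \<and> x \<in> T \<and> C1_on f T"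
  shows "C1_on f S"
proof (rule C1_onI)
  let ?f' = "\<lambda>x. Blinfun (frechet_derivative f (at x))"
  have *: "\<exists>T f'. open T \<and> x \<in> T \<and> continuous_on T f' \<and>
      (\<forall>y\<in>T. (f has_derivative blinfun_apply (f' y)) (at y) \<and> ?f' y = f' y)" if x: "x \<in> S" for x
  proof -
    obtain T where T: "open T" "x \<in> T" "C1_on f T" using assms[OF x] by blast
    obtain f' where f': "\<And>y. y \<in> T \<Longrightarrow> (f has_derivative blinfun_apply (f' y)) (at y)" "continuous_on T f'"
      using T(3) by (rule C1_onE) blast
    have "?f' y = f' y" if "y \<in> T" for y
      using frechet_derivative_at[OF f'(1)[OF that]] by (metis blinfun_apply_inverse)
    then show ?thesis using T f' by blast
  qed
  show "(f has_derivative blinfun_apply (?f' x)) (at x)" if x: "x \<in> S" for x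
    using *[OF x] by metis
  show "continuous_on S ?f'"
  proof (rule continuous_at_imp_continuous_on, rule ballI)
    fix x assume x: "x \<in> S"
    obtain T f' where T: "open T" "x \<in> T" "continuous_on T f'" "\<forall>y\<in>T. ?f' y = f' y"
      using *[OF x] by blast
    then have "continuous_on T ?f'" by (metis (no_types, lifting) continuous_on_eq)
    then show "isCont ?f' x" using T continuous_on_eq_continuous_at by blast
  qed
qed

text \<open>The inverse function theorem supplies a differentiable inverse; its derivative is continuous because
  inversion of linear maps is.\<close>

lemma C1_inverse_function:
  fixes f :: "'a::euclidean_space \<Rightarrow> 'a"
  assumes f: "C1_on f U" "open U" "x0 \<in> U"
    and D: "(f has_derivative D) (at x0)" "\<And>h. D h = 0 \<Longrightarrow> h = 0"
  obtains U' V g where "open U'" "U' \<subseteq> U" "x0 \<in> U'" "open V" "f x0 \<in> V" "homeomorphism U' V f g" "C1_on g V"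
proof -
  obtain f' where f': "\<And>x. x \<in> U \<Longrightarrow> (f has_derivative blinfun_apply (f' x)) (at x)" "continuous_on U f'"
    using f(1) by (rule C1_onE) blast
  have Df': "D = blinfun_apply (f' x0)"
    using D(1) f'(1)[OF f(3)] has_derivative_unique by blast
  have "linear D" "inj D"
    using D has_derivative_linear linear_injective_0 by blast+
  then obtain G where G: "linear G" "G \<circ> D = id"
    using linear_injective_left_inverse by blast
  have "Blinfun G o\<^sub>L f' x0 = id_blinfun"
    using G(2) unfolding Df'
    by (intro blinfun_eqI)
       (simp add: blinfun_compose.rep_eq bounded_linear_Blinfun_apply[OF linear_conv_bounded_linear[THEN iffD1, OF G(1)]] o_def id_def fun_eq_iff)
  from inverse_function_theorem[OF f(2) f' f(3) this]
  obtain U' V g g' where I: "open U'" "U' \<subseteq> U" "x0 \<in> U'" "open V" "f x0 \<in> V" "homeomorphism U' V f g"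
    "\<And>y. y \<in> V \<Longrightarrow> (g has_derivative (g' y)) (at y)"
    "\<And>y. y \<in> V \<Longrightarrow> g' y = inv (blinfun_apply (f' (g y)))"
    "\<And>y. y \<in> V \<Longrightarrow> bij (blinfun_apply (f' (g y)))"
    by blast
  have gU: "g y \<in> U" if "y \<in> V" for y
    using I(2,6) that homeomorphism_image2 by blast
  have cA: "continuous_on V (\<lambda>y. f' (g y))"
  proof (rule continuous_on_compose2[OF f'(2)])
    show "continuous_on V g" using I(6) by (simp add: homeomorphism_def)
  qed (use gU in blast)
  have ap: "blinfun_apply (Blinfun (g' y)) = g' y" if "y \<in> V" for y
    using bounded_linear_Blinfun_apply has_derivative_bounded_linear I(7)[OF that] by blast
  have fg: "f' (g y) (g' y k) = k" "g' y (f' (g y) k) = k" if "y \<in> V" for y k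
    using I(9)[OF that] unfolding I(8)[OF that] by (simp_all add: bij_is_surj surj_f_inv_f bij_is_inj inv_f_f)
  have "C1_on g V"
  proof (rule C1_onI)
    show "(g has_derivative blinfun_apply (Blinfun (g' y))) (at y)" if "y \<in> V" for y
      using I(7)[OF that] by (simp add: ap[OF that])
    show "continuous_on V (\<lambda>y. Blinfun (g' y))"
    proof (rule continuous_on_blinfun_componentwise)
      fix k :: 'a
      show "continuous_on V (\<lambda>y. Blinfun (g' y) k)"
        unfolding continuous_on_def
      proof
        fix z assume z: "z \<in> V"
        define C where "C = norm (Blinfun (g' z))"
        define \<eta> where "\<eta> y = C * norm (f' (g z) - f' (g y))" for y
        have "continuous_on V \<eta>"
          unfolding \<eta>_def by (intro continuous_intros cA)
        then have "(\<eta> \<longlongrightarrow> \<eta> z) (at z within V)"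
          using z unfolding continuous_on_def by blast
        then have \<eta>: "(\<eta> \<longlongrightarrow> 0) (at z within V)" by (simp add: \<eta>_def)
        have est: "norm (g' y k - g' z k) \<le> \<eta> y * norm (g' y k)" if y: "y \<in> V" for y
        proof -
          have "g' y k - g' z k = Blinfun (g' z) (f' (g z) (g' y k - g' z k))"
            by (simp add: ap[OF z] fg[OF z])
          also have "f' (g z) (g' y k - g' z k) = (f' (g z) - f' (g y)) (g' y k)"
            by (simp add: blinfun.diff_left blinfun.diff_right fg[OF z] fg[OF y])
          finally have "norm (g' y k - g' z k) \<le> C * norm ((f' (g z) - f' (g y)) (g' y k))"
            unfolding C_def by (metis norm_blinfun)
          also have "\<dots> \<le> C * (norm (f' (g z) - f' (g y)) * norm (g' y k))"
            by (intro mult_left_mono norm_blinfun) (simp add: C_def)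
          finally show ?thesis by (simp add: \<eta>_def mult_ac)
        qed
        have "eventually (\<lambda>y. \<eta> y < 1 / 2) (at z within V)"
          using \<eta> by (rule order_tendstoD) simp
        moreover have "eventually (\<lambda>y. y \<in> V) (at z within V)"
          using eventually_at_filter by (rule iffD2) (simp add: always_eventually)
        ultimately have ev: "eventually (\<lambda>y. norm (g' y k - g' z k) \<le> 2 * norm (g' z k) * \<eta> y) (at z within V)"
        proof eventually_elim
          case (elim y)
          have 0: "\<eta> y \<ge> 0" by (simp add: \<eta>_def C_def)
          have "norm (g' y k) \<le> norm (g' z k) + norm (g' y k - g' z k)"
            by (rule norm_triangle_sub)
          also have "\<dots> \<le> norm (g' z k) + 1 / 2 * norm (g' y k)"
            using est[OF elim(2)] mult_right_mono[of "\<eta> y" "1/2" "norm (g' y k)"] elim(1) by auto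
          finally have "norm (g' y k) \<le> 2 * norm (g' z k)" by simp
          then have "\<eta> y * norm (g' y k) \<le> \<eta> y * (2 * norm (g' z k))" using 0 by (rule mult_left_mono)
          then show ?case using est[OF elim(2)] by (simp add: mult_ac)
        qed
        have "((\<lambda>y. g' y k - g' z k) \<longlongrightarrow> 0) (at z within V)"
          by (rule Lim_null_comparison[OF ev]) (use tendsto_mult_right_zero[OF \<eta>] in simp)
        then have "((\<lambda>y. g' y k) \<longlongrightarrow> g' z k) (at z within V)"
          by (simp add: LIM_zero_iff)
        then have "((\<lambda>y. Blinfun (g' y) k) \<longlongrightarrow> g' z k) (at z within V)"
          by (rule tendsto_cong[THEN iffD1, rotated])
             (auto simp: eventually_at_filter ap intro!: always_eventually)
        then show "((\<lambda>y. Blinfun (g' y) k) \<longlongrightarrow> Blinfun (g' z) k) (at z within V)"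
          by (simp add: ap[OF z])
      qed
    qed
  qed
  then show ?thesis using that I by blast
qed

text \<open>The inverse function theorem for the map (p, z) \<mapsto> (p, \<Phi> (p, z)).\<close>

lemma C1_implicit_function:
  fixes \<Phi> :: "'p::euclidean_space \<times> 'z::euclidean_space \<Rightarrow> 'z"
  assumes \<Phi>: "C1_on \<Phi> W" "open W" "(p0, z0) \<in> W"
    and D: "((\<lambda>z. \<Phi> (p0, z)) has_derivative D) (at z0)" "\<And>h. D h = 0 \<Longrightarrow> h = 0"
  obtains P \<zeta> where "open P" "p0 \<in> P" "C1_on \<zeta> P" "\<zeta> p0 = z0"
    "\<And>p. p \<in> P \<Longrightarrow> (p, \<zeta> p) \<in> W \<and> \<Phi> (p, \<zeta> p) = \<Phi> (p0, z0)"
proof -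
  define f where "f q = (fst q, \<Phi> q)" for q
  obtain \<Phi>' where \<Phi>': "\<And>x. x \<in> W \<Longrightarrow> (\<Phi> has_derivative blinfun_apply (\<Phi>' x)) (at x)"
    using \<Phi>(1) by (rule C1_onE) blast
  have f: "C1_on f W" unfolding f_def by (intro C1_intros \<Phi>)
  have Df: "(f has_derivative (\<lambda>h. (fst h, \<Phi>' (p0, z0) h))) (at (p0, z0))"
    unfolding f_def by (intro has_derivative_Pair has_derivative_fst has_derivative_ident \<Phi>' \<Phi>(3))
  have "((\<lambda>z. \<Phi> (p0, z)) has_derivative (\<lambda>k. \<Phi>' (p0, z0) (0, k))) (at z0)"
    by (rule has_derivative_compose[where f = "\<lambda>z. (p0, z)", OF _ \<Phi>'[OF \<Phi>(3)]])
       (intro has_derivative_Pair has_derivative_const has_derivative_ident)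
  then have D': "D = (\<lambda>k. \<Phi>' (p0, z0) (0, k))" using D(1) has_derivative_unique by blast
  have inj: "h = 0" if "(fst h, \<Phi>' (p0, z0) h) = 0" for h
  proof -
    have "fst h = 0" "\<Phi>' (p0, z0) h = 0" using that by (simp_all add: zero_prod_def)
    then have "D (snd h) = 0" unfolding D' by (metis prod.collapse)
    then show ?thesis using D(2) \<open>fst h = 0\<close> by (simp add: prod_eq_iff)
  qed
  obtain U' V g where I: "open U'" "U' \<subseteq> W" "(p0, z0) \<in> U'" "open V" "f (p0, z0) \<in> V"
    "homeomorphism U' V f g" "C1_on g V"
    by (rule C1_inverse_function[OF f \<Phi>(2,3) Df inj]) blast
  define P where "P = (\<lambda>p. (p, \<Phi> (p0, z0))) -` V"
  define \<zeta> where "\<zeta> p = snd (g (p, \<Phi> (p0, z0)))" for p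
  show ?thesis
  proof (rule that[of P \<zeta>])
    show "open P" unfolding P_def by (intro open_vimage I(4) continuous_intros)
    show "p0 \<in> P" using I(5) by (simp add: P_def f_def)
    show "C1_on \<zeta> P"
      unfolding \<zeta>_def by (intro C1_on_snd C1_on_compose[OF I(7)] C1_intros) (auto simp: P_def)
    have "g (f (p0, z0)) = (p0, z0)" using I(3,6) by (simp add: homeomorphism_def)
    then show "\<zeta> p0 = z0" by (simp add: \<zeta>_def f_def)
    show "(p, \<zeta> p) \<in> W \<and> \<Phi> (p, \<zeta> p) = \<Phi> (p0, z0)" if "p \<in> P" for p
    proof -
      have v: "(p, \<Phi> (p0, z0)) \<in> V" using that by (simp add: P_def)
      have fg: "f (g (p, \<Phi> (p0, z0))) = (p, \<Phi> (p0, z0))" using I(6) v by (simp add: homeomorphism_def)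
      then have "g (p, \<Phi> (p0, z0)) = (p, \<zeta> p)" by (simp add: f_def \<zeta>_def prod_eq_iff)
      moreover have "g (p, \<Phi> (p0, z0)) \<in> W" using I(2,6) v homeomorphism_image2 by blast
      ultimately show ?thesis using fg by (simp add: f_def)
    qed
  qed
qed

text \<open>Raising an index: a linear form is represented by a vector through a positive definite
  bilinear form, and the vector is of class C^1 in the parameters by the implicit function theorem.\<close>

lemma posdef_representation:
  fixes B :: "'e::euclidean_space \<Rightarrow> 'e \<Rightarrow> real"
  assumes B: "bilinear B" "\<And>v. v \<noteq> 0 \<Longrightarrow> 0 < B v v" and l: "linear l"
  shows "\<exists>!z. \<forall>u. B z u = l u"
proof (rule ex_ex1I)
  define L where "L z = (\<Sum>i\<in>Basis. B z i *\<^sub>R i)" for z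
  have lin: "linear (\<lambda>z. B z u)" "linear (B z)" for z u using B(1) by (simp_all add: bilinear_def)
  have "linear L"
    by (rule linearI)
       (simp_all add: L_def linear_add[OF lin(1)] linear_cmul[OF lin(1)] scaleR_left_distrib sum.distrib scaleR_sum_right)
  have Bu: "B z u = L z \<bullet> u" for z u
  proof -
    have "B z u = B z (\<Sum>i\<in>Basis. (u \<bullet> i) *\<^sub>R i)" by (simp add: euclidean_representation)
    also have "\<dots> = (\<Sum>i\<in>Basis. (u \<bullet> i) * B z i)"
      by (simp add: linear_sum[OF lin(2)] linear_cmul[OF lin(2)])
    finally show ?thesis by (simp add: L_def inner_sum_left inner_commute[of u] mult.commute)
  qed
  have "inj L"
  proof (subst linear_injective_0[OF \<open>linear L\<close>], intro allI impI)
    fix z assume "L z = 0"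
    then show "z = 0" using B(2)[of z] Bu[of z z] by auto
  qed
  then obtain z where z: "L z = (\<Sum>i\<in>Basis. l i *\<^sub>R i)"
    using linear_injective_imp_surjective[OF \<open>linear L\<close>] by (metis surjD)
  have "B z u = l u" for u
  proof -
    have "l u = l (\<Sum>i\<in>Basis. (u \<bullet> i) *\<^sub>R i)" by (simp add: euclidean_representation)
    also have "\<dots> = (\<Sum>i\<in>Basis. (u \<bullet> i) * l i)"
      by (simp add: linear_sum[OF l] linear_cmul[OF l])
    finally show ?thesis by (simp add: Bu z inner_sum_left inner_commute[of u] mult.commute)
  qed
  then show "\<exists>z. \<forall>u. B z u = l u" by blast
  show "z = y" if "\<forall>u. B z u = l u" "\<forall>u. B y u = l u" for z y
  proof (rule ccontr)
    assume "z \<noteq> y"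
    then have "0 < B (z - y) (z - y)" using B(2) by simp
    also have "B (z - y) (z - y) = 0" using that by (simp add: bilinear_lsub[OF B(1)])
    finally show False by simp
  qed
qed

lemma C1_on_posdef_representation:
  fixes B :: "'p::euclidean_space \<Rightarrow> 'e::euclidean_space \<Rightarrow> 'e \<Rightarrow> real"
  assumes S: "open S" and B: "\<And>x. x \<in> S \<Longrightarrow> bilinear (B x)" "\<And>x v. x \<in> S \<Longrightarrow> v \<noteq> 0 \<Longrightarrow> 0 < B x v v"
    and l: "\<And>x. x \<in> S \<Longrightarrow> linear (l x)"
    and C1: "\<And>v w. C1_on (\<lambda>x. B x v w) S" "\<And>u. C1_on (\<lambda>x. l x u) S"
    and z: "\<And>x u. x \<in> S \<Longrightarrow> B x (z x) u = l x u"
  shows "C1_on z S"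
proof (rule C1_on_local)
  fix x0 assume x0: "x0 \<in> S"
  define \<Phi> where "\<Phi> q = (\<Sum>i\<in>Basis. (B (fst q) (snd q) i - l (fst q) i) *\<^sub>R i)" for q :: "'p \<times> 'e"
  have lin: "linear (\<lambda>z. B x z u)" "linear (B x z)" if "x \<in> S" for x z u
    using B(1)[OF that] by (simp_all add: bilinear_def)
  have C1\<Phi>: "C1_on \<Phi> (S \<times> UNIV)"
    unfolding \<Phi>_def
  proof (intro C1_intros)
    show "C1_on (\<lambda>q. B (fst q) (snd q) i) (S \<times> UNIV)" for i
      by (rule C1_on_linear_field[where D="\<lambda>x z. B x z i", OF S lin(1) C1(1)])
         (auto intro!: C1_intros open_Times S)
    show "C1_on (\<lambda>q. l (fst q) i) (S \<times> UNIV)" for i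
      by (rule C1_on_compose[OF C1(2)]) (auto intro!: C1_intros)
  qed
  define D where "D h = (\<Sum>i\<in>Basis. B x0 h i *\<^sub>R i)" for h
  have linD: "linear D"
    by (rule linearI)
       (simp_all add: D_def linear_add[OF lin(1)[OF x0]] linear_cmul[OF lin(1)[OF x0]] scaleR_left_distrib sum.distrib scaleR_sum_right)
  have Dder: "((\<lambda>z. \<Phi> (x0, z)) has_derivative D) (at (z x0))"
  proof -
    have "(\<lambda>z. \<Phi> (x0, z)) = (\<lambda>z. D z - (\<Sum>i\<in>Basis. l x0 i *\<^sub>R i))"
      by (auto simp: \<Phi>_def D_def scaleR_diff_left sum_subtractf)
    then show ?thesis
      using has_derivative_diff[OF linear_imp_has_derivative[OF linD] has_derivative_const] by simp
  qed
  have Dinj: "h = 0" if "D h = 0" for h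
  proof (rule ccontr)
    assume "h \<noteq> 0"
    have "B x0 h h = B x0 h (\<Sum>i\<in>Basis. (h \<bullet> i) *\<^sub>R i)" by (simp add: euclidean_representation)
    also have "\<dots> = (\<Sum>i\<in>Basis. (h \<bullet> i) * B x0 h i)"
      by (simp add: linear_sum[OF lin(2)[OF x0]] linear_cmul[OF lin(2)[OF x0]])
    also have "\<dots> = D h \<bullet> h" by (simp add: D_def inner_sum_left inner_commute[of h] mult.commute)
    finally show False using that B(2)[OF x0 \<open>h \<noteq> 0\<close>] by simp
  qed
  have "(x0, z x0) \<in> S \<times> UNIV" using x0 by simp
  then obtain P \<zeta> where P: "open P" "x0 \<in> P" "C1_on \<zeta> P"
    "\<And>p. p \<in> P \<Longrightarrow> (p, \<zeta> p) \<in> S \<times> UNIV \<and> \<Phi> (p, \<zeta> p) = \<Phi> (x0, z x0)"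
    by (rule C1_implicit_function[OF C1\<Phi> open_Times[OF S open_UNIV] _ Dder Dinj]) (assumption | rule that)+
  have "z p = \<zeta> p" if "p \<in> P" for p
  proof -
    have p: "p \<in> S" and "\<Phi> (p, \<zeta> p) = \<Phi> (x0, z x0)" using P(4)[OF that] by auto
    then have 0: "(\<Sum>i\<in>Basis. (B p (\<zeta> p) i - l p i) *\<^sub>R i) = 0" by (simp add: \<Phi>_def z x0)
    have i: "B p (\<zeta> p) i = l p i" if "i \<in> Basis" for i
      using arg_cong[OF 0, of "\<lambda>y. y \<bullet> i"] that
      by (simp add: inner_sum_left inner_Basis if_distrib cong: if_cong)
    have "B p (\<zeta> p) u = l p u" for u
    proof -
      have "B p (\<zeta> p) u = (\<Sum>i\<in>Basis. (u \<bullet> i) * B p (\<zeta> p) i)"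
        using linear_sum[OF lin(2)[OF p], of "\<zeta> p" "\<lambda>i. (u \<bullet> i) *\<^sub>R i" Basis]
        by (simp add: linear_cmul[OF lin(2)[OF p]] euclidean_representation)
      moreover have "l p u = (\<Sum>i\<in>Basis. (u \<bullet> i) * l p i)"
        using linear_sum[OF l[OF p], of "\<lambda>i. (u \<bullet> i) *\<^sub>R i" Basis]
        by (simp add: linear_cmul[OF l[OF p]] euclidean_representation)
      ultimately show ?thesis using i by simp
    qed
    then show ?thesis
      using posdef_representation[OF B(1)[OF p] B(2)[OF p] l[OF p]] z[OF p] by blast
  qed
  then show "\<exists>T. open T \<and> x0 \<in> T \<and> C1_on z T"
    using P C1_on_cong[OF P(3,1)] by blast
qed

section \<open>Charts, metrics and accelerations in coordinates\<close>

lemma chart_props: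
  assumes "is_chart c"
  shows chart_open: "open (cdom c)" "open (cimg c)"
    and cinv_cmap: "\<And>p. p \<in> cdom c \<Longrightarrow> cinv c (cmap c p) = p"
    and cmap_cinv: "\<And>y. y \<in> cimg c \<Longrightarrow> cmap c (cinv c y) = y"
    and cmap_in: "\<And>p. p \<in> cdom c \<Longrightarrow> cmap c p \<in> cimg c"
    and cinv_in: "\<And>y. y \<in> cimg c \<Longrightarrow> cinv c y \<in> cdom c"
    and continuous_on_cmap: "continuous_on (cdom c) (cmap c)"
    and continuous_on_cinv: "continuous_on (cimg c) (cinv c)"
proof -
  have h: "homeomorphism (cdom c) (cimg c) (cmap c) (cinv c)" and "open (cdom c)" "open (cimg c)"
    using assms by (auto simp: is_chart_def)
  then show "open (cdom c)" "open (cimg c)" by auto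
  show "\<And>p. p \<in> cdom c \<Longrightarrow> cinv c (cmap c p) = p" "\<And>y. y \<in> cimg c \<Longrightarrow> cmap c (cinv c y) = y"
    "\<And>p. p \<in> cdom c \<Longrightarrow> cmap c p \<in> cimg c" "\<And>y. y \<in> cimg c \<Longrightarrow> cinv c y \<in> cdom c"
    "continuous_on (cdom c) (cmap c)" "continuous_on (cimg c) (cinv c)"
    using h by (auto simp: homeomorphism_def)
qed

definition overlap :: "('m, 'e) chart \<Rightarrow> ('m, 'e) chart \<Rightarrow> 'e set" where
  "overlap c d = cmap c ` (cdom c \<inter> cdom d)"

lemma overlap_iff:
  assumes "is_chart c"
  shows "y \<in> overlap c d \<longleftrightarrow> y \<in> cimg c \<and> cinv c y \<in> cdom d"
proof
  assume "y \<in> overlap c d"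
  then obtain p where "p \<in> cdom c" "p \<in> cdom d" "y = cmap c p" by (auto simp: overlap_def)
  then show "y \<in> cimg c \<and> cinv c y \<in> cdom d" by (simp add: cinv_cmap[OF assms] cmap_in[OF assms])
next
  assume "y \<in> cimg c \<and> cinv c y \<in> cdom d"
  then show "y \<in> overlap c d"
    unfolding overlap_def
    by (intro image_eqI[of _ _ "cinv c y"]) (simp_all add: cmap_cinv[OF assms] cinv_in[OF assms])
qed

lemma open_preimage_chart:
  assumes c: "is_chart c" and S: "open S"
  shows "open {y \<in> cimg c. cinv c y \<in> S}"
proof -
  have "open (cimg c \<inter> cinv c -` S)"
    using continuous_on_cinv[OF c] chart_open(2)[OF c] S by (rule continuous_open_preimage)
  then show ?thesis by (simp add: Int_def vimage_def)
qed

lemma open_overlap: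
  assumes "is_chart c" "is_chart d"
  shows "open (overlap c d)"
proof -
  have "overlap c d = {y \<in> cimg c. cinv c y \<in> cdom d}" using overlap_iff[OF assms(1)] by blast
  then show ?thesis using open_preimage_chart[OF assms(1) chart_open(1)[OF assms(2)]] by simp
qed

locale jacobi_setup =
  fixes A :: "('m::t2_space, 'e::euclidean_space) chart set"
    and g :: "('m, 'e) metric" and V :: "'m \<Rightarrow> real" and E :: real
  assumes atlas: "Ck_atlas 3 A" and metric: "riemannian_metric 2 A g" and potential: "Ck_function 2 A V"
begin

lemma chart: "c \<in> A \<Longrightarrow> is_chart c"
  using atlas by (simp add: Ck_atlas_def)

lemma ex_chart: "\<exists>c\<in>A. p \<in> cdom c"
  using atlas unfolding Ck_atlas_def by blast

lemma transition_C3: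
  assumes "c \<in> A" "d \<in> A"
  shows "Ck_on (Suc (Suc (Suc 0))) (cmap d \<circ> cinv c) (overlap c d)"
  using atlas assms unfolding Ck_atlas_def Ck_compatible_def overlap_def numeral_3_eq_3 by blast

lemma transition_C2: "c \<in> A \<Longrightarrow> d \<in> A \<Longrightarrow> Ck_on (Suc (Suc 0)) (cmap d \<circ> cinv c) (overlap c d)"
  by (rule Ck_on_Suc_imp_Ck_on[OF transition_C3])

abbreviation Vc :: "('m, 'e) chart \<Rightarrow> 'e \<Rightarrow> real" where
  "Vc c \<equiv> V \<circ> cinv c"

lemma Vc_C2: "c \<in> A \<Longrightarrow> Ck_on (Suc (Suc 0)) (Vc c) (cimg c)"
  using potential by (simp add: Ck_function_def numeral_2_eq_2)

lemma Vc_C1: "c \<in> A \<Longrightarrow> C1_on (Vc c) (cimg c)"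
  by (rule C2_imp_C1[OF Vc_C2])

lemma Vc_differentiable: "c \<in> A \<Longrightarrow> x \<in> cimg c \<Longrightarrow> Vc c differentiable (at x)"
  using C1_on_differentiable[OF Vc_C1] .

lemma continuous_V: "continuous_on UNIV V"
proof (rule continuous_at_imp_continuous_on, rule ballI)
  fix p :: 'm
  obtain c where c: "c \<in> A" "p \<in> cdom c" using ex_chart by blast
  have "continuous_on (cdom c) (\<lambda>q. Vc c (cmap c q))"
    using cmap_in[OF chart[OF c(1)]]
    by (intro continuous_on_compose2[OF C1_on_continuous_on[OF Vc_C1[OF c(1)]] continuous_on_cmap[OF chart[OF c(1)]]]) auto
  then have "continuous_on (cdom c) V"
    by (rule continuous_on_eq) (simp add: cinv_cmap[OF chart[OF c(1)]])
  then show "isCont V p"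
    using c chart_open(1)[OF chart[OF c(1)]] continuous_on_eq_continuous_at by blast
qed

lemma metric_bilinear: "c \<in> A \<Longrightarrow> x \<in> cimg c \<Longrightarrow> bilinear (g c x)"
  and metric_sym: "c \<in> A \<Longrightarrow> x \<in> cimg c \<Longrightarrow> g c x v w = g c x w v"
  and metric_pos: "c \<in> A \<Longrightarrow> x \<in> cimg c \<Longrightarrow> v \<noteq> 0 \<Longrightarrow> 0 < g c x v v"
  using metric unfolding riemannian_metric_def by blast+

lemma metric_C2: "c \<in> A \<Longrightarrow> Ck_on (Suc (Suc 0)) (\<lambda>x. g c x v w) (cimg c)"
  using metric unfolding riemannian_metric_def numeral_2_eq_2 by blast

lemma metric_linear: 
  assumes "c \<in> A" "x \<in> cimg c"
  shows "linear (g c x v)" "linear (\<lambda>v. g c x v w)"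
  using metric_bilinear[OF assms] by (simp_all add: bilinear_def)

lemmas metric_simps =
  bilinear_ladd[OF metric_bilinear] bilinear_radd[OF metric_bilinear]
  bilinear_lsub[OF metric_bilinear] bilinear_rsub[OF metric_bilinear]
  bilinear_lmul[OF metric_bilinear] bilinear_rmul[OF metric_bilinear]

lemma metric_nondegenerate:
  assumes "c \<in> A" "x \<in> cimg c" "\<And>u. g c x z u = g c x z' u"
  shows "z = z'"
proof (rule ccontr)
  assume "z \<noteq> z'"
  then have "0 < g c x (z - z') (z - z')" using metric_pos[OF assms(1,2)] by simp
  also have "g c x (z - z') (z - z') = g c x z (z - z') - g c x z' (z - z')"
    by (rule bilinear_lsub[OF metric_bilinear[OF assms(1,2)]])
  also have "\<dots> = 0" using assms(3) by simp
  finally show False by simp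
qed

lemma metric_transform:
  assumes "c \<in> A" "d \<in> A" "x \<in> overlap c d"
  shows "g c x v w = g d (cmap d (cinv c x)) (frechet_derivative (cmap d \<circ> cinv c) (at x) v)
                         (frechet_derivative (cmap d \<circ> cinv c) (at x) w)"
proof -
  obtain p where p: "p \<in> cdom c \<inter> cdom d" "x = cmap c p" using assms(3) unfolding overlap_def by blast
  have "g c (cmap c p) v w = g d (cmap d p) (frechet_derivative (cmap d \<circ> cinv c) (at (cmap c p)) v)
                         (frechet_derivative (cmap d \<circ> cinv c) (at (cmap c p)) w)"
    using metric assms(1,2) p(1) unfolding riemannian_metric_def by blast
  then show ?thesis using p cinv_cmap[OF chart[OF assms(1)], of p] by simp
qed

text \<open>The Koszul formula is written with these derivatives of the metric components. They are linear in
  each of the vectors a, v and w.\<close>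

definition dg :: "('m, 'e) chart \<Rightarrow> 'e \<Rightarrow> 'e \<Rightarrow> 'e \<Rightarrow> 'e \<Rightarrow> real" where
  "dg c x a v w = frechet_derivative (\<lambda>y. g c y v w) (at x) a"

lemma metric_differentiable: "c \<in> A \<Longrightarrow> x \<in> cimg c \<Longrightarrow> (\<lambda>y. g c y v w) differentiable (at x)"
  using C1_on_differentiable[OF C2_imp_C1[OF metric_C2]] .

lemma dg_has_derivative: "c \<in> A \<Longrightarrow> x \<in> cimg c \<Longrightarrow> ((\<lambda>y. g c y v w) has_derivative (\<lambda>a. dg c x a v w)) (at x)"
  unfolding dg_def using metric_differentiable frechet_derivative_works by blast

lemma dg_linear1: "c \<in> A \<Longrightarrow> x \<in> cimg c \<Longrightarrow> linear (\<lambda>a. dg c x a v w)"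
  using dg_has_derivative has_derivative_linear by blast

lemma dg_eqI:
  assumes "c \<in> A" "x \<in> cimg c" "\<And>y. y \<in> cimg c \<Longrightarrow> g c y v w = f y" "(f has_derivative f') (at x)"
  shows "dg c x a v w = f' a"
proof -
  have "((\<lambda>y. g c y v w) has_derivative f') (at x)"
    by (rule has_derivative_transform_within_open[OF assms(4) chart_open(2)[OF chart[OF assms(1)]] assms(2)])
       (simp add: assms(3))
  then show ?thesis using has_derivative_unique[OF dg_has_derivative[OF assms(1,2)]] by metis
qed

lemma dg_linear3:
  assumes "c \<in> A" "x \<in> cimg c"
  shows "linear (dg c x a v)"
proof (rule linearI)
  show "dg c x a v (w + w') = dg c x a v w + dg c x a v w'" for w w'
    by (rule dg_eqI[OF assms _ has_derivative_add[OF dg_has_derivative[OF assms] dg_has_derivative[OF assms]]])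
       (simp add: metric_simps assms)
  show "dg c x a v (r *\<^sub>R w) = r *\<^sub>R dg c x a v w" for w r
    by (rule dg_eqI[OF assms _ has_derivative_scaleR_right[OF dg_has_derivative[OF assms]]])
       (simp add: metric_simps assms)
qed

lemma dg_sym:
  assumes "c \<in> A" "x \<in> cimg c"
  shows "dg c x a v w = dg c x a w v"
  by (rule dg_eqI[OF assms _ dg_has_derivative[OF assms]]) (simp add: metric_sym assms)

lemma dg_linear2:
  assumes "c \<in> A" "x \<in> cimg c"
  shows "linear (\<lambda>v. dg c x a v w)"
  using dg_linear3[OF assms] by (simp add: dg_sym[OF assms, of a _ w])

lemma metric_C1_on:
  assumes c: "c \<in> A" and T: "open T" "p ` T \<subseteq> cimg c" and C1: "C1_on p T" "C1_on v T" "C1_on w T"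
  shows "C1_on (\<lambda>y. g c (p y) (v y) (w y)) T"
proof -
  note o = chart_open(2)[OF chart[OF c]]
  have "C1_on (\<lambda>y. g c (p y) v (w y)) T" for v
    using metric_linear(1)[OF c] C2_imp_C1[OF metric_C2[OF c]] o
    by (intro C1_on_linear_field[where S="cimg c", OF o _ _ C1(1,3) T(2,1)]) auto
  then show ?thesis
    using metric_linear(2)[OF c] T
    by (intro C1_on_linear_field[where D="\<lambda>y v. g c (p y) v (w y)" and S=T and p="\<lambda>y. y" and w=v, OF T(1)] C1_on_id C1) auto
qed

lemma dg_C1_on:
  assumes c: "c \<in> A" and T: "open T" "p ` T \<subseteq> cimg c" and C1: "C1_on p T" "C1_on a T" "C1_on v T" "C1_on w T"
  shows "C1_on (\<lambda>y. dg c (p y) (a y) (v y) (w y)) T"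
proof -
  note o = chart_open(2)[OF chart[OF c]]
  have "C1_on (\<lambda>x. dg c x a v w) (cimg c)" for a v w
    unfolding dg_def using metric_C2[OF c, of v w] unfolding C2_iff by blast
  then have "C1_on (\<lambda>y. dg c (p y) a v (w y)) T" for a v
    using dg_linear3[OF c]
    by (intro C1_on_linear_field[where S="cimg c", OF o _ _ C1(1,4) T(2,1)]) auto
  then have "C1_on (\<lambda>y. dg c (p y) a (v y) (w y)) T" for a
    using dg_linear2[OF c] T
    by (intro C1_on_linear_field[where D="\<lambda>y v. dg c (p y) a v (w y)" and S=T and p="\<lambda>y. y" and w=v, OF T(1)] C1_on_id C1) auto
  then show ?thesis
    using dg_linear1[OF c] T
    by (intro C1_on_linear_field[where D="\<lambda>y a. dg c (p y) a (v y) (w y)" and S=T and p="\<lambda>y. y" and w=a, OF T(1)] C1_on_id C1) auto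
qed

text \<open>The product rule for the metric along three varying arguments.\<close>

lemma metric_has_derivative:
  assumes c: "c \<in> A" and p: "p x \<in> cimg c"
    and D: "(p has_derivative p') (at x)" "(v has_derivative v') (at x)" "(w has_derivative w') (at x)"
  shows "((\<lambda>y. g c (p y) (v y) (w y)) has_derivative
     (\<lambda>h. dg c (p x) (p' h) (v x) (w x) + g c (p x) (v' h) (w x) + g c (p x) (v x) (w' h))) (at x)"
proof -
  define J where "J q = g c (fst q) (fst (snd q)) (snd (snd q))" for q :: "'e \<times> 'e \<times> 'e"
  let ?q = "(p x, v x, w x)"
  note o = chart_open(2)[OF chart[OF c]]
  have "C1_on J (cimg c \<times> UNIV)"
    unfolding J_def by (intro metric_C1_on[OF c] C1_intros open_Times o) auto
  then obtain J' where J': "(J has_derivative blinfun_apply J') (at ?q)"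
    using p unfolding C1_on_def by force
  have 1: "J' (a, 0, 0) = dg c (p x) a (v x) (w x)" for a
  proof -
    have "((\<lambda>y. J (y, v x, w x)) has_derivative (\<lambda>a. J' (a, 0, 0))) (at (p x))"
      by (rule has_derivative_compose[where f="\<lambda>y. (y, v x, w x)", OF _ J'])
         (intro has_derivative_Pair has_derivative_const has_derivative_ident)
    then show ?thesis
      using has_derivative_unique[OF dg_has_derivative[OF c p, of "v x" "w x"]] by (simp add: J_def) metis
  qed
  have 2: "J' (0, b, 0) = g c (p x) b (w x)" for b
  proof -
    have "((\<lambda>y. J (p x, y, w x)) has_derivative (\<lambda>b. J' (0, b, 0))) (at (v x))"
      by (rule has_derivative_compose[where f="\<lambda>y. (p x, y, w x)", OF _ J'])
         (intro has_derivative_Pair has_derivative_const has_derivative_ident)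
    then show ?thesis
      using has_derivative_unique[OF linear_imp_has_derivative[OF metric_linear(2)[OF c p, of "w x"]]]
      by (simp add: J_def) metis
  qed
  have 3: "J' (0, 0, b) = g c (p x) (v x) b" for b
  proof -
    have "((\<lambda>y. J (p x, v x, y)) has_derivative (\<lambda>b. J' (0, 0, b))) (at (w x))"
      by (rule has_derivative_compose[where f="\<lambda>y. (p x, v x, y)", OF _ J'])
         (intro has_derivative_Pair has_derivative_const has_derivative_ident)
    then show ?thesis
      using has_derivative_unique[OF linear_imp_has_derivative[OF metric_linear(1)[OF c p, of "v x"]]]
      by (simp add: J_def) metis
  qed
  have "((\<lambda>y. J (p y, v y, w y)) has_derivative (\<lambda>h. J' (p' h, v' h, w' h))) (at x)"
    by (rule has_derivative_compose[where f="\<lambda>y. (p y, v y, w y)", OF _ J'])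
       (intro has_derivative_Pair D)
  moreover have "J' (a, b, e) = dg c (p x) a (v x) (w x) + g c (p x) b (w x) + g c (p x) (v x) e" for a b e
  proof -
    have "(a, b, e) = (a, 0, 0) + (0, b, 0) + (0, 0, e)" by simp
    then show ?thesis by (metis (no_types) blinfun.add_right 1 2 3)
  qed
  ultimately show ?thesis by (simp add: J_def)
qed

subsection \<open>Gradient and Christoffel symbols\<close>

abbreviation dV :: "('m, 'e) chart \<Rightarrow> 'e \<Rightarrow> 'e \<Rightarrow> real" where
  "dV c x u \<equiv> frechet_derivative (Vc c) (at x) u"

abbreviation grad :: "('m, 'e) chart \<Rightarrow> 'e \<Rightarrow> 'e" where
  "grad c x \<equiv> gradient g V c x"

lemma gradient_eq:
  assumes "c \<in> A" "x \<in> cimg c"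
  shows "g c x (grad c x) u = dV c x u"
proof -
  have "linear (dV c x)" using Vc_differentiable[OF assms] by (rule linear_frechet_derivative)
  from theI'[OF posdef_representation[OF metric_bilinear[OF assms] metric_pos[OF assms] this]]
  show ?thesis unfolding gradient_def by blast
qed

lemma gradient_C1_on:
  assumes c: "c \<in> A"
  shows "C1_on (gradient g V c) (cimg c)"
proof (rule C1_on_posdef_representation[OF chart_open(2)[OF chart[OF c]] metric_bilinear[OF c] metric_pos[OF c]])
  show "linear (dV c x)" if "x \<in> cimg c" for x
    using Vc_differentiable[OF c that] by (rule linear_frechet_derivative)
  show "C1_on (\<lambda>x. dV c x u) (cimg c)" for u
    using Vc_C2[OF c] unfolding C2_iff by blast
  show "C1_on (\<lambda>x. g c x v w) (cimg c)" for v w by (rule C2_imp_C1[OF metric_C2[OF c]])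
  show "g c x (grad c x) u = dV c x u" if "x \<in> cimg c" for x u by (rule gradient_eq[OF c that])
qed

abbreviation \<Gamma> :: "('m, 'e) chart \<Rightarrow> 'e \<Rightarrow> 'e \<Rightarrow> 'e" where
  "\<Gamma> c x v \<equiv> christoffel g c x v v"

lemma koszul_linear:
  assumes "c \<in> A" "x \<in> cimg c"
  shows "linear (\<lambda>u. dg c x v v u - dg c x u v v / 2)"
  by (intro linear_compose_sub dg_linear3[OF assms] linear_compose_scale_right[OF dg_linear1[OF assms], of "1/2", simplified])
    
lemma christoffel_eq:
  assumes "c \<in> A" "x \<in> cimg c"
  shows "g c x (\<Gamma> c x v) u = dg c x v v u - dg c x u v v / 2"
proof -
  have eq: "(dg c x v v u + dg c x v v u - dg c x u v v) / 2 = dg c x v v u - dg c x u v v / 2" for u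
    by simp
  have "\<Gamma> c x v = (THE z. \<forall>u. g c x z u = dg c x v v u - dg c x u v v / 2)"
    unfolding christoffel_def dg_def[symmetric] eq by (rule refl)
  moreover have "\<forall>u. g c x (THE z. \<forall>u. g c x z u = dg c x v v u - dg c x u v v / 2) u = dg c x v v u - dg c x u v v / 2"
    by (rule theI'[OF posdef_representation[OF metric_bilinear[OF assms] metric_pos[OF assms] koszul_linear[OF assms]]])
  ultimately show ?thesis by simp
qed

lemma christoffel_C1_on:
  assumes c: "c \<in> A" and T: "open T" "p ` T \<subseteq> cimg c" and C1: "C1_on p T" "C1_on v T"
  shows "C1_on (\<lambda>y. \<Gamma> c (p y) (v y)) T"
proof -
  note o = chart_open(2)[OF chart[OF c]]
  have "C1_on (\<lambda>q. \<Gamma> c (fst q) (snd q)) (cimg c \<times> UNIV)"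
  proof (rule C1_on_posdef_representation[where B="\<lambda>q. g c (fst q)" and
        l="\<lambda>q u. dg c (fst q) (snd q) (snd q) u - dg c (fst q) u (snd q) (snd q) / 2"])
    show "C1_on (\<lambda>q. g c (fst q) v w) (cimg c \<times> UNIV)" for v w
      by (intro metric_C1_on[OF c] C1_intros open_Times o) auto
    show "C1_on (\<lambda>q. dg c (fst q) (snd q) (snd q) u - dg c (fst q) u (snd q) (snd q) / 2) (cimg c \<times> UNIV)" for u
      by (intro dg_C1_on[OF c] C1_intros C1_on_divide open_Times o) auto
    show "open (cimg c \<times> (UNIV :: 'e set))" by (intro open_Times o open_UNIV)
  qed (use christoffel_eq[OF c] metric_bilinear[OF c] metric_pos[OF c] koszul_linear[OF c] in \<open>auto\<close>)
  from C1_on_compose[OF this C1_on_Pair[OF C1]] show ?thesis using T by auto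
qed

end

section \<open>Change of charts\<close>

text \<open>The derivative of the map of tangent bundles induced by a map of class C^2.\<close>

lemma frechet_derivative_has_derivative_pair:
  fixes f :: "'a::euclidean_space \<Rightarrow> 'b::euclidean_space"
  assumes f: "Ck_on (Suc (Suc 0)) f S" "open S" and p: "p x \<in> S"
    and D: "(p has_derivative p') (at x)" "(w has_derivative w') (at x)"
  shows "((\<lambda>y. frechet_derivative f (at (p y)) (w y)) has_derivative
     (\<lambda>h. frechet_derivative (\<lambda>q. frechet_derivative f (at q) (w x)) (at (p x)) (p' h)
          + frechet_derivative f (at (p x)) (w' h))) (at x)"
proof -
  define J where "J q = frechet_derivative f (at (fst q)) (snd q)" for q :: "'a \<times> 'a"
  let ?H = "\<lambda>h. frechet_derivative (\<lambda>q. frechet_derivative f (at q) (w x)) (at (p x)) h"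
  have "C1_on J (S \<times> UNIV)"
    unfolding J_def by (rule C1_on_frechet_derivative[OF f]) (auto intro!: C1_intros open_Times f(2))
  then obtain J0 where J0: "\<And>q. q \<in> S \<times> UNIV \<Longrightarrow> (J has_derivative blinfun_apply (J0 q)) (at q)"
    by (rule C1_onE) blast
  have J': "(J has_derivative blinfun_apply (J0 (p x, w x))) (at (p x, w x))"
    by (rule J0) (use p in simp)
  have 1: "J0 (p x, w x) (a, 0) = ?H a" for a
  proof -
    have 0: "((\<lambda>y. J (y, w x)) has_derivative (\<lambda>a. J0 (p x, w x) (a, 0))) (at (p x))"
      by (rule has_derivative_compose[where f="\<lambda>y. (y, w x)", OF _ J'])
         (intro has_derivative_Pair has_derivative_const has_derivative_ident)
    show ?thesis
      using fun_cong[OF frechet_derivative_at[OF 0], of a] by (simp add: J_def)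
  qed
  have 2: "J0 (p x, w x) (0, b) = frechet_derivative f (at (p x)) b" for b
  proof -
    have 0: "((\<lambda>y. J (p x, y)) has_derivative (\<lambda>a. J0 (p x, w x) (0, a))) (at (w x))"
      by (rule has_derivative_compose[where f="\<lambda>y. (p x, y)", OF _ J'])
         (intro has_derivative_Pair has_derivative_const has_derivative_ident)
    have "linear (frechet_derivative f (at (p x)))"
      using C1_on_differentiable[OF C2_imp_C1[OF f(1)] p] by (rule linear_frechet_derivative)
    then have "((\<lambda>y. J (p x, y)) has_derivative frechet_derivative f (at (p x))) (at (w x))"
      unfolding J_def by (simp add: linear_imp_has_derivative)
    then show ?thesis using fun_cong[OF has_derivative_unique[OF 0], of _ b] by simp
  qed
  have "((\<lambda>y. J (p y, w y)) has_derivative (\<lambda>h. J0 (p x, w x) (p' h, w' h))) (at x)"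
    by (rule has_derivative_compose[where f="\<lambda>y. (p y, w y)", OF _ J'])
       (intro has_derivative_Pair D)
  moreover have "J0 (p x, w x) (a, b) = ?H a + frechet_derivative f (at (p x)) b" for a b
  proof -
    have "(a, b) = (a, 0) + (0, b)" by simp
    then show ?thesis by (metis (no_types) blinfun.add_right 1 2)
  qed
  ultimately show ?thesis by (simp add: J_def)
qed

lemma vector_derivative_cong_open:
  assumes "open J" "s \<in> J" "\<And>r. r \<in> J \<Longrightarrow> f r = h r"
  shows "vector_derivative f (at s) = vector_derivative h (at s)"
    and "f differentiable (at s) \<longleftrightarrow> h differentiable (at s)"
proof -
  have *: "(f has_vector_derivative d) (at s) \<longleftrightarrow> (h has_vector_derivative d) (at s)" for d
    using has_vector_derivative_transform_within_open[OF _ assms(1,2), of f d h]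
      has_vector_derivative_transform_within_open[OF _ assms(1,2), of h d f] assms(3) by metis
  then show "vector_derivative f (at s) = vector_derivative h (at s)"
    by (simp add: vector_derivative_def)
  show "f differentiable (at s) \<longleftrightarrow> h differentiable (at s)"
    using * by (metis vector_derivative_works differentiableI_vector)
qed

context jacobi_setup
begin

definition tmap :: "('m, 'e) chart \<Rightarrow> ('m, 'e) chart \<Rightarrow> 'e \<Rightarrow> 'e" where
  "tmap c d = cmap d \<circ> cinv c"

definition dtrans :: "('m, 'e) chart \<Rightarrow> ('m, 'e) chart \<Rightarrow> 'e \<Rightarrow> 'e \<Rightarrow> 'e" where
  "dtrans c d x = frechet_derivative (tmap c d) (at x)"

definition ddtrans :: "('m, 'e) chart \<Rightarrow> ('m, 'e) chart \<Rightarrow> 'e \<Rightarrow> 'e \<Rightarrow> 'e \<Rightarrow> 'e" where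
  "ddtrans c d x a v = frechet_derivative (\<lambda>y. dtrans c d y v) (at x) a"

lemma tmap_C2: "c \<in> A \<Longrightarrow> d \<in> A \<Longrightarrow> Ck_on (Suc (Suc 0)) (tmap c d) (overlap c d)"
  unfolding tmap_def by (rule transition_C2)

lemma open_overlap_A: "c \<in> A \<Longrightarrow> d \<in> A \<Longrightarrow> open (overlap c d)"
  by (intro open_overlap chart)

lemma overlap_A: "c \<in> A \<Longrightarrow> y \<in> overlap c d \<longleftrightarrow> y \<in> cimg c \<and> cinv c y \<in> cdom d"
  by (intro overlap_iff chart)

lemma tmap_has_derivative:
  assumes "c \<in> A" "d \<in> A" "x \<in> overlap c d"
  shows "(tmap c d has_derivative dtrans c d x) (at x)"
  using C1_on_differentiable[OF C2_imp_C1[OF tmap_C2[OF assms(1,2)]] assms(3)]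
  unfolding dtrans_def by (simp add: frechet_derivative_works)

lemma dtrans_linear: "c \<in> A \<Longrightarrow> d \<in> A \<Longrightarrow> x \<in> overlap c d \<Longrightarrow> linear (dtrans c d x)"
  using tmap_has_derivative has_derivative_linear by blast

lemma dtrans_has_derivative:
  assumes "c \<in> A" "d \<in> A" "x \<in> overlap c d"
  shows "((\<lambda>y. dtrans c d y v) has_derivative (\<lambda>a. ddtrans c d x a v)) (at x)"
proof -
  have "C1_on (\<lambda>y. dtrans c d y v) (overlap c d)"
    using tmap_C2[OF assms(1,2)] unfolding C2_iff dtrans_def by blast
  then show ?thesis
    using C1_on_differentiable assms(3) unfolding ddtrans_def by (simp add: frechet_derivative_works)
qed

lemma ddtrans_sym:
  assumes "c \<in> A" "d \<in> A" "x \<in> overlap c d"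
  shows "ddtrans c d x a v = ddtrans c d x v a"
  unfolding ddtrans_def dtrans_def
  by (rule symmetric_second_derivative[OF tmap_C2[OF assms(1,2)] open_overlap_A[OF assms(1,2)] assms(3)])

lemma tmap_overlap:
  assumes "c \<in> A" "d \<in> A" "x \<in> overlap c d"
  shows "tmap c d x \<in> overlap d c" "tmap d c (tmap c d x) = x" "tmap c d x \<in> cimg d"
    "cinv d (tmap c d x) = cinv c x"
proof -
  have x: "x \<in> cimg c" "cinv c x \<in> cdom d" using assms overlap_A by auto
  show 1: "tmap c d x \<in> cimg d" using cmap_in[OF chart[OF assms(2)] x(2)] by (simp add: tmap_def)
  show 2: "cinv d (tmap c d x) = cinv c x" using cinv_cmap[OF chart[OF assms(2)] x(2)] by (simp add: tmap_def)
  show "tmap c d x \<in> overlap d c"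
    using 1 2 cinv_in[OF chart[OF assms(1)] x(1)] overlap_A[OF assms(2)] by simp
  show "tmap d c (tmap c d x) = x"
    using 2 cmap_cinv[OF chart[OF assms(1)] x(1)] by (simp add: tmap_def)
qed

text \<open>In particular every vector is in the range of the derivative of a change of charts, so that
  identities may be tested on transformed vectors.\<close>

lemma dtrans_inverse:
  assumes "c \<in> A" "d \<in> A" "x \<in> overlap c d"
  shows "dtrans d c (tmap c d x) (dtrans c d x u) = u"
proof -
  have "((\<lambda>y. tmap d c (tmap c d y)) has_derivative (\<lambda>u. dtrans d c (tmap c d x) (dtrans c d x u))) (at x)"
    by (rule has_derivative_compose[OF tmap_has_derivative[OF assms] tmap_has_derivative[OF assms(2,1) tmap_overlap(1)[OF assms]]])
  then have "((\<lambda>y. y) has_derivative (\<lambda>u. dtrans d c (tmap c d x) (dtrans c d x u))) (at x)"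
    by (rule has_derivative_transform_within_open[OF _ open_overlap_A[OF assms(1,2)] assms(3)])
       (simp add: tmap_overlap assms(1,2))
  then show ?thesis
    using has_derivative_unique[OF has_derivative_ident] by metis
qed

lemma metric_transform':
  assumes "c \<in> A" "d \<in> A" "x \<in> overlap c d"
  shows "g c x v w = g d (tmap c d x) (dtrans c d x v) (dtrans c d x w)"
  using metric_transform[OF assms] by (simp add: tmap_def dtrans_def o_def)

lemma dg_transform:
  assumes "c \<in> A" "d \<in> A" "x \<in> overlap c d"
  shows "dg c x a v w = dg d (tmap c d x) (dtrans c d x a) (dtrans c d x v) (dtrans c d x w)
      + g d (tmap c d x) (ddtrans c d x a v) (dtrans c d x w)
      + g d (tmap c d x) (dtrans c d x v) (ddtrans c d x a w)"
proof -
  have "((\<lambda>y. g d (tmap c d y) (dtrans c d y v) (dtrans c d y w)) has_derivative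
     (\<lambda>a. dg d (tmap c d x) (dtrans c d x a) (dtrans c d x v) (dtrans c d x w)
      + g d (tmap c d x) (ddtrans c d x a v) (dtrans c d x w)
      + g d (tmap c d x) (dtrans c d x v) (ddtrans c d x a w))) (at x)"
    by (rule metric_has_derivative[OF assms(2) tmap_overlap(3)[OF assms] tmap_has_derivative[OF assms]
          dtrans_has_derivative[OF assms] dtrans_has_derivative[OF assms]])
  then have "((\<lambda>y. g c y v w) has_derivative
     (\<lambda>a. dg d (tmap c d x) (dtrans c d x a) (dtrans c d x v) (dtrans c d x w)
      + g d (tmap c d x) (ddtrans c d x a v) (dtrans c d x w)
      + g d (tmap c d x) (dtrans c d x v) (ddtrans c d x a w))) (at x)"
    by (rule has_derivative_transform_within_open[OF _ open_overlap_A[OF assms(1,2)] assms(3)])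
       (simp add: metric_transform'[OF assms(1,2)])
  then have "(\<lambda>a. dg c x a v w) = (\<lambda>a. dg d (tmap c d x) (dtrans c d x a) (dtrans c d x v) (dtrans c d x w)
      + g d (tmap c d x) (ddtrans c d x a v) (dtrans c d x w)
      + g d (tmap c d x) (dtrans c d x v) (ddtrans c d x a w))"
    using has_derivative_unique[OF dg_has_derivative[OF assms(1)]] assms overlap_A by blast
  then show ?thesis by (rule fun_cong)
qed

text \<open>The inhomogeneous term in the transformation of the Christoffel symbols is the second
  derivative of the change of charts; the remaining second derivatives cancel by symmetry.\<close>

lemma christoffel_transform:
  assumes "c \<in> A" "d \<in> A" "x \<in> overlap c d"
  shows "\<Gamma> d (tmap c d x) (dtrans c d x v) = dtrans c d x (\<Gamma> c x v) - ddtrans c d x v v"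
proof (rule metric_nondegenerate[OF assms(2) tmap_overlap(3)[OF assms]])
  fix u
  have xc: "x \<in> cimg c" using assms overlap_A by blast
  note td = tmap_overlap(3)[OF assms]
  obtain w where u: "u = dtrans c d x w"
    using dtrans_inverse[OF assms(2,1) tmap_overlap(1)[OF assms], of u] tmap_overlap(2)[OF assms] by metis
  let ?D = "dtrans c d x" and ?y = "tmap c d x" and ?H = "ddtrans c d x"
  have "g d ?y (?D (\<Gamma> c x v) - ?H v v) u = g d ?y (?D (\<Gamma> c x v)) (?D w) - g d ?y (?H v v) (?D w)"
    unfolding u by (rule bilinear_lsub[OF metric_bilinear[OF assms(2) td]])
  also have "g d ?y (?D (\<Gamma> c x v)) (?D w) = dg c x v v w - dg c x w v v / 2"
    using christoffel_eq[OF assms(1) xc] metric_transform'[OF assms] by metis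
  also have "dg c x v v w = dg d ?y (?D v) (?D v) (?D w) + g d ?y (?H v v) (?D w) + g d ?y (?D v) (?H v w)"
    by (rule dg_transform[OF assms])
  also have "dg c x w v v = dg d ?y (?D w) (?D v) (?D v) + g d ?y (?H v w) (?D v) + g d ?y (?D v) (?H v w)"
    using dg_transform[OF assms, of w v v] ddtrans_sym[OF assms, of w v] by simp
  also have "g d ?y (?H v w) (?D v) = g d ?y (?D v) (?H v w)"
    by (rule metric_sym[OF assms(2) td])
  finally have "g d ?y (?D (\<Gamma> c x v) - ?H v v) u = dg d ?y (?D v) (?D v) (?D w) - dg d ?y (?D w) (?D v) (?D v) / 2"
    by (simp add: field_simps)
  then show "g d ?y (\<Gamma> d ?y (?D v)) u = g d ?y (?D (\<Gamma> c x v) - ?H v v) u"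
    unfolding u using christoffel_eq[OF assms(2) td, of "?D v" "?D w"] by simp
qed

lemma gradient_transform:
  assumes "c \<in> A" "d \<in> A" "x \<in> overlap c d"
  shows "grad d (tmap c d x) = dtrans c d x (grad c x)"
proof (rule metric_nondegenerate[OF assms(2) tmap_overlap(3)[OF assms]])
  fix u
  have xc: "x \<in> cimg c" using assms overlap_A by blast
  note td = tmap_overlap(3)[OF assms]
  obtain w where u: "u = dtrans c d x w"
    using dtrans_inverse[OF assms(2,1) tmap_overlap(1)[OF assms], of u] tmap_overlap(2)[OF assms] by metis
  have "(Vc d has_derivative frechet_derivative (Vc d) (at (tmap c d x))) (at (tmap c d x))"
    using Vc_differentiable[OF assms(2) td] by (simp add: frechet_derivative_works)
  from has_derivative_compose[OF tmap_has_derivative[OF assms] this]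
  have "(Vc c has_derivative (\<lambda>w. dV d (tmap c d x) (dtrans c d x w))) (at x)"
    by (rule has_derivative_transform_within_open[OF _ open_overlap_A[OF assms(1,2)] assms(3)])
       (simp add: tmap_overlap(4) assms(1,2))
  from frechet_derivative_at[OF this]
  have "dV c x w = dV d (tmap c d x) (dtrans c d x w)" by metis
  then show "g d (tmap c d x) (grad d (tmap c d x)) u = g d (tmap c d x) (dtrans c d x (grad c x)) u"
    unfolding u gradient_eq[OF assms(2) td] using metric_transform'[OF assms, of "grad c x" w] gradient_eq[OF assms(1) xc, of w]
    by simp
qed

section \<open>The Jacobi equation as a differential equation on the manifold\<close>

text \<open>The left-hand side of the Jacobi equation at position y, velocity v and coordinate
  acceleration a. It transforms like a tangent vector, the acceleration absorbing the
  inhomogeneous term of the Christoffel symbols; so the equation in one chart implies it in all.\<close>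

definition jac :: "('m, 'e) chart \<Rightarrow> 'e \<Rightarrow> 'e \<Rightarrow> 'e \<Rightarrow> 'e" where
  "jac c y v a = (E - Vc c y) *\<^sub>R (a + \<Gamma> c y v) - g c y (grad c y) v *\<^sub>R v + (g c y v v / 2) *\<^sub>R grad c y"

lemma jac_transform:
  assumes "c \<in> A" "d \<in> A" "x \<in> overlap c d"
  shows "jac d (tmap c d x) (dtrans c d x v) (ddtrans c d x v v + dtrans c d x a) = dtrans c d x (jac c x v a)"
proof -
  note l = dtrans_linear[OF assms]
  show ?thesis
    unfolding jac_def christoffel_transform[OF assms] gradient_transform[OF assms] metric_transform'[OF assms, symmetric]
    using tmap_overlap(4)[OF assms]
    by (simp add: linear_add[OF l] linear_diff[OF l] linear_cmul[OF l])
qed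

definition jsol_at :: "(real \<Rightarrow> 'm) \<Rightarrow> real \<Rightarrow> bool" where
  "jsol_at x s \<longleftrightarrow> V (x s) < E \<and> (\<forall>c\<in>A. x s \<in> cdom c \<longrightarrow>
     (cmap c \<circ> x) differentiable (at s) \<and> (\<lambda>r. velocity x r c) differentiable (at s) \<and>
     jac c (cmap c (x s)) (velocity x s c) (vector_derivative (\<lambda>r. velocity x r c) (at s)) = 0)"

definition jsol_on :: "(real \<Rightarrow> 'm) \<Rightarrow> real set \<Rightarrow> bool" where
  "jsol_on x I \<longleftrightarrow> open I \<and> is_interval I \<and> continuous_on I x \<and> (\<forall>s\<in>I. jsol_at x s)"

lemma jacobi_geodesic_iff: "jacobi_geodesic A g V E \<gamma> \<longleftrightarrow> jsol_on (the \<circ> \<gamma>) (dom \<gamma>)"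
proof -
  have "(\<forall>p \<in> ran \<gamma>. V p < E) \<longleftrightarrow> (\<forall>s \<in> dom \<gamma>. V (the (\<gamma> s)) < E)"
    by (auto simp: ran_def dom_def)
  moreover have "jac c (cmap c (the (\<gamma> s))) (velocity (the \<circ> \<gamma>) s c) (vector_derivative (\<lambda>r. velocity (the \<circ> \<gamma>) r c) (at s))
     = (E - V (the (\<gamma> s))) *\<^sub>R covariant_derivative g c (the \<circ> \<gamma>) (\<lambda>r. velocity (the \<circ> \<gamma>) r c) s
      - g c (cmap c (the (\<gamma> s))) (grad c (cmap c (the (\<gamma> s)))) (velocity (the \<circ> \<gamma>) s c) *\<^sub>R velocity (the \<circ> \<gamma>) s c
      + (g c (cmap c (the (\<gamma> s))) (velocity (the \<circ> \<gamma>) s c) (velocity (the \<circ> \<gamma>) s c) / 2) *\<^sub>R grad c (cmap c (the (\<gamma> s)))"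
    if "c \<in> A" "the (\<gamma> s) \<in> cdom c" for c s
    using cinv_cmap[OF chart[OF that(1)] that(2)] by (simp add: jac_def covariant_derivative_def)
  ultimately show ?thesis
    unfolding jacobi_geodesic_def jsol_on_def jsol_at_def Let_def comp_apply by (simp cong: conj_cong) blast
qed

lemma velocity_cong:
  assumes "open J" "s \<in> J" "\<And>r. r \<in> J \<Longrightarrow> x r = y r"
  shows "velocity x s c = velocity y s c"
  unfolding velocity_def by (rule vector_derivative_cong_open(1)[OF assms(1,2)]) (simp add: assms(3))

lemma jsol_at_cong:
  assumes J: "open J" "s \<in> J" "\<And>r. r \<in> J \<Longrightarrow> x r = y r" and x: "jsol_at x s"
  shows "jsol_at y s"
proof -
  have v: "velocity x r c = velocity y r c" if "r \<in> J" for r and c :: "('m, 'e) chart"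
    by (rule velocity_cong[OF J(1) that J(3)])
  have "(cmap c \<circ> x) differentiable (at s) \<longleftrightarrow> (cmap c \<circ> y) differentiable (at s)" for c :: "('m, 'e) chart"
    by (rule vector_derivative_cong_open(2)[OF J(1,2)]) (simp add: J(3))
  moreover have "(\<lambda>r. velocity x r c) differentiable (at s) \<longleftrightarrow> (\<lambda>r. velocity y r c) differentiable (at s)"
    "vector_derivative (\<lambda>r. velocity x r c) (at s) = vector_derivative (\<lambda>r. velocity y r c) (at s)" for c :: "('m, 'e) chart"
    by (rule vector_derivative_cong_open[OF J(1,2)], rule v, assumption)+
  ultimately show ?thesis
    using x J(2,3) v[OF J(2)] unfolding jsol_at_def by simp
qed

lemma jsol_on_cong:
  assumes "jsol_on x I" "\<And>s. s \<in> I \<Longrightarrow> x s = y s"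
  shows "jsol_on y I"
  using assms(1) continuous_on_eq[of I x y] jsol_at_cong[of I _ x y] assms(2) unfolding jsol_on_def by simp

lemma jsol_on_subset:
  assumes "jsol_on x I" "J \<subseteq> I" "open J" "is_interval J"
  shows "jsol_on x J"
  using assms continuous_on_subset[of I x J] unfolding jsol_on_def by blast

text \<open>The acceleration picks up the second derivative of the change of charts, the velocity only the
  first.\<close>

lemma curve_transform:
  assumes cd: "c \<in> A" "d \<in> A" and J: "open J" "s \<in> J" and x: "\<And>r. r \<in> J \<Longrightarrow> x r \<in> cdom c \<inter> cdom d"
    and v: "\<And>r. r \<in> J \<Longrightarrow> (cmap c \<circ> x) differentiable (at r)"
  shows "(cmap d \<circ> x) differentiable (at s)"
    "velocity x s d = dtrans c d (cmap c (x s)) (velocity x s c)"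
    "((\<lambda>r. velocity x r c) has_vector_derivative a) (at s) \<Longrightarrow>
      ((\<lambda>r. velocity x r d) has_vector_derivative
         ddtrans c d (cmap c (x s)) (velocity x s c) (velocity x s c) + dtrans c d (cmap c (x s)) a) (at s)"
proof -
  have ov: "cmap c (x r) \<in> overlap c d" if "r \<in> J" for r
    using x[OF that] unfolding overlap_def by blast
  have vc: "((cmap c \<circ> x) has_vector_derivative velocity x r c) (at r)" if "r \<in> J" for r
    using v[OF that] unfolding velocity_def by (simp add: vector_derivative_works)
  have vd: "((cmap d \<circ> x) has_vector_derivative dtrans c d (cmap c (x r)) (velocity x r c)) (at r)" if r: "r \<in> J" for r
  proof -
    have "((\<lambda>r. tmap c d ((cmap c \<circ> x) r)) has_derivative (\<lambda>h. dtrans c d (cmap c (x r)) (h *\<^sub>R velocity x r c))) (at r)"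
      using has_derivative_compose[OF vc[OF r, unfolded has_vector_derivative_def], of "tmap c d" "dtrans c d (cmap c (x r))"]
        tmap_has_derivative[OF cd ov[OF r]] by simp
    then have "((\<lambda>r. tmap c d ((cmap c \<circ> x) r)) has_vector_derivative dtrans c d (cmap c (x r)) (velocity x r c)) (at r)"
      by (simp add: has_vector_derivative_def linear_cmul[OF dtrans_linear[OF cd ov[OF r]]])
    then show ?thesis
      by (rule has_vector_derivative_transform_within_open[OF _ J(1) r])
         (use x cinv_cmap[OF chart[OF cd(1)]] in \<open>simp add: tmap_def\<close>)
  qed
  show "(cmap d \<circ> x) differentiable (at s)"
    using vd[OF J(2)] by (rule differentiableI_vector)
  have veq: "velocity x r d = dtrans c d (cmap c (x r)) (velocity x r c)" if "r \<in> J" for r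
    unfolding velocity_def[of x r d] by (rule vector_derivative_at[OF vd[OF that]])
  show "velocity x s d = dtrans c d (cmap c (x s)) (velocity x s c)" by (rule veq[OF J(2)])
  assume a: "((\<lambda>r. velocity x r c) has_vector_derivative a) (at s)"
  have "((\<lambda>r. frechet_derivative (tmap c d) (at ((cmap c \<circ> x) r)) (velocity x r c)) has_derivative
     (\<lambda>h. frechet_derivative (\<lambda>q. frechet_derivative (tmap c d) (at q) (velocity x s c)) (at ((cmap c \<circ> x) s)) (h *\<^sub>R velocity x s c)
       + frechet_derivative (tmap c d) (at ((cmap c \<circ> x) s)) (h *\<^sub>R a))) (at s)"
    by (rule frechet_derivative_has_derivative_pair[OF tmap_C2[OF cd] open_overlap_A[OF cd]])
       (use ov[OF J(2)] vc[OF J(2)] a in \<open>simp_all add: has_vector_derivative_def o_def\<close>)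
  then have *: "((\<lambda>r. dtrans c d (cmap c (x r)) (velocity x r c)) has_derivative
     (\<lambda>h. ddtrans c d (cmap c (x s)) (h *\<^sub>R velocity x s c) (velocity x s c)
       + dtrans c d (cmap c (x s)) (h *\<^sub>R a))) (at s)"
    by (simp add: dtrans_def ddtrans_def)
  have l2: "linear (\<lambda>a. ddtrans c d (cmap c (x s)) a (velocity x s c))"
    using dtrans_has_derivative[OF cd ov[OF J(2)]] has_derivative_linear by blast
  have "((\<lambda>r. dtrans c d (cmap c (x r)) (velocity x r c)) has_vector_derivative
     ddtrans c d (cmap c (x s)) (velocity x s c) (velocity x s c) + dtrans c d (cmap c (x s)) a) (at s)"
    using * by (simp add: has_vector_derivative_def linear_cmul[OF l2] scaleR_add_right
        linear_cmul[OF dtrans_linear[OF cd ov[OF J(2)]]])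
  then show "((\<lambda>r. velocity x r d) has_vector_derivative
         ddtrans c d (cmap c (x s)) (velocity x s c) (velocity x s c) + dtrans c d (cmap c (x s)) a) (at s)"
    by (rule has_vector_derivative_transform_within_open[OF _ J]) (simp add: veq)
qed

lemma open_preimage_curve:
  assumes "open J" "continuous_on J x" "open S"
  shows "open {r \<in> J. x r \<in> S}"
proof -
  have "open (J \<inter> x -` S)" using assms(2,1,3) by (rule continuous_open_preimage)
  then show ?thesis by (simp add: Int_def vimage_def)
qed

text \<open>It suffices to verify the equation in one chart.\<close>

lemma jsol_atI:
  assumes c: "c \<in> A" and J: "open J" "s \<in> J" "continuous_on J x" "\<And>r. r \<in> J \<Longrightarrow> x r \<in> cdom c"
    and v: "\<And>r. r \<in> J \<Longrightarrow> (cmap c \<circ> x) differentiable (at r)"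
    and a: "((\<lambda>r. velocity x r c) has_vector_derivative a) (at s)"
    and V: "V (x s) < E" and eq: "jac c (cmap c (x s)) (velocity x s c) a = 0"
  shows "jsol_at x s"
  unfolding jsol_at_def
proof (intro conjI ballI impI)
  show "V (x s) < E" by fact
  fix d assume d: "d \<in> A" "x s \<in> cdom d"
  let ?J = "{r \<in> J. x r \<in> cdom d}"
  have J': "open ?J" "s \<in> ?J" "\<And>r. r \<in> ?J \<Longrightarrow> x r \<in> cdom c \<inter> cdom d"
    using open_preimage_curve[OF J(1,3) chart_open(1)[OF chart[OF d(1)]]] J d by auto
  have v': "(cmap c \<circ> x) differentiable (at r)" if "r \<in> ?J" for r using v that by simp
  have T2: "velocity x s d = dtrans c d (cmap c (x s)) (velocity x s c)"
    by (rule curve_transform(2)[OF c d(1) J' v'])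
  have T3: "((\<lambda>r. velocity x r d) has_vector_derivative
         ddtrans c d (cmap c (x s)) (velocity x s c) (velocity x s c) + dtrans c d (cmap c (x s)) a) (at s)"
    by (rule curve_transform(3)[OF c d(1) J' v' a])
  show "(cmap d \<circ> x) differentiable (at s)" by (rule curve_transform(1)[OF c d(1) J' v'])
  show "(\<lambda>r. velocity x r d) differentiable (at s)" by (rule differentiableI_vector[OF T3])
  have ov: "cmap c (x s) \<in> overlap c d" using J'(2) J(4) unfolding overlap_def by blast
  have y: "cmap d (x s) = tmap c d (cmap c (x s))"
    using cinv_cmap[OF chart[OF c] J(4)[OF J(2)]] by (simp add: tmap_def)
  show "jac d (cmap d (x s)) (velocity x s d) (vector_derivative (\<lambda>r. velocity x r d) (at s)) = 0"
    unfolding vector_derivative_at[OF T3] T2 y jac_transform[OF c d(1) ov] eq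
    by (rule linear_0[OF dtrans_linear[OF c d(1) ov]])
qed

subsection \<open>The equation in a chart\<close>

definition state :: "(real \<Rightarrow> 'm) \<Rightarrow> ('m, 'e) chart \<Rightarrow> real \<Rightarrow> 'e \<times> 'e" where
  "state x c s = (cmap c (x s), velocity x s c)"

definition phase :: "('m, 'e) chart \<Rightarrow> ('e \<times> 'e) set" where
  "phase c = {y \<in> cimg c. cinv c y \<in> {p. V p < E}} \<times> UNIV"

text \<open>The Jacobi equation solved for the acceleration, as a first-order system for position and velocity.\<close>

definition jfield :: "('m, 'e) chart \<Rightarrow> 'e \<times> 'e \<Rightarrow> 'e \<times> 'e" where
  "jfield c z = (snd z, (1 / (E - Vc c (fst z))) *\<^sub>R (g c (fst z) (grad c (fst z)) (snd z) *\<^sub>R snd z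
      - (g c (fst z) (snd z) (snd z) / 2) *\<^sub>R grad c (fst z)) - \<Gamma> c (fst z) (snd z))"

lemma open_sublevel: "open {p. V p < E}"
proof -
  have "{p. V p < E} = V -` {..<E}" by auto
  then show ?thesis using continuous_V by (simp add: open_vimage)
qed

lemma open_phase: "c \<in> A \<Longrightarrow> open (phase c)"
  unfolding phase_def by (intro open_Times open_UNIV open_preimage_chart chart open_sublevel)

lemma phase_iff: "z \<in> phase c \<longleftrightarrow> fst z \<in> cimg c \<and> Vc c (fst z) < E"
  by (cases z) (auto simp: phase_def)

lemma jfield_C1:
  assumes c: "c \<in> A"
  shows "C1_on (jfield c) (phase c)"
proof -
  have im: "fst ` phase c \<subseteq> cimg c" by (auto simp: phase_iff)
  note o = open_phase[OF c]
  have f: "C1_on fst (phase c)" by (rule C1_on_bounded_linear[OF bounded_linear_fst])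
  have gr: "C1_on (\<lambda>z. grad c (fst z)) (phase c)"
    by (rule C1_on_compose[OF gradient_C1_on[OF c] f im])
  have "C1_on (\<lambda>z. Vc c (fst z)) (phase c)"
    by (rule C1_on_compose[OF Vc_C1[OF c] f im])
  then show ?thesis
    unfolding jfield_def using im
    by (intro C1_intros C1_on_divide christoffel_C1_on[OF c] metric_C1_on[OF c] o gr) (auto simp: phase_iff)
qed

lemma jac_zero_iff:
  assumes "Vc c y < E"
  shows "jac c y v a = 0 \<longleftrightarrow> a = snd (jfield c (y, v))"
proof -
  let ?W = "g c y (grad c y) v *\<^sub>R v - (g c y v v / 2) *\<^sub>R grad c y" and ?k = "E - Vc c y"
  have k: "?k \<noteq> 0" using assms by simp
  have factor: "r *\<^sub>R (b - (1 / r) *\<^sub>R W) = r *\<^sub>R b - W" if "r \<noteq> 0" for r :: real and b W :: 'e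
    using that by (simp add: scaleR_diff_right)
  have "jac c y v a = ?k *\<^sub>R (a + \<Gamma> c y v) - ?W" by (simp add: jac_def)
  also have "\<dots> = ?k *\<^sub>R (a + \<Gamma> c y v - (1 / ?k) *\<^sub>R ?W)"
    by (rule factor[OF k, symmetric])
  finally have "jac c y v a = 0 \<longleftrightarrow> a + \<Gamma> c y v - (1 / ?k) *\<^sub>R ?W = 0"
    using k by simp
  also have "\<dots> \<longleftrightarrow> a = (1 / ?k) *\<^sub>R ?W - \<Gamma> c y v" by (auto simp: algebra_simps)
  finally show ?thesis by (simp add: jfield_def)
qed

lemma jsol_state:
  assumes x: "jsol_at x s" and c: "c \<in> A" "x s \<in> cdom c"
  shows "state x c s \<in> phase c" "(state x c has_vector_derivative jfield c (state x c s)) (at s)"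
proof -
  have Vx: "Vc c (cmap c (x s)) < E" and ci: "cmap c (x s) \<in> cimg c"
    using x c cinv_cmap[OF chart[OF c(1)] c(2)] cmap_in[OF chart[OF c(1)] c(2)] by (auto simp: jsol_at_def)
  then show "state x c s \<in> phase c" by (simp add: phase_iff state_def)
  have d: "(cmap c \<circ> x) differentiable (at s)" "(\<lambda>r. velocity x r c) differentiable (at s)"
    "jac c (cmap c (x s)) (velocity x s c) (vector_derivative (\<lambda>r. velocity x r c) (at s)) = 0"
    using x c unfolding jsol_at_def by auto
  have 1: "((\<lambda>r. cmap c (x r)) has_vector_derivative velocity x s c) (at s)"
    using d(1) unfolding velocity_def vector_derivative_works o_def .
  have 2: "((\<lambda>r. velocity x r c) has_vector_derivative snd (jfield c (state x c s))) (at s)"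
    using d(2) unfolding vector_derivative_works d(3)[unfolded jac_zero_iff[OF Vx]] state_def .
  have "((\<lambda>r. (cmap c (x r), velocity x r c)) has_vector_derivative
      (velocity x s c, snd (jfield c (state x c s)))) (at s)"
    by (rule has_vector_derivative_Pair[OF 1 2])
  moreover have "(velocity x s c, snd (jfield c (state x c s))) = jfield c (state x c s)"
    by (simp add: jfield_def state_def)
  ultimately show "(state x c has_vector_derivative jfield c (state x c s)) (at s)"
    unfolding state_def[abs_def] by simp
qed

lemma ode_jsol:
  assumes c: "c \<in> A" and J: "open J" "is_interval J"
    and z: "\<And>s. s \<in> J \<Longrightarrow> z s \<in> phase c \<and> (z has_vector_derivative jfield c (z s)) (at s)"
  defines "x \<equiv> \<lambda>s. cinv c (fst (z s))"
  shows "jsol_on x J" "\<And>s. s \<in> J \<Longrightarrow> x s \<in> cdom c \<and> state x c s = z s"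
proof -
  have ci: "fst (z s) \<in> cimg c" "Vc c (fst (z s)) < E" if "s \<in> J" for s
    using z[OF that] by (auto simp: phase_iff)
  have xc: "x s \<in> cdom c" "cmap c (x s) = fst (z s)" if "s \<in> J" for s
    using ci(1)[OF that] cinv_in[OF chart[OF c]] cmap_cinv[OF chart[OF c]] by (auto simp: x_def)
  have cz: "continuous_on J z"
    by (intro continuous_at_imp_continuous_on ballI) (meson z has_vector_derivative_continuous)
  have cx: "continuous_on J x"
    unfolding x_def using ci
    by (intro continuous_on_compose2[OF continuous_on_cinv[OF chart[OF c]]] continuous_on_fst cz) auto
  have d: "((cmap c \<circ> x) has_vector_derivative snd (z s)) (at s)" if s: "s \<in> J" for s
  proof -
    have "((\<lambda>s. fst (z s)) has_vector_derivative fst (jfield c (z s))) (at s)"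
      using bounded_linear.has_vector_derivative[OF bounded_linear_fst] z[OF s] by blast
    then have "((\<lambda>s. fst (z s)) has_vector_derivative snd (z s)) (at s)" by (simp add: jfield_def)
    then show ?thesis
      by (rule has_vector_derivative_transform_within_open[OF _ J(1) s]) (simp add: xc(2))
  qed
  have v: "velocity x s c = snd (z s)" if "s \<in> J" for s
    unfolding velocity_def by (rule vector_derivative_at[OF d[OF that]])
  show "\<And>s. s \<in> J \<Longrightarrow> x s \<in> cdom c \<and> state x c s = z s"
    by (simp add: xc v state_def)
  have "jsol_at x s" if s: "s \<in> J" for s
  proof (rule jsol_atI[OF c J(1) s cx xc(1) differentiableI_vector[OF d]])
    have "((\<lambda>s. snd (z s)) has_vector_derivative snd (jfield c (z s))) (at s)"
      using bounded_linear.has_vector_derivative[OF bounded_linear_snd] z[OF s] by blast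
    then show "((\<lambda>r. velocity x r c) has_vector_derivative snd (jfield c (z s))) (at s)"
      by (rule has_vector_derivative_transform_within_open[OF _ J(1) s]) (simp add: v)
    show "V (x s) < E" using ci(2)[OF s] by (simp add: x_def)
    show "jac c (cmap c (x s)) (velocity x s c) (snd (jfield c (z s))) = 0"
      using ci(2)[OF s] unfolding xc(2)[OF s] v[OF s] jac_zero_iff[OF ci(2)[OF s]] by simp
  qed
  then show "jsol_on x J" unfolding jsol_on_def using J cx by blast
qed

end

section \<open>Global uniqueness, gluing and transport along a Jacobi geodesic\<close>

context jacobi_setup
begin

lemma jsol_onD:
  assumes "jsol_on x I"
  shows "open I" "is_interval I" "continuous_on I x" "\<And>s. s \<in> I \<Longrightarrow> jsol_at x s"
  using assms unfolding jsol_on_def by auto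

lemma state_cong:
  assumes "open J" "s \<in> J" "\<And>r. r \<in> J \<Longrightarrow> x r = y r"
  shows "state x c s = state y c s"
proof -
  have "velocity x s c = velocity y s c" by (rule velocity_cong[OF assms])
  then show ?thesis using assms(3)[OF assms(2)] by (simp add: state_def)
qed

lemma state_in_chart:
  assumes x: "jsol_on x I" and c: "c \<in> A"
  defines "J \<equiv> {r \<in> I. x r \<in> cdom c}"
  shows "open J" "\<And>r. r \<in> J \<Longrightarrow> state x c r \<in> phase c \<and> (state x c has_vector_derivative jfield c (state x c r)) (at r)"
    "continuous_on J (state x c)"
proof -
  show o: "open J"
    unfolding J_def using jsol_onD[OF x] chart_open(1)[OF chart[OF c]] by (intro open_preimage_curve) auto
  show s: "\<And>r. r \<in> J \<Longrightarrow> state x c r \<in> phase c \<and> (state x c has_vector_derivative jfield c (state x c r)) (at r)"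
    using jsol_state jsol_onD(4)[OF x] c unfolding J_def by blast
  show "continuous_on J (state x c)"
    by (intro continuous_at_imp_continuous_on ballI) (meson s has_vector_derivative_continuous)
qed

lemma state_eq_imp_eq:
  assumes "c \<in> A" "x s \<in> cdom c" "y r \<in> cdom c" "state x c s = state y c r"
  shows "x s = y r"
  using assms cinv_cmap[OF chart[OF assms(1)]] unfolding state_def by (metis prod.inject)

lemma jsol_locally_unique:
  assumes x: "jsol_on x I" and y: "jsol_on y I" and s: "s \<in> I"
    and c: "c \<in> A" "x s \<in> cdom c" "y s \<in> cdom c" and eq: "state x c s = state y c s"
  shows "\<exists>e>0. \<forall>r. \<bar>r - s\<bar> < e \<longrightarrow> r \<in> I \<and> x r = y r"
proof -
  let ?J = "{r \<in> I. x r \<in> cdom c} \<inter> {r \<in> I. y r \<in> cdom c}"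
  have J: "open ?J" "s \<in> ?J"
    using state_in_chart(1)[OF x c(1)] state_in_chart(1)[OF y c(1)] s c by auto
  have "\<exists>e>0. \<forall>r. \<bar>r - s\<bar> < e \<longrightarrow> r \<in> ?J \<and> state x c r = state y c r"
    by (rule ode_locally_unique[where y="state x c" and z="state y c", OF jfield_C1[OF c(1)] open_phase[OF c(1)] J _ _ eq])
       (use state_in_chart(2)[OF x c(1)] state_in_chart(2)[OF y c(1)] in simp_all)
  then obtain e where e: "e > 0" "\<forall>r. \<bar>r - s\<bar> < e \<longrightarrow> r \<in> ?J \<and> state x c r = state y c r" by blast
  have "r \<in> I \<and> x r = y r" if "\<bar>r - s\<bar> < e" for r
    using e(2) that state_eq_imp_eq[OF c(1), of x r y r] by blast
  then show ?thesis using e(1) by blast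
qed

text \<open>The set where two solutions agree together with their velocities is open by local uniqueness.
  It is closed because positions and velocities depend continuously on the parameter.\<close>

lemma jsol_unique:
  assumes x: "jsol_on x I" and y: "jsol_on y I" and s0: "s0 \<in> I"
    and c0: "c0 \<in> A" "x s0 \<in> cdom c0" "y s0 \<in> cdom c0" and eq: "state x c0 s0 = state y c0 s0" and s: "s \<in> I"
  shows "x s = y s"
proof -
  note I = jsol_onD(1,2,3)[OF x] jsol_onD(3)[OF y]
  define Q where "Q s \<longleftrightarrow> (\<exists>e>0. \<forall>r. \<bar>r - s\<bar> < e \<longrightarrow> r \<in> I \<and> x r = y r)" for s
  have Qopen: "open {s \<in> I. Q s}"
  proof (subst open_dist, intro ballI)
    fix s assume "s \<in> {s \<in> I. Q s}"
    then obtain e where e: "e > 0" "\<And>r. \<bar>r - s\<bar> < e \<Longrightarrow> r \<in> I \<and> x r = y r"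
      unfolding Q_def by blast
    have "t \<in> {s \<in> I. Q s}" if t: "dist t s < e / 2" for t
    proof -
      have "r \<in> I \<and> x r = y r" if "\<bar>r - t\<bar> < e / 2" for r
        using t that by (intro e(2)) (unfold dist_real_def, arith)
      then have "Q t" unfolding Q_def using e(1) by (intro exI[of _ "e / 2"]) auto
      moreover have "t \<in> I" using e(1) e(2)[of t] t by (auto simp: dist_real_def)
      ultimately show ?thesis by blast
    qed
    then show "\<exists>e>0. \<forall>t. dist t s < e \<longrightarrow> t \<in> {s \<in> I. Q s}"
      using e(1) by (intro exI[of _ "e / 2"]) auto
  qed
  have Qeq: "x r = y r \<and> (\<forall>c. state x c r = state y c r)" if Qr: "Q r" for r
  proof -
    obtain e where e: "e > 0" "\<And>t. \<bar>t - r\<bar> < e \<Longrightarrow> t \<in> I \<and> x t = y t"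
      using Qr unfolding Q_def by blast
    have "state x c r = state y c r" for c
      by (rule state_cong[of "ball r e"]) (use e in \<open>auto simp: dist_real_def abs_minus_commute\<close>)
    then show ?thesis using e by simp
  qed
  have nQ: "\<exists>T. open T \<and> s \<in> T \<and> T \<subseteq> {s \<in> I. \<not> Q s}" if s: "s \<in> I" "\<not> Q s" for s
  proof (cases "x s = y s")
    case False
    then obtain S1 S2 where S: "open S1" "open S2" "x s \<in> S1" "y s \<in> S2" "S1 \<inter> S2 = {}"
      by (meson hausdorff)
    let ?T = "{r \<in> I. x r \<in> S1} \<inter> {r \<in> I. y r \<in> S2}"
    have "open ?T" using open_preimage_curve I S by (intro open_Int) auto
    moreover have "?T \<subseteq> {s \<in> I. \<not> Q s}"
      using Qeq S(5) by fastforce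
    ultimately show ?thesis using S s(1) by (intro exI[of _ ?T]) simp
  next
    case True
    obtain c where c: "c \<in> A" "x s \<in> cdom c" using ex_chart by blast
    let ?J = "{r \<in> I. x r \<in> cdom c} \<inter> {r \<in> I. y r \<in> cdom c}"
    have J: "open ?J" "s \<in> ?J"
      using state_in_chart(1)[OF x c(1)] state_in_chart(1)[OF y c(1)] s c True by auto
    have "continuous_on ?J (state x c)" "continuous_on ?J (state y c)"
      by (rule continuous_on_subset[OF state_in_chart(3)[OF x c(1)]], blast)
         (rule continuous_on_subset[OF state_in_chart(3)[OF y c(1)]], blast)
    then have "continuous_on ?J (\<lambda>r. state x c r - state y c r)"
      by (rule continuous_on_diff)
    then have "open (?J \<inter> (\<lambda>r. state x c r - state y c r) -` (- {0}))"
      using J(1) by (intro continuous_open_preimage) auto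
    moreover have "state x c s \<noteq> state y c s"
      using jsol_locally_unique[OF x y s(1) c] c(2) True s(2) unfolding Q_def by metis
    moreover have "?J \<inter> (\<lambda>r. state x c r - state y c r) -` (- {0}) \<subseteq> {s \<in> I. \<not> Q s}"
    proof
      fix r assume r: "r \<in> ?J \<inter> (\<lambda>r. state x c r - state y c r) -` (- {0})"
      then have "state x c r \<noteq> state y c r" by simp
      then show "r \<in> {s \<in> I. \<not> Q s}" using Qeq[of r] r by blast
    qed
    ultimately show ?thesis
      using J(2) by (intro exI[of _ "?J \<inter> (\<lambda>r. state x c r - state y c r) -` (- {0})"]) simp
  qed
  have "open {s \<in> I. \<not> Q s}"
    by (subst open_subopen, intro ballI) (simp add: nQ)
  moreover have "connected I" using I(2) by (simp add: is_interval_connected_1)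
  moreover have "Q s0"
    using jsol_locally_unique[OF x y s0 c0 eq] by (simp add: Q_def)
  ultimately have "{s \<in> I. \<not> Q s} \<inter> I = {}"
    using connectedD[of I "{s \<in> I. Q s}" "{s \<in> I. \<not> Q s}"] Qopen s0 by blast
  then show ?thesis using Qeq s by blast
qed

lemma jsol_agree:
  assumes x: "jsol_on x I" and y: "jsol_on y J" and s0: "s0 \<in> I" "s0 \<in> J"
    and c0: "c0 \<in> A" "x s0 \<in> cdom c0" "y s0 \<in> cdom c0" and eq: "state x c0 s0 = state y c0 s0" and s: "s \<in> I" "s \<in> J"
  shows "x s = y s"
proof -
  have K: "open (I \<inter> J)" "is_interval (I \<inter> J)"
    using jsol_onD[OF x] jsol_onD[OF y] by (auto intro: is_interval_Int)
  show ?thesis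
    by (rule jsol_unique[OF jsol_on_subset[OF x _ K] jsol_on_subset[OF y _ K] _ c0 eq]) (use s0 s in auto)
qed

lemma jsol_glue:
  assumes x: "jsol_on x I" and y: "jsol_on y J" and s0: "s0 \<in> I" "s0 \<in> J"
    and eq: "\<And>s. s \<in> I \<Longrightarrow> s \<in> J \<Longrightarrow> x s = y s"
  defines "z \<equiv> \<lambda>s. if s \<in> I then x s else y s"
  shows "jsol_on z (I \<union> J)" "\<And>s. s \<in> I \<Longrightarrow> z s = x s" "\<And>s. s \<in> J \<Longrightarrow> z s = y s"
proof -
  show zx: "\<And>s. s \<in> I \<Longrightarrow> z s = x s" and zy: "\<And>s. s \<in> J \<Longrightarrow> z s = y s" by (auto simp: z_def eq)
  have 1: "jsol_on z I" and 2: "jsol_on z J"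
    by (rule jsol_on_cong[OF x] jsol_on_cong[OF y], simp add: zx zy)+
  have "is_interval (I \<union> J)"
    using jsol_onD(2)[OF x] jsol_onD(2)[OF y] s0
    by (auto simp: is_interval_connected_1 intro: connected_Un)
  then show "jsol_on z (I \<union> J)"
    using 1 2 unfolding jsol_on_def by (auto intro: continuous_on_open_Un)
qed

lemma has_vector_derivative_shift:
  fixes f :: "real \<Rightarrow> 'e"
  shows "((\<lambda>r. f (r + a)) has_vector_derivative d) (at s) \<longleftrightarrow> (f has_vector_derivative d) (at (s + a))"
proof -
  have imp: "((\<lambda>r. h (r + b)) has_vector_derivative d) (at t)"
    if "(h has_vector_derivative d) (at (t + b))" for h :: "real \<Rightarrow> 'e" and t b
  proof -
    have "((\<lambda>r. r + b) has_derivative (\<lambda>r. r)) (at t)" by (auto intro!: derivative_eq_intros)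
    then show ?thesis
      using has_derivative_compose[of "\<lambda>r. r + b" "\<lambda>r. r" t UNIV h "\<lambda>k. k *\<^sub>R d"] that
      by (simp add: has_vector_derivative_def)
  qed
  show ?thesis
    using imp[of f s a] imp[of "\<lambda>r. f (r + a)" "s + a" "- a"] by auto
qed

lemma velocity_shift: "velocity (\<lambda>r. x (r + a)) s c = velocity x (s + a) c" for c :: "('m, 'e) chart"
  unfolding velocity_def vector_derivative_def
  using has_vector_derivative_shift[of "cmap c \<circ> x" a _ s] by (simp add: o_def)

lemma jsol_shift:
  assumes x: "jsol_on x I"
  shows "jsol_on (\<lambda>s. x (s + a)) {s. s + a \<in> I}"
proof -
  let ?J = "{s. s + a \<in> I}" and ?y = "\<lambda>s. x (s + a)"
  have e: "?J = (\<lambda>s. s + a) -` I" by auto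
  have "open ?J" unfolding e using jsol_onD(1)[OF x] by (intro open_vimage continuous_intros)
  moreover have "is_interval ?J"
    unfolding is_interval_1
  proof (intro ballI allI impI)
    fix p q r assume "p \<in> ?J" "q \<in> ?J" "p \<le> r \<and> r \<le> q"
    then show "r \<in> ?J"
      using mem_is_interval_1_I[OF jsol_onD(2)[OF x], of "p + a" "q + a" "r + a"] by simp
  qed
  moreover have "continuous_on ?J ?y"
    by (rule continuous_on_compose2[OF jsol_onD(3)[OF x]]) (auto intro!: continuous_intros)
  moreover have "jsol_at ?y s" if "s \<in> ?J" for s
  proof -
    have xs: "jsol_at x (s + a)" using jsol_onD(4)[OF x] that by simp
    have d: "(f has_vector_derivative vector_derivative f (at (s + a))) (at (s + a)) \<Longrightarrow>
        (\<lambda>r. f (r + a)) differentiable (at s) \<and> vector_derivative (\<lambda>r. f (r + a)) (at s) = vector_derivative f (at (s + a))"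
      for f :: "real \<Rightarrow> 'e"
      using has_vector_derivative_shift[of f a _ s] by (metis differentiableI_vector vector_derivative_at)
    show ?thesis
      unfolding jsol_at_def
    proof (intro conjI ballI impI)
      show "V (x (s + a)) < E" using xs by (simp add: jsol_at_def)
      fix c assume c: "c \<in> A" "x (s + a) \<in> cdom c"
      have xc: "(cmap c \<circ> x) differentiable (at (s + a))" "(\<lambda>r. velocity x r c) differentiable (at (s + a))"
        "jac c (cmap c (x (s + a))) (velocity x (s + a) c) (vector_derivative (\<lambda>r. velocity x r c) (at (s + a))) = 0"
        using xs c unfolding jsol_at_def by auto
      note d1 = d[OF vector_derivative_works[THEN iffD1, OF xc(1)]]
      note d2 = d[OF vector_derivative_works[THEN iffD1, OF xc(2)]]
      show "(cmap c \<circ> ?y) differentiable (at s)" using d1 by (simp add: o_def)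
      show "(\<lambda>r. velocity ?y r c) differentiable (at s)" using d2 by (simp add: velocity_shift)
      show "jac c (cmap c (?y s)) (velocity ?y s c) (vector_derivative (\<lambda>r. velocity ?y r c) (at s)) = 0"
        using d2 xc(3) by (simp add: velocity_shift)
    qed
  qed
  ultimately show ?thesis unfolding jsol_on_def by blast
qed

subsection \<open>Transport of initial data\<close>

text \<open>The change of charts of the tangent bundle.\<close>

definition smap :: "('m, 'e) chart \<Rightarrow> ('m, 'e) chart \<Rightarrow> 'e \<times> 'e \<Rightarrow> 'e \<times> 'e" where
  "smap c d z = (tmap c d (fst z), dtrans c d (fst z) (snd z))"

text \<open>Along the solution x, initial data at a in the chart c are carried to data at b in the chart d by
  a map F of class C^1, and each such transport is realized by a solution.\<close>

definition flowbox :: "(real \<Rightarrow> 'm) \<Rightarrow> real \<Rightarrow> ('m, 'e) chart \<Rightarrow> real \<Rightarrow> ('m, 'e) chart \<Rightarrow> bool" where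
  "flowbox x a c b d \<longleftrightarrow> (\<exists>B F. open B \<and> state x c a \<in> B \<and> C1_on F B \<and> F (state x c a) = state x d b \<and>
     (\<forall>z\<in>B. \<exists>y J. jsol_on y J \<and> {a..b} \<subseteq> J \<and> y a \<in> cdom c \<and> state y c a = z \<and> y b \<in> cdom d \<and> state y d b = F z))"

lemma flowbox_trans:
  assumes 1: "flowbox x a c b d" and 2: "flowbox x b d r e" and d: "d \<in> A" and le: "a \<le> b" "b \<le> r"
  shows "flowbox x a c r e"
proof -
  obtain B1 F1 where B1: "open B1" "state x c a \<in> B1" "C1_on F1 B1" "F1 (state x c a) = state x d b"
    "\<And>z. z \<in> B1 \<Longrightarrow> \<exists>y J. jsol_on y J \<and> {a..b} \<subseteq> J \<and> y a \<in> cdom c \<and> state y c a = z \<and> y b \<in> cdom d \<and> state y d b = F1 z"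
    using 1 unfolding flowbox_def by blast
  obtain B2 F2 where B2: "open B2" "state x d b \<in> B2" "C1_on F2 B2" "F2 (state x d b) = state x e r"
    "\<And>z. z \<in> B2 \<Longrightarrow> \<exists>y J. jsol_on y J \<and> {b..r} \<subseteq> J \<and> y b \<in> cdom d \<and> state y d b = z \<and> y r \<in> cdom e \<and> state y e r = F2 z"
    using 2 unfolding flowbox_def by blast
  let ?B = "B1 \<inter> F1 -` B2" and ?F = "\<lambda>z. F2 (F1 z)"
  have "open ?B"
    by (rule continuous_open_preimage[OF C1_on_continuous_on[OF B1(3)] B1(1) B2(1)])
  moreover have "state x c a \<in> ?B" using B1 B2 by simp
  moreover have "C1_on ?F ?B"
    by (rule C1_on_compose[OF B2(3) C1_on_subset[OF B1(3)]]) auto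
  moreover have "?F (state x c a) = state x e r" using B1(4) B2(4) by simp
  moreover have "\<exists>y J. jsol_on y J \<and> {a..r} \<subseteq> J \<and> y a \<in> cdom c \<and> state y c a = z \<and> y r \<in> cdom e \<and> state y e r = ?F z"
    if z: "z \<in> ?B" for z
  proof -
    obtain y1 J1 where y1: "jsol_on y1 J1" "{a..b} \<subseteq> J1" "y1 a \<in> cdom c" "state y1 c a = z" "y1 b \<in> cdom d" "state y1 d b = F1 z"
      using B1(5)[of z] z by blast
    obtain y2 J2 where y2: "jsol_on y2 J2" "{b..r} \<subseteq> J2" "y2 b \<in> cdom d" "state y2 d b = F1 z" "y2 r \<in> cdom e" "state y2 e r = ?F z"
      using B2(5)[of "F1 z"] z by blast
    have b: "b \<in> J1" "b \<in> J2" "a \<in> J1" "r \<in> J2" using y1(2) y2(2) le by auto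
    have eq: "y1 s = y2 s" if "s \<in> J1" "s \<in> J2" for s
      by (rule jsol_agree[OF y1(1) y2(1) b(1,2) d y1(5) y2(3) _ that]) (simp add: y1(6) y2(4))
    define y where "y = (\<lambda>s. if s \<in> J1 then y1 s else y2 s)"
    have G1: "jsol_on y (J1 \<union> J2)"
      unfolding y_def by (rule jsol_glue(1)[OF y1(1) y2(1) b(1,2) eq])
    have G2: "y s = y1 s" if "s \<in> J1" for s using that by (simp add: y_def)
    have G3: "y s = y2 s" if "s \<in> J2" for s using that eq by (simp add: y_def)
    have "state y c a = state y1 c a"
      by (rule state_cong[OF jsol_onD(1)[OF y1(1)] b(3)]) (rule G2)
    moreover have "state y e r = state y2 e r"
      by (rule state_cong[OF jsol_onD(1)[OF y2(1)] b(4)]) (rule G3)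
    moreover have "{a..r} \<subseteq> J1 \<union> J2" using y1(2) y2(2) by (auto simp: subset_iff) (meson linear)
    moreover have "jsol_on y (J1 \<union> J2)" by (rule G1)
    moreover have "y a = y1 a" "y r = y2 r" using G2 G3 b by blast+
    ultimately show ?thesis using y1 y2 by metis
  qed
  ultimately show ?thesis unfolding flowbox_def by blast
qed

text \<open>The local flow, seen as a family of curves on the manifold. As the equation is autonomous, the curves may start
  at any parameter value a.\<close>

lemma local_flow:
  assumes c: "c \<in> A" and z0: "z0 \<in> phase c"
  obtains T r \<phi> where "T > 0" "r > 0" "ball z0 r \<subseteq> phase c" "C1_on (\<lambda>(t, z). \<phi> t z) ({-T<..<T} \<times> ball z0 r)"
    "\<And>z t. z \<in> ball z0 r \<Longrightarrow> t \<in> {-T<..<T} \<Longrightarrow> \<phi> t z \<in> phase c \<and> ((\<lambda>t. \<phi> t z) has_vector_derivative jfield c (\<phi> t z)) (at t)"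
    "\<And>z. z \<in> ball z0 r \<Longrightarrow> \<phi> 0 z = z"
    "\<And>z a. z \<in> ball z0 r \<Longrightarrow> jsol_on (\<lambda>s. cinv c (fst (\<phi> (s - a) z))) {a - T<..<a + T}"
    "\<And>z a s. z \<in> ball z0 r \<Longrightarrow> s \<in> {a - T<..<a + T} \<Longrightarrow>
        cinv c (fst (\<phi> (s - a) z)) \<in> cdom c \<and> state (\<lambda>s. cinv c (fst (\<phi> (s - a) z))) c s = \<phi> (s - a) z"
proof -
  obtain T r \<phi> where f: "T > 0" "r > 0" "ball z0 r \<subseteq> phase c"
    "\<And>z. z \<in> ball z0 r \<Longrightarrow> \<phi> 0 z = z"
    "\<And>z t. z \<in> ball z0 r \<Longrightarrow> t \<in> {-T<..<T} \<Longrightarrow> \<phi> t z \<in> phase c"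
    "\<And>z t. z \<in> ball z0 r \<Longrightarrow> t \<in> {-T<..<T} \<Longrightarrow> ((\<lambda>t. \<phi> t z) has_vector_derivative jfield c (\<phi> t z)) (at t)"
    "C1_on (\<lambda>(t, z). \<phi> t z) ({-T<..<T} \<times> ball z0 r)"
    by (rule ode_local_flow[OF jfield_C1[OF c] open_phase[OF c] z0]) (rule that)
  have sh: "\<phi> (s - a) z \<in> phase c \<and> ((\<lambda>s. \<phi> (s - a) z) has_vector_derivative jfield c (\<phi> (s - a) z)) (at s)"
    if z: "z \<in> ball z0 r" and s: "s \<in> {a - T<..<a + T}" for z a s
  proof -
    have sa: "s - a \<in> {-T<..<T}" using s by auto
    have "((\<lambda>s. \<phi> (s - a) z) has_derivative (\<lambda>h. h *\<^sub>R jfield c (\<phi> (s - a) z))) (at s)"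
      by (rule has_derivative_compose[of "\<lambda>s. s - a" "\<lambda>h. h" s UNIV "\<lambda>t. \<phi> t z",
            OF _ f(6)[OF z sa, unfolded has_vector_derivative_def]])
         (auto intro!: derivative_eq_intros)
    then show ?thesis using f(5)[OF z sa] by (simp add: has_vector_derivative_def)
  qed
  have J: "open {a - T<..<a + T}" "is_interval {a - T<..<a + T}" for a :: real by auto
  show ?thesis
  proof (rule that[OF f(1-3,7) _ f(4)])
    show "\<phi> t z \<in> phase c \<and> ((\<lambda>t. \<phi> t z) has_vector_derivative jfield c (\<phi> t z)) (at t)"
      if "z \<in> ball z0 r" "t \<in> {-T<..<T}" for z t using f(5,6)[OF that] by blast
    show "jsol_on (\<lambda>s. cinv c (fst (\<phi> (s - a) z))) {a - T<..<a + T}" if "z \<in> ball z0 r" for z a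
      by (rule ode_jsol(1)[OF c J sh[OF that]])
    show "cinv c (fst (\<phi> (s - a) z)) \<in> cdom c \<and> state (\<lambda>s. cinv c (fst (\<phi> (s - a) z))) c s = \<phi> (s - a) z"
      if "z \<in> ball z0 r" "s \<in> {a - T<..<a + T}" for z a s
      by (rule ode_jsol(2)[OF c J sh[OF that(1)] that(2)])
  qed
qed

lemma state_transform:
  assumes x: "jsol_on x I" "s \<in> I" and c: "c \<in> A" "x s \<in> cdom c" and d: "d \<in> A" "x s \<in> cdom d"
  shows "state x d s = smap c d (state x c s)"
proof -
  let ?J = "{r \<in> I. x r \<in> cdom c} \<inter> {r \<in> I. x r \<in> cdom d}"
  have J: "open ?J" "s \<in> ?J"
    using state_in_chart(1)[OF x(1) c(1)] state_in_chart(1)[OF x(1) d(1)] x(2) c d by auto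
  have v: "velocity x s d = dtrans c d (cmap c (x s)) (velocity x s c)"
    by (rule curve_transform(2)[OF c(1) d(1) J])
       (use jsol_onD(4)[OF x(1)] c(1) in \<open>auto simp: jsol_at_def\<close>)
  then show ?thesis
    using cinv_cmap[OF chart[OF c(1)] c(2)] by (simp add: state_def smap_def tmap_def)
qed

lemma smap_C1:
  assumes "c \<in> A" "d \<in> A"
  shows "C1_on (smap c d) (overlap c d \<times> UNIV)"
proof -
  have o: "open (overlap c d \<times> (UNIV :: 'e set))" by (intro open_Times open_overlap_A assms open_UNIV)
  show ?thesis
    unfolding smap_def dtrans_def
    by (intro C1_on_Pair C1_on_frechet_derivative[OF tmap_C2[OF assms] open_overlap_A[OF assms]]
          C1_on_compose[OF C2_imp_C1[OF tmap_C2[OF assms]]] C1_intros o) auto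
qed

text \<open>A change of charts is a transport over the trivial interval. This reduces transport between
  arbitrary charts to transport inside one chart.\<close>

lemma flowbox_change:
  assumes x: "jsol_on x I" "s \<in> I" and c: "c \<in> A" "x s \<in> cdom c" and d: "d \<in> A" "x s \<in> cdom d"
  shows "flowbox x s c s d"
proof -
  let ?B = "phase c \<inter> (overlap c d \<times> UNIV)"
  have "cmap c (x s) \<in> overlap c d" using c(2) d(2) unfolding overlap_def by blast
  then have xB: "state x c s \<in> ?B"
    using jsol_state(1)[OF jsol_onD(4)[OF x] c] by (simp add: state_def)
  have o: "open ?B" by (intro open_Int open_phase c(1) open_Times open_overlap_A d(1) open_UNIV)
  have "\<exists>y J. jsol_on y J \<and> {s..s} \<subseteq> J \<and> y s \<in> cdom c \<and> state y c s = z \<and> y s \<in> cdom d \<and> state y d s = smap c d z"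
    if z: "z \<in> ?B" for z
  proof -
    have zp: "z \<in> phase c" using z by simp
    obtain T r \<phi> where f: "T > 0" "r > 0" "\<And>z'. z' \<in> ball z r \<Longrightarrow> \<phi> 0 z' = z'"
      "\<And>z' a. z' \<in> ball z r \<Longrightarrow> jsol_on (\<lambda>s. cinv c (fst (\<phi> (s - a) z'))) {a - T<..<a + T}"
      "\<And>z' a s. z' \<in> ball z r \<Longrightarrow> s \<in> {a - T<..<a + T} \<Longrightarrow>
        cinv c (fst (\<phi> (s - a) z')) \<in> cdom c \<and> state (\<lambda>s. cinv c (fst (\<phi> (s - a) z'))) c s = \<phi> (s - a) z'"
      by (rule local_flow[OF c(1) zp]) (rule that)
    have zb: "z \<in> ball z r" using f(2) by simp
    define y where "y = (\<lambda>t. cinv c (fst (\<phi> (t - s) z)))"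
    have y: "jsol_on y {s - T<..<s + T}" unfolding y_def by (rule f(4)[OF zb])
    have st: "s \<in> {s - T<..<s + T}" using f(1) by simp
    have yc: "y s \<in> cdom c" "state y c s = z"
      using f(5)[OF zb st] f(3)[OF zb] unfolding y_def by simp_all
    have "cinv c (fst z) \<in> cdom d" using z overlap_A[OF c(1), of "fst z" d] by (auto simp: mem_Times_iff)
    then have yd: "y s \<in> cdom d" using f(3)[OF zb] by (simp add: y_def)
    have "state y d s = smap c d z"
      using state_transform[OF y st c(1) yc(1) d(1) yd] yc(2) by simp
    then show ?thesis using y st yc yd by (intro exI[of _ y] exI[of _ "{s - T<..<s + T}"]) simp
  qed
  then show ?thesis
    unfolding flowbox_def
    using o xB C1_on_subset[OF smap_C1[OF c(1) d(1)], of ?B] state_transform[OF x c d]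
    by (intro exI[of _ ?B] exI[of _ "smap c d"]) auto
qed

end

context jacobi_setup
begin

lemma flowbox_local:
  assumes x: "jsol_on x I" and s: "s \<in> I"
  shows "\<exists>e>0. \<forall>a b. a \<le> s \<and> s \<le> b \<and> b - a < e \<longrightarrow>
    (\<forall>c\<in>A. \<forall>d\<in>A. x a \<in> cdom c \<longrightarrow> x b \<in> cdom d \<longrightarrow> flowbox x a c b d)"
proof -
  obtain c where c: "c \<in> A" "x s \<in> cdom c" using ex_chart by blast
  have z0: "state x c s \<in> phase c" by (rule jsol_state(1)[OF jsol_onD(4)[OF x s] c])
  obtain T r \<phi> where f: "T > 0" "r > 0" "ball (state x c s) r \<subseteq> phase c"
    "C1_on (\<lambda>(t, z). \<phi> t z) ({-T<..<T} \<times> ball (state x c s) r)"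
    "\<And>z. z \<in> ball (state x c s) r \<Longrightarrow> \<phi> 0 z = z"
    "\<And>z a. z \<in> ball (state x c s) r \<Longrightarrow> jsol_on (\<lambda>s. cinv c (fst (\<phi> (s - a) z))) {a - T<..<a + T}"
    "\<And>z a q. z \<in> ball (state x c s) r \<Longrightarrow> q \<in> {a - T<..<a + T} \<Longrightarrow>
        cinv c (fst (\<phi> (q - a) z)) \<in> cdom c \<and> state (\<lambda>s. cinv c (fst (\<phi> (s - a) z))) c q = \<phi> (q - a) z"
    by (rule local_flow[OF c(1) z0]) (rule that)
  let ?Z = "ball (state x c s) r" and ?J = "{r \<in> I. x r \<in> cdom c}"
  have "open (?J \<inter> state x c -` ?Z)"
    using state_in_chart(3,1)[OF x c(1)] by (rule continuous_open_preimage) simp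
  moreover have "s \<in> ?J \<inter> state x c -` ?Z" using s c f(2) by simp
  ultimately obtain e where e: "e > 0" "ball s e \<subseteq> ?J \<inter> state x c -` ?Z" using openE by blast
  have "flowbox x a c1 b c2" if ab: "a \<le> s" "s \<le> b" "b - a < min e T" and
    ch: "c1 \<in> A" "c2 \<in> A" "x a \<in> cdom c1" "x b \<in> cdom c2" for a b c1 c2
  proof -
    have "a \<in> ball s e" "b \<in> ball s e" using ab by (auto simp: dist_real_def)
    then have in': "a \<in> I" "b \<in> I" "x a \<in> cdom c" "x b \<in> cdom c" "state x c a \<in> ?Z" using e(2) by auto
    have T: "a \<in> {a - T<..<a + T}" "b \<in> {a - T<..<a + T}" "b - a \<in> {-T<..<T}" "{a..b} \<subseteq> {a - T<..<a + T}"
      using ab f(1) by auto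
    have "flowbox x a c b c"
      unfolding flowbox_def
    proof (intro exI[of _ ?Z] exI[of _ "\<phi> (b - a)"] conjI ballI)
      show "open ?Z" "state x c a \<in> ?Z" using in' by auto
      have "C1_on (\<lambda>z. (\<lambda>(t, z). \<phi> t z) (b - a, z)) ?Z"
        by (rule C1_on_compose[OF f(4)]) (use T in \<open>auto intro!: C1_intros\<close>)
      then show "C1_on (\<phi> (b - a)) ?Z" by simp
      define y where "y z = (\<lambda>q. cinv c (fst (\<phi> (q - a) z)))" for z
      have y: "jsol_on (y z) {a - T<..<a + T}" "y z a \<in> cdom c" "state (y z) c a = z" "y z b \<in> cdom c"
        "state (y z) c b = \<phi> (b - a) z" if "z \<in> ?Z" for z
        using f(5)[OF that] f(6)[OF that, of a] f(7)[OF that T(1)] f(7)[OF that T(2)] unfolding y_def by simp_all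
      have yx: "y (state x c a) q = x q" if "q \<in> I" "q \<in> {a - T<..<a + T}" for q
        by (rule jsol_agree[OF y(1)[OF in'(5)] x T(1) in'(1) c(1) y(2)[OF in'(5)] in'(3) y(3)[OF in'(5)] that(2,1)])
      have "state (y (state x c a)) c b = state x c b"
        by (rule state_cong[of "I \<inter> {a - T<..<a + T}"]) (use jsol_onD(1)[OF x] in' T yx in auto)
      then show "\<phi> (b - a) (state x c a) = state x c b" using y(5)[OF in'(5)] by simp
      show "\<exists>y J. jsol_on y J \<and> {a..b} \<subseteq> J \<and> y a \<in> cdom c \<and> state y c a = z \<and> y b \<in> cdom c \<and> state y c b = \<phi> (b - a) z"
        if "z \<in> ?Z" for z
        using y[OF that] T(4) by blast
    qed
    from flowbox_trans[OF flowbox_change[OF x in'(1) ch(1,3) c(1) in'(3)] this c(1) order_refl]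
    have "flowbox x a c1 b c" using ab by simp
    from flowbox_trans[OF this flowbox_change[OF x in'(2) c(1) in'(4) ch(2,4)] c(1) _ order_refl]
    show ?thesis using ab by simp
  qed
  then show ?thesis using e(1) f(1) by (intro exI[of _ "min e T"]) auto
qed

text \<open>Transports over short intervals are composed; the compactness of the interval is used through
  bisection.\<close>

lemma flowbox_along:
  assumes x: "jsol_on x I" and ab: "a \<le> b" "{a..b} \<subseteq> I"
    and ch: "c \<in> A" "d \<in> A" "x a \<in> cdom c" "x b \<in> cdom d"
  shows "flowbox x a c b d"
proof -
  have "\<forall>c\<in>A. \<forall>d\<in>A. x a \<in> cdom c \<longrightarrow> x b \<in> cdom d \<longrightarrow> flowbox x a c b d"
    using ab(1)
  proof (induct rule: Bolzano)
    case (trans a b r)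
    obtain e where "e \<in> A" "x b \<in> cdom e" using ex_chart by blast
    then show ?case using trans flowbox_trans by blast
  next
    case (local s)
    then have "s \<in> I" using ab(2) by auto
    then show ?case using flowbox_local[OF x] by simp
  qed
  then show ?thesis using ch by blast
qed

section \<open>The conserved quantity\<close>

definition jconst :: "(real \<Rightarrow> 'm) \<Rightarrow> ('m, 'e) chart \<Rightarrow> real \<Rightarrow> real" where
  "jconst x c s = (E - Vc c (cmap c (x s))) / 2 * g c (cmap c (x s)) (velocity x s c) (velocity x s c)"

lemma has_jacobi_constant_iff: "has_jacobi_constant A g V E \<gamma> l \<longleftrightarrow>
   (\<forall>s\<in>dom \<gamma>. \<forall>c\<in>A. (the \<circ> \<gamma>) s \<in> cdom c \<longrightarrow> jconst (the \<circ> \<gamma>) c s = l)"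
  by (simp add: has_jacobi_constant_def jacobi_metric_def jconst_def)

lemma jconst_cong:
  assumes "open J" "s \<in> J" "\<And>r. r \<in> J \<Longrightarrow> x r = y r"
  shows "jconst x c s = jconst y c s"
proof -
  have "velocity x s c = velocity y s c" by (rule velocity_cong[OF assms])
  then show ?thesis using assms(3)[OF assms(2)] by (simp add: jconst_def)
qed

lemma jconst_chart_independent:
  assumes x: "jsol_on x I" "s \<in> I" and c: "c \<in> A" "x s \<in> cdom c" and d: "d \<in> A" "x s \<in> cdom d"
  shows "jconst x c s = jconst x d s"
proof -
  have ov: "cmap c (x s) \<in> overlap c d" using c(2) d(2) unfolding overlap_def by blast
  have "cmap d (x s) = tmap c d (cmap c (x s))" "velocity x s d = dtrans c d (cmap c (x s)) (velocity x s c)"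
    using state_transform[OF x c d] by (auto simp: state_def smap_def)
  then show ?thesis
    unfolding jconst_def metric_transform'[OF c(1) d(1) ov]
    using cinv_cmap[OF chart[OF c(1)] c(2)] cinv_cmap[OF chart[OF d(1)] d(2)] by simp
qed

text \<open>Pairing the equation with the velocity shows that the derivative of the kinetic factor
  compensates that of the conformal factor.\<close>

lemma jconst_has_derivative_0:
  assumes x: "jsol_at x s" and c: "c \<in> A" "x s \<in> cdom c"
  shows "(jconst x c has_derivative (\<lambda>h. 0)) (at s)"
proof -
  define y v a where "y = cmap c (x s)" and "v = velocity x s c" and "a = snd (jfield c (state x c s))"
  note S = jsol_state[OF x c]
  have st: "state x c s = (y, v)" by (simp add: state_def y_def v_def)
  have yc: "y \<in> cimg c" and Vy: "Vc c y < E" using S(1) by (auto simp: st phase_iff)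
  have "((\<lambda>r. fst (state x c r)) has_derivative (\<lambda>h. fst (h *\<^sub>R jfield c (state x c s)))) (at s)"
    "((\<lambda>r. snd (state x c r)) has_derivative (\<lambda>h. snd (h *\<^sub>R jfield c (state x c s)))) (at s)"
    by (rule has_derivative_fst has_derivative_snd, rule S(2)[unfolded has_vector_derivative_def])+
  then have Dy: "((\<lambda>r. cmap c (x r)) has_derivative (\<lambda>h. h *\<^sub>R v)) (at s)"
    and Dv: "((\<lambda>r. velocity x r c) has_derivative (\<lambda>h. h *\<^sub>R a)) (at s)"
    by (simp_all add: state_def a_def jfield_def v_def)
  have DV0: "(Vc c has_derivative dV c y) (at y)"
    using Vc_differentiable[OF c(1) yc] by (simp add: frechet_derivative_works)
  have DV: "((\<lambda>r. Vc c (cmap c (x r))) has_derivative (\<lambda>h. dV c y (h *\<^sub>R v))) (at s)"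
    by (rule has_derivative_compose[OF Dy DV0[unfolded y_def], folded y_def])
  have Dg: "((\<lambda>r. g c (cmap c (x r)) (velocity x r c) (velocity x r c)) has_derivative
     (\<lambda>h. dg c y (h *\<^sub>R v) v v + g c y (h *\<^sub>R a) v + g c y v (h *\<^sub>R a))) (at s)"
    using metric_has_derivative[OF c(1) _ Dy Dv Dv] yc by (simp add: y_def v_def)
  have D: "(jconst x c has_derivative (\<lambda>h. (E - Vc c y) / 2 * (dg c y (h *\<^sub>R v) v v + g c y (h *\<^sub>R a) v + g c y v (h *\<^sub>R a))
      + (- (dV c y (h *\<^sub>R v)) / 2) * g c y v v)) (at s)"
  proof -
    have "((\<lambda>r. inverse 2 * (E - Vc c (cmap c (x r)))) has_derivative (\<lambda>h. inverse 2 * (0 - dV c y (h *\<^sub>R v)))) (at s)"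
      by (intro has_derivative_mult_right has_derivative_diff has_derivative_const DV)
    then have "((\<lambda>r. (E - Vc c (cmap c (x r))) / 2) has_derivative (\<lambda>h. - (dV c y (h *\<^sub>R v)) / 2)) (at s)"
      by (simp add: field_simps)
    from has_derivative_mult[OF this Dg] show ?thesis
      unfolding jconst_def by (simp add: y_def v_def o_def)
  qed
  have "jac c y v a = 0" using jac_zero_iff[OF Vy] by (simp add: a_def st)
  then have j: "(E - Vc c y) *\<^sub>R (a + \<Gamma> c y v) = g c y (grad c y) v *\<^sub>R v - (g c y v v / 2) *\<^sub>R grad c y"
    unfolding jac_def by (simp only: eq_diff_eq diff_add_eq right_minus_eq)
  note ms = bilinear_ladd[OF metric_bilinear[OF c(1) yc]] bilinear_lsub[OF metric_bilinear[OF c(1) yc]]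
    bilinear_lmul[OF metric_bilinear[OF c(1) yc]] bilinear_rmul[OF metric_bilinear[OF c(1) yc]]
  have "(E - Vc c y) * (g c y a v + dg c y v v v / 2) = g c y ((E - Vc c y) *\<^sub>R (a + \<Gamma> c y v)) v"
    using christoffel_eq[OF c(1) yc, of v v] by (simp add: ms)
  also have "\<dots> = dV c y v * g c y v v / 2"
    unfolding j by (simp add: ms gradient_eq[OF c(1) yc])
  finally have key: "(E - Vc c y) * (g c y a v + dg c y v v v / 2) = dV c y v * g c y v v / 2" .
  have "(E - Vc c y) / 2 * (dg c y (h *\<^sub>R v) v v + g c y (h *\<^sub>R a) v + g c y v (h *\<^sub>R a))
      + (- (dV c y (h *\<^sub>R v)) / 2) * g c y v v = 0" for h
  proof -
    have "dV c y (h *\<^sub>R v) = h * dV c y v"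
      using linear_cmul[OF has_derivative_linear[OF DV0]] by simp
    moreover have "dg c y (h *\<^sub>R v) v v = h * dg c y v v v"
      using linear_cmul[OF dg_linear1[OF c(1) yc]] by simp
    moreover have "g c y v a = g c y a v" by (rule metric_sym[OF c(1) yc])
    ultimately have "(E - Vc c y) / 2 * (dg c y (h *\<^sub>R v) v v + g c y (h *\<^sub>R a) v + g c y v (h *\<^sub>R a))
      + (- (dV c y (h *\<^sub>R v)) / 2) * g c y v v
      = h * ((E - Vc c y) * (g c y a v + dg c y v v v / 2) - dV c y v * g c y v v / 2)"
      by (simp add: ms field_simps)
    then show ?thesis using key by simp
  qed
  then show ?thesis using D by simp
qed

lemma jconst_constant:
  assumes x: "jsol_on x I" and s: "s \<in> I" "c \<in> A" "x s \<in> cdom c" and t: "t \<in> I" "d \<in> A" "x t \<in> cdom d"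
  shows "jconst x c s = jconst x d t"
proof -
  define \<kappa> where "\<kappa> r = (SOME c. c \<in> A \<and> x r \<in> cdom c)" for r
  have \<kappa>: "\<kappa> r \<in> A" "x r \<in> cdom (\<kappa> r)" for r
    using someI_ex[of "\<lambda>c. c \<in> A \<and> x r \<in> cdom c"] ex_chart[of "x r"] unfolding \<kappa>_def by blast+
  have D: "((\<lambda>r. jconst x (\<kappa> r) r) has_derivative (\<lambda>h. 0)) (at r within I)" if r: "r \<in> I" for r
  proof (rule has_derivative_at_withinI, rule has_derivative_transform_within_open)
    show "(jconst x (\<kappa> r) has_derivative (\<lambda>h. 0)) (at r)"
      by (rule jconst_has_derivative_0[OF jsol_onD(4)[OF x r] \<kappa>])
    show "open {q \<in> I. x q \<in> cdom (\<kappa> r)}" by (rule state_in_chart(1)[OF x \<kappa>(1)])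
    show "r \<in> {q \<in> I. x q \<in> cdom (\<kappa> r)}" using r \<kappa> by simp
    show "jconst x (\<kappa> r) q = jconst x (\<kappa> q) q" if "q \<in> {q \<in> I. x q \<in> cdom (\<kappa> r)}" for q
      using that by (intro jconst_chart_independent[OF x _ \<kappa>(1) _ \<kappa>]) auto
  qed
  have "convex I" using jsol_onD(2)[OF x] by (simp add: is_interval_convex)
  from has_derivative_zero_constant[OF this D] obtain k where "\<And>r. r \<in> I \<Longrightarrow> jconst x (\<kappa> r) r = k"
    by blast
  then show ?thesis
    using jconst_chart_independent[OF x s \<kappa>] jconst_chart_independent[OF x t \<kappa>] s(1) t(1) by simp
qed

end

section \<open>Unions of compatible curves and maximal curves\<close>

text \<open>The choice of a member of C is immaterial for the compatible families defined next.\<close>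

definition join :: "(real \<rightharpoonup> 'm) set \<Rightarrow> (real \<rightharpoonup> 'm)" where
  "join C s = (if \<exists>\<gamma>\<in>C. s \<in> dom \<gamma> then (SOME \<gamma>. \<gamma> \<in> C \<and> s \<in> dom \<gamma>) s else None)"

definition compatible :: "(real \<rightharpoonup> 'm) set \<Rightarrow> bool" where
  "compatible C \<longleftrightarrow> (\<forall>\<gamma>\<in>C. \<forall>\<eta>\<in>C. \<forall>s. s \<in> dom \<gamma> \<longrightarrow> s \<in> dom \<eta> \<longrightarrow> \<gamma> s = \<eta> s)"

lemma join_eq:
  assumes "compatible C" "\<gamma> \<in> C" "s \<in> dom \<gamma>"
  shows "join C s = \<gamma> s"
proof -
  have "\<exists>\<gamma>. \<gamma> \<in> C \<and> s \<in> dom \<gamma>" using assms(2,3) by blast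
  from someI_ex[OF this] have "(SOME \<gamma>. \<gamma> \<in> C \<and> s \<in> dom \<gamma>) s = \<gamma> s"
    using assms unfolding compatible_def by blast
  then show ?thesis using assms(2,3) unfolding join_def by auto
qed

lemma dom_join:
  assumes "compatible C"
  shows "dom (join C) = (\<Union>\<gamma>\<in>C. dom \<gamma>)"
proof (intro set_eqI iffI)
  fix s assume "s \<in> dom (join C)"
  then show "s \<in> (\<Union>\<gamma>\<in>C. dom \<gamma>)" by (auto simp: join_def split: if_splits)
next
  fix s assume "s \<in> (\<Union>\<gamma>\<in>C. dom \<gamma>)"
  then obtain \<gamma> where "\<gamma> \<in> C" "s \<in> dom \<gamma>" by blast
  then show "s \<in> dom (join C)" using join_eq[OF assms] by (metis domIff)
qed

text \<open>A maximal curve is contained in the union of all curves with the property Q, hence equal to it.\<close>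

lemma maximal_curve_join:
  assumes C: "compatible {\<gamma>. Q \<gamma>}" and Q: "Q (join {\<gamma>. Q \<gamma>})"
  shows "(THE \<gamma>. maximal_curve Q \<gamma>) = join {\<gamma>. Q \<gamma>}"
    and "\<And>\<gamma>. Q \<gamma> \<Longrightarrow> \<gamma> \<subseteq>\<^sub>m join {\<gamma>. Q \<gamma>}"
proof -
  show le: "\<gamma> \<subseteq>\<^sub>m join {\<gamma>. Q \<gamma>}" if "Q \<gamma>" for \<gamma>
    using join_eq[OF C, of \<gamma>] that by (simp add: map_le_def)
  show "(THE \<gamma>. maximal_curve Q \<gamma>) = join {\<gamma>. Q \<gamma>}"
  proof (rule the_equality)
    show "maximal_curve Q (join {\<gamma>. Q \<gamma>})"
      unfolding maximal_curve_def using Q le map_le_antisym by blast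
    show "\<gamma> = join {\<gamma>. Q \<gamma>}" if "maximal_curve Q \<gamma>" for \<gamma>
      using that Q le unfolding maximal_curve_def by metis
  qed
qed

context jacobi_setup
begin

lemma join_jacobi_geodesic:
  assumes C: "compatible C" and J: "\<And>\<gamma>. \<gamma> \<in> C \<Longrightarrow> jacobi_geodesic A g V E \<gamma>"
    and I: "is_interval (\<Union>\<gamma>\<in>C. dom \<gamma>)"
  shows "jacobi_geodesic A g V E (join C)"
  unfolding jacobi_geodesic_iff jsol_on_def
proof (intro conjI ballI)
  have j: "jsol_on (the \<circ> \<gamma>) (dom \<gamma>)" if "\<gamma> \<in> C" for \<gamma> using J[OF that] by (simp add: jacobi_geodesic_iff)
  have eq: "(the \<circ> \<gamma>) s = (the \<circ> join C) s" if "\<gamma> \<in> C" "s \<in> dom \<gamma>" for \<gamma> s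
    using join_eq[OF C that] by simp
  have jj: "jsol_on (the \<circ> join C) (dom \<gamma>)" if "\<gamma> \<in> C" for \<gamma>
    by (rule jsol_on_cong[OF j[OF that] eq[OF that]])
  show "open (dom (join C))" unfolding dom_join[OF C] using jsol_onD(1)[OF j] by blast
  show "is_interval (dom (join C))" unfolding dom_join[OF C] by (rule I)
  show "continuous_on (dom (join C)) (the \<circ> join C)"
    unfolding dom_join[OF C] using jsol_onD(1,3)[OF jj] by (intro continuous_on_open_UN) auto
  show "jsol_at (the \<circ> join C) s" if "s \<in> dom (join C)" for s
    using that jsol_onD(4)[OF jj] unfolding dom_join[OF C] by blast
qed

text \<open>Two solutions of the same Cauchy problem have equal states at 0.\<close>

lemma jacobi_cauchy_compatible: "compatible {\<gamma>. jacobi_cauchy A g V E p v \<gamma>}"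
  unfolding compatible_def
proof (intro ballI allI impI)
  fix \<gamma> \<eta> s assume gh: "\<gamma> \<in> {\<gamma>. jacobi_cauchy A g V E p v \<gamma>}" "\<eta> \<in> {\<gamma>. jacobi_cauchy A g V E p v \<gamma>}"
    and s: "s \<in> dom \<gamma>" "s \<in> dom \<eta>"
  obtain c where c: "c \<in> A" "p \<in> cdom c" using ex_chart by blast
  have g: "jsol_on (the \<circ> \<gamma>) (dom \<gamma>)" "\<gamma> 0 = Some p" "velocity (the \<circ> \<gamma>) 0 c = v c"
    and h: "jsol_on (the \<circ> \<eta>) (dom \<eta>)" "\<eta> 0 = Some p" "velocity (the \<circ> \<eta>) 0 c = v c"
    using gh c by (auto simp: jacobi_cauchy_def jacobi_geodesic_iff)
  have "(the \<circ> \<gamma>) s = (the \<circ> \<eta>) s"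
    by (rule jsol_agree[OF g(1) h(1) _ _ c(1) _ _ _ s, of 0]) (use g h c in \<open>auto simp: state_def\<close>)
  then show "\<gamma> s = \<eta> s" using s by auto
qed

text \<open>All solutions are defined at 0, so the union of their domains is an interval and the union of
  the solutions solves the same problem.\<close>

lemma jacobi_cauchy_maximal:
  assumes "jacobi_cauchy A g V E p v \<gamma>"
  shows "\<gamma> \<subseteq>\<^sub>m (THE \<gamma>. maximal_curve (jacobi_cauchy A g V E p v) \<gamma>)"
proof -
  let ?C = "{\<gamma>. jacobi_cauchy A g V E p v \<gamma>}"
  note comp = jacobi_cauchy_compatible[of p v]
  have "is_interval (\<Union>\<gamma>\<in>?C. dom \<gamma>)"
    unfolding is_interval_connected_1
  proof (rule connected_Union)
    show "connected S" if "S \<in> dom ` ?C" for S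
      using that by (auto simp: jacobi_cauchy_def jacobi_geodesic_def is_interval_connected_1)
    show "\<Inter> (dom ` ?C) \<noteq> {}"
      by (auto simp: jacobi_cauchy_def intro!: exI[of _ "0::real"])
  qed
  then have J: "jacobi_geodesic A g V E (join ?C)"
    by (intro join_jacobi_geodesic[OF comp]) (auto simp: jacobi_cauchy_def)
  have d: "0 \<in> dom \<gamma>" using assms by (auto simp: jacobi_cauchy_def)
  have jg: "join ?C s = \<gamma> s" if "s \<in> dom \<gamma>" for s
    using join_eq[OF comp] assms that by blast
  have o: "open (dom \<gamma>)" using assms by (auto simp: jacobi_cauchy_def jacobi_geodesic_def)
  have "velocity (the \<circ> join ?C) 0 c = velocity (the \<circ> \<gamma>) 0 c" for c :: "('m, 'e) chart"
    by (rule velocity_cong[OF o d]) (simp add: jg)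
  then have "jacobi_cauchy A g V E p v (join ?C)"
    using J assms jg[OF d] by (simp add: jacobi_cauchy_def)
  from maximal_curve_join[OF comp this] assms show ?thesis by simp
qed

text \<open>Restarting a geodesic at an interior parameter value gives a Cauchy problem that its shift
  solves.\<close>

lemma jacobi_geodesic_restart:
  assumes \<gamma>: "jacobi_geodesic A g V E \<gamma>" and s0: "s0 \<in> dom \<gamma>" and s: "s \<in> dom \<gamma>"
  shows "\<gamma> s = (THE \<eta>. maximal_curve (jacobi_cauchy A g V E ((the \<circ> \<gamma>) s0) (velocity (the \<circ> \<gamma>) s0)) \<eta>) (s - s0)"
proof -
  define \<eta> where "\<eta> s = \<gamma> (s + s0)" for s
  have d: "dom \<eta> = {s. s + s0 \<in> dom \<gamma>}" by (auto simp: \<eta>_def dom_def)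
  have e: "the \<circ> \<eta> = (\<lambda>s. (the \<circ> \<gamma>) (s + s0))" by (auto simp: \<eta>_def)
  have "jsol_on (the \<circ> \<eta>) (dom \<eta>)"
    unfolding d e by (rule jsol_shift[OF \<gamma>[unfolded jacobi_geodesic_iff]])
  moreover have "\<eta> 0 = Some ((the \<circ> \<gamma>) s0)" using s0 by (auto simp: \<eta>_def)
  moreover have "velocity (the \<circ> \<eta>) 0 c = velocity (the \<circ> \<gamma>) s0 c" for c :: "('m, 'e) chart"
    unfolding e velocity_shift by simp
  ultimately have "jacobi_cauchy A g V E ((the \<circ> \<gamma>) s0) (velocity (the \<circ> \<gamma>) s0) \<eta>"
    by (simp add: jacobi_cauchy_def jacobi_geodesic_iff)
  from jacobi_cauchy_maximal[OF this] show ?thesis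
    using s unfolding map_le_def d by (metis (mono_tags, lifting) \<eta>_def diff_add_cancel mem_Collect_eq)
qed

end

section \<open>Geodesics issuing from the boundary\<close>

text \<open>Used to pass from the time of a motion to the parameter of a geodesic. The image of the interval is open by
  invariance of domain.\<close>

lemma continuous_strict_mono_inverse:
  fixes s :: "real \<Rightarrow> real"
  assumes K: "open K" "is_interval K" and D: "\<And>t. t \<in> K \<Longrightarrow> (s has_real_derivative d t) (at t)" "\<And>t. t \<in> K \<Longrightarrow> d t > 0"
  shows "strict_mono_on K s" "open (s ` K)" "is_interval (s ` K)"
    "\<And>t. t \<in> K \<Longrightarrow> (inv_into K s has_real_derivative 1 / d t) (at (s t))"
proof -
  show mono: "strict_mono_on K s"
  proof (rule strict_mono_onI)
    fix a b assume ab: "a \<in> K" "b \<in> K" "a < b"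
    show "s a < s b"
    proof (rule DERIV_pos_imp_increasing[OF ab(3)])
      fix t assume "a \<le> t" "t \<le> b"
      then have "t \<in> K" using ab mem_is_interval_1_I[OF K(2), of a b t] by blast
      then show "\<exists>y. (s has_real_derivative y) (at t) \<and> 0 < y" using D by blast
    qed
  qed
  have inj: "inj_on s K" using mono by (rule strict_mono_on_imp_inj_on)
  have cont: "continuous_on K s"
    by (intro continuous_at_imp_continuous_on ballI DERIV_isCont[OF D(1)])
  show "open (s ` K)" by (rule invariance_of_domain[OF cont K(1) inj])
  show "is_interval (s ` K)"
    using connected_continuous_image[OF cont] K(2) by (simp add: is_interval_connected_1)
  fix t assume t: "t \<in> K"
  have "(inv_into K s has_derivative (\<lambda>h. h * (1 / d t))) (at (s t))"
  proof (rule has_derivative_inverse_strong[OF K(1) t cont])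
    show "inv_into K s (s x) = x" if "x \<in> K" for x using inj that by simp
    show "(s has_derivative (\<lambda>h. h * d t)) (at t)"
      using D(1)[OF t] by (simp add: has_field_derivative_def mult_commute_abs)
    show "(\<lambda>h. h * d t) \<circ> (\<lambda>h. h * (1 / d t)) = id"
      using D(2)[OF t] by (auto simp: fun_eq_iff)
  qed
  then show "(inv_into K s has_real_derivative 1 / d t) (at (s t))"
    by (simp only: has_field_derivative_def mult_commute_abs)
qed

context jacobi_setup
begin

text \<open>Newton's equation in a chart, extended by the action as a third component.\<close>

definition nfield :: "('m, 'e) chart \<Rightarrow> 'e \<times> 'e \<times> real \<Rightarrow> 'e \<times> 'e \<times> real" where
  "nfield c w = (fst (snd w), - \<Gamma> c (fst w) (fst (snd w)) - grad c (fst w), E - Vc c (fst w))"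

definition nsol :: "('m, 'e) chart \<Rightarrow> (real \<Rightarrow> 'e \<times> 'e \<times> real) \<Rightarrow> real set \<Rightarrow> bool" where
  "nsol c w K \<longleftrightarrow> (\<forall>t\<in>K. fst (w t) \<in> cimg c \<and> (w has_vector_derivative nfield c (w t)) (at t))"

lemma nfield_C1:
  assumes c: "c \<in> A"
  shows "C1_on (nfield c) (cimg c \<times> UNIV)"
proof -
  have o: "open (cimg c \<times> (UNIV :: ('e \<times> real) set))" by (intro open_Times chart_open(2) chart c open_UNIV)
  have im: "fst ` (cimg c \<times> (UNIV :: ('e \<times> real) set)) \<subseteq> cimg c" by auto
  have f: "C1_on fst (cimg c \<times> (UNIV :: ('e \<times> real) set))" by (rule C1_on_bounded_linear[OF bounded_linear_fst])
  have "C1_on (\<lambda>w. grad c (fst w)) (cimg c \<times> (UNIV :: ('e \<times> real) set))"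
    "C1_on (\<lambda>w. Vc c (fst w)) (cimg c \<times> (UNIV :: ('e \<times> real) set))"
    by (rule C1_on_compose[OF gradient_C1_on[OF c] f im] C1_on_compose[OF Vc_C1[OF c] f im])+
  then show ?thesis
    unfolding nfield_def using im
    by (intro C1_intros christoffel_C1_on[OF c] o) auto
qed

lemma christoffel_scale:
  assumes "c \<in> A" "y \<in> cimg c"
  shows "\<Gamma> c y (b *\<^sub>R v) = b\<^sup>2 *\<^sub>R \<Gamma> c y v"
proof (rule metric_nondegenerate[OF assms])
  fix u
  have "g c y (\<Gamma> c y (b *\<^sub>R v)) u = b\<^sup>2 * (dg c y v v u - dg c y u v v / 2)"
    unfolding christoffel_eq[OF assms]
    using linear_cmul[OF dg_linear1[OF assms]] linear_cmul[OF dg_linear2[OF assms]] linear_cmul[OF dg_linear3[OF assms]]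
    by (simp add: power2_eq_square algebra_simps)
  also have "\<dots> = g c y (b\<^sup>2 *\<^sub>R \<Gamma> c y v) u"
    using christoffel_eq[OF assms] by (simp add: bilinear_lmul[OF metric_bilinear[OF assms]])
  finally show "g c y (\<Gamma> c y (b *\<^sub>R v)) u = g c y (b\<^sup>2 *\<^sub>R \<Gamma> c y v) u" .
qed

lemma nsolD:
  assumes "nsol c w K" "t \<in> K"
  shows "fst (w t) \<in> cimg c"
    "((\<lambda>t. fst (w t)) has_vector_derivative fst (snd (w t))) (at t)"
    "((\<lambda>t. fst (snd (w t))) has_vector_derivative - \<Gamma> c (fst (w t)) (fst (snd (w t))) - grad c (fst (w t))) (at t)"
    "((\<lambda>t. snd (snd (w t))) has_real_derivative E - Vc c (fst (w t))) (at t)"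
proof -
  have 0: "fst (w t) \<in> cimg c" "(w has_vector_derivative nfield c (w t)) (at t)"
    using assms by (auto simp: nsol_def)
  show "fst (w t) \<in> cimg c" by (rule 0(1))
  note f = bounded_linear.has_vector_derivative[OF bounded_linear_fst]
  note s = bounded_linear.has_vector_derivative[OF bounded_linear_snd]
  show "((\<lambda>t. fst (w t)) has_vector_derivative fst (snd (w t))) (at t)"
    using f[OF 0(2)] by (simp add: nfield_def)
  show "((\<lambda>t. fst (snd (w t))) has_vector_derivative - \<Gamma> c (fst (w t)) (fst (snd (w t))) - grad c (fst (w t))) (at t)"
    using f[OF s[OF 0(2)]] by (simp add: nfield_def)
  show "((\<lambda>t. snd (snd (w t))) has_real_derivative E - Vc c (fst (w t))) (at t)"
    using s[OF s[OF 0(2)]] by (simp add: nfield_def has_real_derivative_iff_has_vector_derivative)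
qed

lemma nsol_V:
  assumes "c \<in> A" "nsol c w K" "t \<in> K"
  shows "((\<lambda>t. Vc c (fst (w t))) has_real_derivative dV c (fst (w t)) (fst (snd (w t)))) (at t)"
proof -
  note n = nsolD[OF assms(2,3)]
  have DV0: "(Vc c has_derivative dV c (fst (w t))) (at (fst (w t)))"
    using Vc_differentiable[OF assms(1) n(1)] by (simp add: frechet_derivative_works)
  have "((\<lambda>t. Vc c (fst (w t))) has_derivative (\<lambda>h. dV c (fst (w t)) (h *\<^sub>R fst (snd (w t))))) (at t)"
    by (rule has_derivative_compose[OF n(2)[unfolded has_vector_derivative_def] DV0])
  moreover have "(\<lambda>h. dV c (fst (w t)) (h *\<^sub>R fst (snd (w t)))) = (*) (dV c (fst (w t)) (fst (snd (w t))))"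
    using linear_cmul[OF has_derivative_linear[OF DV0]] by (auto simp: fun_eq_iff)
  ultimately show ?thesis by (simp only: has_field_derivative_def)
qed

definition energy :: "('m, 'e) chart \<Rightarrow> 'e \<times> 'e \<times> real \<Rightarrow> real" where
  "energy c w = g c (fst w) (fst (snd w)) (fst (snd w)) / 2 + Vc c (fst w)"

text \<open>In the derivative of the kinetic energy, the term from the metric cancels against the Christoffel
  symbols and the gradient cancels the derivative of V.\<close>

lemma nsol_energy:
  assumes c: "c \<in> A" and w: "nsol c w K" and K: "is_interval K" and t: "t \<in> K" "t0 \<in> K"
  shows "energy c (w t) = energy c (w t0)"
proof -
  have D: "((\<lambda>t. energy c (w t)) has_derivative (\<lambda>h. 0)) (at t within K)" if t: "t \<in> K" for t
  proof -
    define y v where "y = fst (w t)" and "v = fst (snd (w t))"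
    note n = nsolD[OF w t, folded y_def v_def]
    let ?a = "- \<Gamma> c y v - grad c y"
    note ms = bilinear_ladd[OF metric_bilinear[OF c n(1)]] bilinear_lsub[OF metric_bilinear[OF c n(1)]]
      bilinear_lmul[OF metric_bilinear[OF c n(1)]] bilinear_rmul[OF metric_bilinear[OF c n(1)]]
      bilinear_lneg[OF metric_bilinear[OF c n(1)]]
    have "((\<lambda>t. g c (fst (w t)) (fst (snd (w t))) (fst (snd (w t)))) has_derivative
      (\<lambda>h. dg c y (h *\<^sub>R v) v v + g c y (h *\<^sub>R ?a) v + g c y v (h *\<^sub>R ?a))) (at t)"
      unfolding y_def v_def
      by (rule metric_has_derivative[OF c]) (use n in \<open>simp_all add: has_vector_derivative_def y_def v_def\<close>)
    moreover have "(\<lambda>h. dg c y (h *\<^sub>R v) v v + g c y (h *\<^sub>R ?a) v + g c y v (h *\<^sub>R ?a)) = (*) (- 2 * dV c y v)"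
    proof
      fix h
      have B: "g c y v ?a = g c y ?a v" by (rule metric_sym[OF c n(1)])
      have A: "g c y ?a v = - (dg c y v v v / 2) - dV c y v"
        using christoffel_eq[OF c n(1), of v v] gradient_eq[OF c n(1), of v] by (simp add: ms)
      have d1: "dg c y (h *\<^sub>R v) v v = h * dg c y v v v"
        using linear_cmul[OF dg_linear1[OF c n(1)]] by simp
      have d2: "g c y (h *\<^sub>R ?a) v = h * g c y ?a v" "g c y v (h *\<^sub>R ?a) = h * g c y v ?a"
        by (simp_all only: ms(3,4) real_scaleR_def)
      have "dg c y (h *\<^sub>R v) v v + g c y (h *\<^sub>R ?a) v + g c y v (h *\<^sub>R ?a)
        = h * dg c y v v v + h * (- (dg c y v v v / 2) - dV c y v) + h * (- (dg c y v v v / 2) - dV c y v)"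
        by (simp only: d1 d2 B A)
      then show "dg c y (h *\<^sub>R v) v v + g c y (h *\<^sub>R ?a) v + g c y v (h *\<^sub>R ?a) = - 2 * dV c y v * h"
        by (simp add: algebra_simps)
    qed
    ultimately have "((\<lambda>t. g c (fst (w t)) (fst (snd (w t))) (fst (snd (w t)))) has_real_derivative - 2 * dV c y v) (at t)"
      by (simp only: has_field_derivative_def)
    from DERIV_add[OF DERIV_cdivide[OF this, of 2] nsol_V[OF c w t, folded y_def v_def]]
    have "((\<lambda>t. energy c (w t)) has_real_derivative 0) (at t)"
      unfolding energy_def by simp
    then show ?thesis by (simp add: has_field_derivative_def has_derivative_at_withinI lambda_zero)
  qed
  have "convex K" using K by (simp add: is_interval_convex)
  from has_derivative_zero_constant[OF this D] show ?thesis using t by metis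
qed

text \<open>On the energy level E, the change of parameter whose derivative is the kinetic energy divided
  by the square root of l turns a solution of Newton's equation into a Jacobi geodesic of constant l.\<close>

lemma newton_to_jacobi:
  fixes \<alpha> l :: real
  assumes c: "c \<in> A" and K: "open K" "is_interval K" and w: "nsol c w K"
    and en: "\<And>t. t \<in> K \<Longrightarrow> energy c (w t) = E" and pos: "\<And>t. t \<in> K \<Longrightarrow> Vc c (fst (w t)) < E" and l: "l > 0"
  defines "s \<equiv> \<lambda>t. \<alpha> + snd (snd (w t)) / sqrt l"
  shows "\<exists>x. jsol_on x (s ` K) \<and> (\<forall>t\<in>K. x (s t) = cinv c (fst (w t)) \<and> x (s t) \<in> cdom c \<and> jconst x c (s t) = l \<and>
       state x c (s t) = (fst (w t), (sqrt l / (E - Vc c (fst (w t)))) *\<^sub>R fst (snd (w t))))"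
proof -
  have sl: "sqrt l > 0" using l by simp
  define k where "k t = E - Vc c (fst (w t))" for t
  have k: "k t > 0" if "t \<in> K" for t using pos[OF that] by (simp add: k_def)
  have Ds: "(s has_real_derivative k t / sqrt l) (at t)" if "t \<in> K" for t
    using DERIV_add[OF DERIV_const[of \<alpha>] DERIV_cdivide[OF nsolD(4)[OF w that], of "sqrt l"]]
    by (simp add: s_def k_def)
  have Dpos: "k t / sqrt l > 0" if "t \<in> K" for t using k[OF that] sl by simp
  have inv1: "strict_mono_on K s" by (rule continuous_strict_mono_inverse(1)[OF K Ds Dpos])
  have inv2: "open (s ` K)" by (rule continuous_strict_mono_inverse(2)[OF K Ds Dpos])
  have inv3: "is_interval (s ` K)" by (rule continuous_strict_mono_inverse(3)[OF K Ds Dpos])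
  have inv4: "(inv_into K s has_real_derivative 1 / (k t / sqrt l)) (at (s t))" if "t \<in> K" for t
    by (rule continuous_strict_mono_inverse(4)[OF K Ds Dpos that])
  have inj: "inj_on s K" using inv1 by (rule strict_mono_on_imp_inj_on)
  let ?\<theta> = "inv_into K s"
  have th: "?\<theta> (s t) = t" if "t \<in> K" for t using inj that by simp
  define \<zeta> where "\<zeta> t = (fst (w t), (sqrt l / k t) *\<^sub>R fst (snd (w t)))" for t
  have zeta: "((\<lambda>s. \<zeta> (?\<theta> s)) has_vector_derivative jfield c (\<zeta> t)) (at (s t))" if t: "t \<in> K" for t
  proof -
    define y v where "y = fst (w t)" and "v = fst (snd (w t))"
    note n = nsolD[OF w t, folded y_def v_def]
    define b where "b = sqrt l / k t"
    let ?a = "- \<Gamma> c y v - grad c y"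
    have kt: "k t > 0" by (rule k[OF t])
    have kE: "E - Vc c y = k t" by (simp add: k_def y_def)
    have Dk: "(k has_real_derivative - dV c y v) (at t)"
      using DERIV_diff[OF DERIV_const[of E] nsol_V[OF c w t]] unfolding k_def[abs_def] y_def v_def by simp
    have "((\<lambda>t. sqrt l / k t) has_real_derivative sqrt l * dV c y v / (k t)\<^sup>2) (at t)"
      using DERIV_divide[OF DERIV_const[of "sqrt l"] Dk] kt by (simp add: power2_eq_square)
    from has_vector_derivative_scaleR[OF this n(3)]
    have Dv: "((\<lambda>t. (sqrt l / k t) *\<^sub>R fst (snd (w t))) has_vector_derivative b *\<^sub>R ?a + (sqrt l * dV c y v / (k t)\<^sup>2) *\<^sub>R v) (at t)"
      by (simp add: b_def v_def)
    have Dz: "(\<zeta> has_derivative (\<lambda>h. h *\<^sub>R (v, b *\<^sub>R ?a + (sqrt l * dV c y v / (k t)\<^sup>2) *\<^sub>R v))) (at (?\<theta> (s t)))"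
      unfolding \<zeta>_def[abs_def] th[OF t]
      using has_vector_derivative_Pair[OF n(2) Dv] by (simp add: has_vector_derivative_def)
    have "1 / (k t / sqrt l) = b" by (simp add: b_def)
    then have Dth: "(?\<theta> has_derivative (\<lambda>h. h * b)) (at (s t))"
      using inv4[OF t] by (simp only: has_field_derivative_def mult_commute_abs)
    have jz: "jfield c (\<zeta> t) = b *\<^sub>R (v, b *\<^sub>R ?a + (sqrt l * dV c y v / (k t)\<^sup>2) *\<^sub>R v)"
    proof -
      have gG: "g c y (grad c y) (b *\<^sub>R v) = b * dV c y v"
        using gradient_eq[OF c n(1)] by (simp add: bilinear_rmul[OF metric_bilinear[OF c n(1)]])
      have "g c y v v = 2 * k t" using en[OF t] by (simp add: energy_def y_def v_def k_def)
      then have gv: "g c y (b *\<^sub>R v) (b *\<^sub>R v) / 2 = b\<^sup>2 * k t"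
        by (simp add: bilinear_rmul[OF metric_bilinear[OF c n(1)]] bilinear_lmul[OF metric_bilinear[OF c n(1)]] power2_eq_square)
      have "snd (jfield c (y, b *\<^sub>R v)) = (1 / k t) *\<^sub>R ((b * dV c y v) *\<^sub>R (b *\<^sub>R v) - (b\<^sup>2 * k t) *\<^sub>R grad c y) - b\<^sup>2 *\<^sub>R \<Gamma> c y v"
        unfolding jfield_def fst_conv snd_conv gG gv kE christoffel_scale[OF c n(1)] by (rule refl)
      also have "\<dots> = (b\<^sup>2 * dV c y v / k t) *\<^sub>R v - b\<^sup>2 *\<^sub>R grad c y - b\<^sup>2 *\<^sub>R \<Gamma> c y v"
        using kt by (simp add: scaleR_diff_right power2_eq_square)
      also have "b\<^sup>2 * dV c y v / k t = b * (sqrt l * dV c y v / (k t)\<^sup>2)"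
        using kt by (simp add: b_def power2_eq_square field_simps)
      finally have "snd (jfield c (y, b *\<^sub>R v)) = b *\<^sub>R (b *\<^sub>R ?a + (sqrt l * dV c y v / (k t)\<^sup>2) *\<^sub>R v)"
        by (simp add: scaleR_add_right scaleR_diff_right power2_eq_square algebra_simps)
      moreover have "\<zeta> t = (y, b *\<^sub>R v)" by (simp add: \<zeta>_def y_def v_def b_def)
      ultimately show ?thesis by (simp add: jfield_def prod_eq_iff)
    qed
    have "((\<lambda>s. \<zeta> (?\<theta> s)) has_derivative (\<lambda>h. (h * b) *\<^sub>R (v, b *\<^sub>R ?a + (sqrt l * dV c y v / (k t)\<^sup>2) *\<^sub>R v))) (at (s t))"
      by (rule has_derivative_compose[OF Dth Dz])
    then show ?thesis unfolding has_vector_derivative_def jz by simp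
  qed
  have sol: "\<zeta> (?\<theta> r) \<in> phase c \<and> ((\<lambda>s. \<zeta> (?\<theta> s)) has_vector_derivative jfield c (\<zeta> (?\<theta> r))) (at r)"
    if "r \<in> s ` K" for r
  proof -
    obtain t where t: "t \<in> K" "r = s t" using \<open>r \<in> s ` K\<close> by blast
    have "\<zeta> t \<in> phase c" using nsolD(1)[OF w t(1)] pos[OF t(1)] by (simp add: phase_iff \<zeta>_def)
    then show ?thesis using zeta[OF t(1)] by (simp add: t(2) th[OF t(1)])
  qed
  define x where "x r = cinv c (fst (\<zeta> (?\<theta> r)))" for r
  have x1: "jsol_on x (s ` K)"
    unfolding x_def by (rule ode_jsol(1)[OF c inv2 inv3 sol])
  have x2: "x r \<in> cdom c \<and> state x c r = \<zeta> (?\<theta> r)" if "r \<in> s ` K" for r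
    unfolding x_def by (rule ode_jsol(2)[OF c inv2 inv3 sol that])
  have "x (s t) = cinv c (fst (w t)) \<and> x (s t) \<in> cdom c \<and> jconst x c (s t) = l \<and>
       state x c (s t) = (fst (w t), (sqrt l / (E - Vc c (fst (w t)))) *\<^sub>R fst (snd (w t)))" if t: "t \<in> K" for t
  proof -
    have 1: "x (s t) \<in> cdom c" "state x c (s t) = (fst (w t), (sqrt l / k t) *\<^sub>R fst (snd (w t)))"
      using x2[of "s t"] t by (auto simp: th \<zeta>_def)
    have kt: "k t > 0" by (rule k[OF t])
    have "g c (fst (w t)) (fst (snd (w t))) (fst (snd (w t))) = 2 * k t"
      using en[OF t] by (simp add: energy_def k_def)
    moreover have "jconst x c (s t) = k t / 2 * g c (fst (w t)) ((sqrt l / k t) *\<^sub>R fst (snd (w t))) ((sqrt l / k t) *\<^sub>R fst (snd (w t)))"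
      using 1(2) by (simp add: jconst_def state_def k_def)
    ultimately have "jconst x c (s t) = k t / 2 * ((sqrt l / k t) * ((sqrt l / k t) * (2 * k t)))"
      using bilinear_rmul[OF metric_bilinear[OF c nsolD(1)[OF w t]]] bilinear_lmul[OF metric_bilinear[OF c nsolD(1)[OF w t]]]
      by simp
    also have "\<dots> = sqrt l * sqrt l" using kt by (simp add: field_simps)
    finally have "jconst x c (s t) = l" using l by simp
    moreover have "x (s t) = cinv c (fst (w t))" using t by (simp add: x_def th \<zeta>_def)
    ultimately show ?thesis using 1 by (simp add: k_def)
  qed
  then show ?thesis using x1 by blast
qed

end

text \<open>If k'' \<ge> m on an interval, then k exceeds its value at the midpoint by the quadratic m (\<tau>/2)^2 / 2 at one
  of the end points, one towards which k does not decrease at the midpoint.\<close>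

lemma strictly_convex_endpoint:
  fixes k h :: "real \<Rightarrow> real"
  assumes \<tau>: "\<tau> > 0" and k: "\<And>t. t \<in> {-\<tau>..0} \<Longrightarrow> (k has_real_derivative h t) (at t)"
    and h: "\<And>t. t \<in> {-\<tau>..0} \<Longrightarrow> \<exists>D\<ge>m. (h has_real_derivative D) (at t)"
  shows "k (- \<tau>) \<ge> k (- \<tau> / 2) + m * \<tau>\<^sup>2 / 8 \<or> k 0 \<ge> k (- \<tau> / 2) + m * \<tau>\<^sup>2 / 8"
proof -
  define p where "p = - \<tau> / 2"
  define f where "f t = k t - m / 2 * (t - p)\<^sup>2" for t
  define u where "u t = h t - m * (t - p)" for t
  have p: "-\<tau> \<le> p" "p \<le> 0" using \<tau> by (auto simp: p_def)
  have f: "(f has_real_derivative u t) (at t)" if "t \<in> {-\<tau>..0}" for t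
    unfolding f_def[abs_def] u_def using k[OF that]
    by (auto intro!: derivative_eq_intros simp: power2_eq_square field_simps)
  have mono: "u a \<le> u b" if "-\<tau> \<le> a" "a \<le> b" "b \<le> 0" for a b
  proof (rule DERIV_nonneg_imp_nondecreasing[OF that(2)])
    fix t assume "a \<le> t" "t \<le> b"
    then have "t \<in> {-\<tau>..0}" using that by auto
    from h[OF this] obtain D where D: "D \<ge> m" "(h has_real_derivative D) (at t)" by blast
    have "(u has_real_derivative (D - m)) (at t)"
      unfolding u_def[abs_def] using D(2) by (auto intro!: derivative_eq_intros)
    then show "\<exists>y. (u has_real_derivative y) (at t) \<and> 0 \<le> y" using D(1) by auto
  qed
  show ?thesis
  proof (cases "h p \<ge> 0")
    case True
    have "f p \<le> f 0"
    proof (rule DERIV_nonneg_imp_nondecreasing[OF p(2)])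
      fix t assume t: "p \<le> t" "t \<le> 0"
      have "0 \<le> u t" using mono[OF p(1) t] True by (simp add: u_def)
      then show "\<exists>y. (f has_real_derivative y) (at t) \<and> 0 \<le> y" using f[of t] t p by auto
    qed
    then show ?thesis by (simp add: f_def p_def power2_eq_square field_simps)
  next
    case False
    have "f p \<le> f (-\<tau>)"
    proof (rule DERIV_nonpos_imp_nonincreasing[OF p(1)])
      fix t assume t: "-\<tau> \<le> t" "t \<le> p"
      have "u t \<le> 0" using mono[OF t p(2)] False by (simp add: u_def)
      then show "\<exists>y. (f has_real_derivative y) (at t) \<and> y \<le> 0" using f[of t] t p by auto
    qed
    then show ?thesis by (simp add: f_def p_def power2_eq_square field_simps)
  qed
qed

locale boundary_setup = jacobi_setup A g V E
  for A :: "('m::t2_space, 'e::euclidean_space) chart set" and g :: "('m, 'e) metric" and V :: "'m \<Rightarrow> real" and E :: real +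
  assumes regular: "regular_value A V E"
begin

abbreviation rest :: "'e \<Rightarrow> 'e \<times> 'e \<times> real" where
  "rest y \<equiv> (y, 0, 0)"

text \<open>The first derivative of E - V along a motion. A lower bound for its own derivative is
  what makes motions near the boundary turn inwards.\<close>

definition accel :: "('m, 'e) chart \<Rightarrow> 'e \<times> 'e \<times> real \<Rightarrow> real" where
  "accel c w = - dV c (fst w) (fst (snd w))"

text \<open>The flow of Newton's equation near a point of the level set at rest. The force pushes inwards:
  the second derivative of E - V along the motion is bounded below by a positive constant, the
  gradient of V not being zero.\<close>

definition bflow :: "('m, 'e) chart \<Rightarrow> 'm \<Rightarrow> real \<Rightarrow> real \<Rightarrow> real \<Rightarrow> (real \<Rightarrow> 'e \<times> 'e \<times> real \<Rightarrow> 'e \<times> 'e \<times> real) \<Rightarrow> bool" where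
  "bflow c P T r m \<phi> \<longleftrightarrow> c \<in> A \<and> P \<in> cdom c \<and> V P = E \<and> T > 0 \<and> r > 0 \<and> m > 0 \<and>
     C1_on (\<lambda>(t, w). \<phi> t w) ({-T<..<T} \<times> ball (rest (cmap c P)) r) \<and>
     (\<forall>w\<in>ball (rest (cmap c P)) r. \<phi> 0 w = w \<and> nsol c (\<lambda>t. \<phi> t w) {-T<..<T} \<and>
        (\<forall>t\<in>{-T<..<T}. \<exists>D\<ge>m. ((\<lambda>t. accel c (\<phi> t w)) has_real_derivative D) (at t)))"

lemma ex_bflow:
  assumes c: "c \<in> A" and P: "P \<in> cdom c" "V P = E"
  shows "\<exists>T r m \<phi>. bflow c P T r m \<phi>"
proof -
  let ?y = "cmap c P" and ?D = "cimg c \<times> (UNIV :: ('e \<times> real) set)"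
  let ?w = "rest ?y"
  have y: "?y \<in> cimg c" by (rule cmap_in[OF chart[OF c] P(1)])
  have oD: "open ?D" by (intro open_Times chart_open(2) chart c open_UNIV)
  have wD: "?w \<in> ?D" using y by simp
  define G where "G = grad c ?y"
  have G0: "G \<noteq> 0"
  proof
    assume "G = 0"
    then have "dV c ?y u = 0" for u
      using gradient_eq[OF c y, of u] bilinear_lzero[OF metric_bilinear[OF c y]] by (simp add: G_def)
    then show False using regular P c unfolding regular_value_def by blast
  qed
  have acc1: "C1_on (accel c) ?D"
  proof -
    have "C1_on (\<lambda>w. frechet_derivative (Vc c) (at (fst w)) (fst (snd w))) ?D"
      by (rule C1_on_frechet_derivative[OF Vc_C2[OF c] chart_open(2)[OF chart[OF c]]])
         (auto intro!: C1_intros oD)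
    then show ?thesis unfolding accel_def by (rule C1_on_minus)
  qed
  then obtain a' where a': "\<And>w. w \<in> ?D \<Longrightarrow> (accel c has_derivative blinfun_apply (a' w)) (at w)" "continuous_on ?D a'"
    by (rule C1_onE) blast
  define La where "La w = a' w (nfield c w)" for w
  have cLa: "continuous_on ?D La"
    unfolding La_def by (intro continuous_intros a'(2) C1_on_continuous_on[OF nfield_C1[OF c]])
  have "La ?w = g c ?y G G"
  proof -
    have "\<Gamma> c ?y 0 = 0" using christoffel_scale[OF c y, of 0 0] by simp
    moreover have "Vc c ?y = E" using cinv_cmap[OF chart[OF c] P(1)] P(2) by simp
    ultimately have nf: "nfield c ?w = (0, - G, 0)" by (simp add: nfield_def G_def)
    have lin: "linear (dV c ?y)" using Vc_differentiable[OF c y] by (rule linear_frechet_derivative)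
    have "((\<lambda>t::real. accel c (?y, t *\<^sub>R (- G), 0)) has_derivative (\<lambda>h. a' ?w (0, h *\<^sub>R (- G), 0))) (at 0)"
      by (rule has_derivative_compose[where f="\<lambda>t. (?y, t *\<^sub>R (- G), 0)" and g="accel c"])
         (use a'(1)[OF wD] in \<open>auto intro!: derivative_eq_intros\<close>)
    moreover have "(\<lambda>t::real. accel c (?y, t *\<^sub>R (- G), 0)) = (\<lambda>t. t * dV c ?y G)"
      using linear_cmul[OF lin] linear_neg[OF lin] by (simp add: accel_def fun_eq_iff del: scaleR_minus_right) 
    moreover have "((\<lambda>t. t * dV c ?y G) has_derivative (\<lambda>h. h * dV c ?y G)) (at 0)"
      by (auto intro!: derivative_eq_intros)
    ultimately have "(\<lambda>h. a' ?w (0, h *\<^sub>R (- G), 0)) = (\<lambda>h. h * dV c ?y G)"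
      using has_derivative_unique by metis
    from fun_cong[OF this, of 1] show ?thesis
      using gradient_eq[OF c y, of G] by (simp add: La_def nf G_def)
  qed
  then have Lpos: "La ?w > 0" using metric_pos[OF c y G0] by simp
  define m where "m = La ?w / 2"
  have m: "m > 0" "La ?w > m" using Lpos by (auto simp: m_def)
  obtain T1 r1 \<phi> where f: "T1 > 0" "r1 > 0" "ball ?w r1 \<subseteq> ?D"
    "\<And>w. w \<in> ball ?w r1 \<Longrightarrow> \<phi> 0 w = w"
    "\<And>w t. w \<in> ball ?w r1 \<Longrightarrow> t \<in> {-T1<..<T1} \<Longrightarrow> \<phi> t w \<in> ?D"
    "\<And>w t. w \<in> ball ?w r1 \<Longrightarrow> t \<in> {-T1<..<T1} \<Longrightarrow> ((\<lambda>t. \<phi> t w) has_vector_derivative nfield c (\<phi> t w)) (at t)"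
    "C1_on (\<lambda>(t, w). \<phi> t w) ({-T1<..<T1} \<times> ball ?w r1)"
    by (rule ode_local_flow[OF nfield_C1[OF c] oD wD]) (rule that)
  let ?W = "{-T1<..<T1} \<times> ball ?w r1"
  have oW: "open ?W" by (intro open_Times open_greaterThanLessThan open_ball)
  have oN: "open (?D \<inter> La -` {m<..})"
    by (rule continuous_open_preimage[OF cLa oD open_greaterThan])
  have "open (?W \<inter> (\<lambda>(t, w). \<phi> t w) -` (?D \<inter> La -` {m<..}))"
    by (rule continuous_open_preimage[OF C1_on_continuous_on[OF f(7)] oW oN])
  moreover have "(0, ?w) \<in> ?W \<inter> (\<lambda>(t, w). \<phi> t w) -` (?D \<inter> La -` {m<..})"
    using f(1,2) f(4)[of ?w] m wD by simp
  ultimately obtain Ta Wb where Q: "open Ta" "open Wb" "(0, ?w) \<in> Ta \<times> Wb"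
    "Ta \<times> Wb \<subseteq> ?W \<inter> (\<lambda>(t, w). \<phi> t w) -` (?D \<inter> La -` {m<..})"
    by (rule open_prod_elim)
  obtain T where T: "T > 0" "ball 0 T \<subseteq> Ta" using Q(1,3) openE by blast
  obtain r where r: "r > 0" "ball ?w r \<subseteq> Wb" using Q(2,3) openE by blast
  have TW: "t \<in> {-T1<..<T1} \<and> w \<in> ball ?w r1 \<and> \<phi> t w \<in> ?D \<and> La (\<phi> t w) > m"
    if "t \<in> {-T<..<T}" "w \<in> ball ?w r" for t w
  proof -
    have "t \<in> ball 0 T" using that(1) by (auto simp: dist_real_def)
    then have "(t, w) \<in> Ta \<times> Wb" using that(2) T(2) r(2) by blast
    from subsetD[OF Q(4) this] show ?thesis by simp
  qed
  have "bflow c P T r m \<phi>"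
    unfolding bflow_def
  proof (intro conjI ballI)
    show "C1_on (\<lambda>(t, w). \<phi> t w) ({-T<..<T} \<times> ball ?w r)"
      by (rule C1_on_subset[OF f(7)]) (use TW in blast)
    fix w assume w: "w \<in> ball ?w r"
    have w1: "w \<in> ball ?w r1" using TW[of 0 w] T(1) w by simp
    show "\<phi> 0 w = w" by (rule f(4)[OF w1])
    show "nsol c (\<lambda>t. \<phi> t w) {-T<..<T}"
      unfolding nsol_def
    proof
      fix t assume t: "t \<in> {-T<..<T}"
      show "fst (\<phi> t w) \<in> cimg c \<and> ((\<lambda>t. \<phi> t w) has_vector_derivative nfield c (\<phi> t w)) (at t)"
        using TW[OF t w] f(6)[of w t] by (auto simp: mem_Times_iff)
    qed
    fix t assume t: "t \<in> {-T<..<T}"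
    note tw = TW[OF t w]
    have "((\<lambda>t. accel c (\<phi> t w)) has_derivative (\<lambda>h. a' (\<phi> t w) (h *\<^sub>R nfield c (\<phi> t w)))) (at t)"
      by (rule has_derivative_compose[where f="\<lambda>t. \<phi> t w", OF f(6)[unfolded has_vector_derivative_def] a'(1)])
         (use tw in blast)+
    then have "((\<lambda>t. accel c (\<phi> t w)) has_real_derivative La (\<phi> t w)) (at t)"
      by (simp add: has_field_derivative_def La_def blinfun.scaleR_right mult_commute_abs)
    then show "\<exists>D\<ge>m. ((\<lambda>t. accel c (\<phi> t w)) has_real_derivative D) (at t)"
      using tw by (intro exI[of _ "La (\<phi> t w)"]) simp
  qed (use c P T(1) r(1) m(1) in auto)
  then show ?thesis by blast
qed

lemma bflowD:
  assumes "bflow c P T r m \<phi>"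
  shows "c \<in> A" "P \<in> cdom c" "V P = E" "T > 0" "r > 0" "m > 0"
    "C1_on (\<lambda>(t, w). \<phi> t w) ({-T<..<T} \<times> ball (rest (cmap c P)) r)"
    "\<And>w. w \<in> ball (rest (cmap c P)) r \<Longrightarrow> \<phi> 0 w = w"
    "\<And>w. w \<in> ball (rest (cmap c P)) r \<Longrightarrow> nsol c (\<lambda>t. \<phi> t w) {-T<..<T}"
    "\<And>w t. w \<in> ball (rest (cmap c P)) r \<Longrightarrow> t \<in> {-T<..<T} \<Longrightarrow> \<exists>D\<ge>m. ((\<lambda>t. accel c (\<phi> t w)) has_real_derivative D) (at t)"
  using assms unfolding bflow_def by blast+

lemma bflow_kinetic_derivative:
  assumes b: "bflow c P T r m \<phi>" and w: "w \<in> ball (rest (cmap c P)) r" and t: "t \<in> {-T<..<T}"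
  shows "((\<lambda>t. E - Vc c (fst (\<phi> t w))) has_real_derivative accel c (\<phi> t w)) (at t)"
  using DERIV_diff[OF DERIV_const[of E] nsol_V[OF bflowD(1)[OF b] bflowD(9)[OF b w] t]]
  by (simp add: accel_def)

lemma bflow_energy:
  assumes b: "bflow c P T r m \<phi>" and w: "w \<in> ball (rest (cmap c P)) r" and t: "t \<in> {-T<..<T}"
  shows "energy c (\<phi> t w) = energy c w"
proof -
  have "energy c (\<phi> t w) = energy c (\<phi> 0 w)"
    by (rule nsol_energy[OF bflowD(1)[OF b] bflowD(9)[OF b w] _ t]) (use bflowD(4)[OF b] in auto)
  then show ?thesis by (simp add: bflowD(8)[OF b w])
qed

text \<open>E - V and its first derivative vanish at the start and its second derivative is positive; so the motion
  enters the sublevel set at once.\<close>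

lemma bflow_positive:
  assumes b: "bflow c P T r m \<phi>" and w: "rest y \<in> ball (rest (cmap c P)) r" and y: "Vc c y = E" and t: "t \<in> {0<..<T}"
  shows "Vc c (fst (\<phi> t (rest y))) < E" "snd (snd (\<phi> t (rest y))) > 0" "energy c (\<phi> t (rest y)) = E"
proof -
  let ?w = "rest y"
  note c = bflowD(1)[OF b] and n = bflowD(9)[OF b w]
  have \<phi>0: "\<phi> 0 ?w = ?w" by (rule bflowD(8)[OF b w])
  have yc: "y \<in> cimg c" using nsolD(1)[OF n, of 0] bflowD(4)[OF b] \<phi>0 by simp
  have in': "s \<in> {-T<..<T}" if "0 \<le> s" "s \<le> t" for s using that t bflowD(4)[OF b] by auto
  have a: "accel c (\<phi> s ?w) > 0" if s: "0 < s" "s \<le> t" for s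
  proof -
    have "accel c (\<phi> 0 ?w) < accel c (\<phi> s ?w)"
    proof (rule DERIV_pos_imp_increasing[OF s(1)])
      fix q assume "0 \<le> q" "q \<le> s"
      from bflowD(10)[OF b w in'] this s(2) bflowD(6)[OF b]
      show "\<exists>D. ((\<lambda>t. accel c (\<phi> t ?w)) has_real_derivative D) (at q) \<and> 0 < D"
        by (meson less_le_trans order_trans)
    qed
    moreover have "dV c y 0 = 0" using Vc_differentiable[OF c yc] by (simp add: linear_0 linear_frechet_derivative)
    ultimately show ?thesis by (simp add: \<phi>0 accel_def)
  qed
  have k: "E - Vc c (fst (\<phi> s ?w)) > 0" if s: "0 < s" "s \<le> t" for s
  proof -
    have "E - Vc c (fst (\<phi> 0 ?w)) < E - Vc c (fst (\<phi> s ?w))"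
    proof (rule DERIV_pos_imp_increasing_open[OF s(1)])
      show "\<exists>D. ((\<lambda>t. E - Vc c (fst (\<phi> t ?w))) has_real_derivative D) (at q) \<and> 0 < D" if "0 < q" "q < s" for q
        using bflow_kinetic_derivative[OF b w in'[of q]] a[of q] that s(2) by auto
      show "continuous_on {0..s} (\<lambda>t. E - Vc c (fst (\<phi> t ?w)))"
        using s(2) by (intro continuous_at_imp_continuous_on ballI DERIV_isCont[OF bflow_kinetic_derivative[OF b w in']]) auto
    qed
    then show ?thesis using y by (simp add: \<phi>0)
  qed
  show "Vc c (fst (\<phi> t ?w)) < E" using k[of t] t by simp
  have "snd (snd (\<phi> 0 ?w)) < snd (snd (\<phi> t ?w))"
  proof (rule DERIV_pos_imp_increasing_open[where f="\<lambda>t. snd (snd (\<phi> t ?w))"])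
    show "0 < t" using t by simp
    show "\<exists>D. ((\<lambda>t. snd (snd (\<phi> t ?w))) has_real_derivative D) (at q) \<and> 0 < D" if "0 < q" "q < t" for q
      using nsolD(4)[OF n in'[of q]] k[of q] that by auto
    show "continuous_on {0..t} (\<lambda>t. snd (snd (\<phi> t ?w)))"
      by (intro continuous_at_imp_continuous_on ballI DERIV_isCont[OF nsolD(4)[OF n in']]) auto
  qed
  then show "snd (snd (\<phi> t ?w)) > 0" by (simp add: \<phi>0)
  show "energy c (\<phi> t ?w) = E"
    using bflow_energy[OF b w in'[of t]] t y bilinear_lzero[OF metric_bilinear[OF c yc]] by (simp add: energy_def)
qed

text \<open>By the intermediate value theorem, as the action is 0 at time 0.\<close>

lemma bflow_action_onto:
  assumes b: "bflow c P T r m \<phi>" and w: "rest y \<in> ball (rest (cmap c P)) r" and t: "t \<in> {0<..<T}"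
    and s: "0 < s" "s \<le> snd (snd (\<phi> t (rest y))) / sqrt l" and l: "l > 0"
  shows "\<exists>q. 0 < q \<and> q \<le> t \<and> s = snd (snd (\<phi> q (rest y))) / sqrt l"
proof -
  let ?s = "\<lambda>q. snd (snd (\<phi> q (rest y))) / sqrt l"
  have 0: "?s 0 = 0" by (simp add: bflowD(8)[OF b w])
  have "isCont (\<lambda>t. snd (snd (\<phi> t (rest y)))) q" if "0 \<le> q \<and> q \<le> t" for q
    by (rule DERIV_isCont[OF nsolD(4)[OF bflowD(9)[OF b w]]]) (use that t bflowD(4)[OF b] in auto)
  then have "\<forall>q. 0 \<le> q \<and> q \<le> t \<longrightarrow> isCont ?s q"
    using l by (auto intro!: continuous_intros)
  then obtain q where q: "0 \<le> q" "q \<le> t" "?s q = s"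
    using IVT[of ?s 0 s t] s t 0 by auto
  moreover have "q \<noteq> 0"
  proof
    assume "q = 0"
    then show False using q(3) s(1) 0 by simp
  qed
  ultimately show ?thesis by (intro exI[of _ q]) auto
qed

text \<open>The new parameter starts at 0 together with the action, and the curve converges to the initial
  point because small parameter values belong to small times.\<close>

lemma boundary_curve:
  assumes b: "bflow c P T r m \<phi>" and w: "rest y \<in> ball (rest (cmap c P)) r" and y: "Vc c y = E" and l: "l > 0"
  defines "s \<equiv> \<lambda>t. snd (snd (\<phi> t (rest y))) / sqrt l"
  obtains x where "jsol_on x (s ` {0<..<T})" "(x \<longlongrightarrow> cinv c y) (at_right 0)"
    "\<And>t. t \<in> {0<..<T} \<Longrightarrow> s t > 0 \<and> {0<..s t} \<subseteq> s ` {0<..<T} \<and> x (s t) \<in> cdom c \<and> jconst x c (s t) = l \<and>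
       state x c (s t) = (fst (\<phi> t (rest y)), (sqrt l / (E - Vc c (fst (\<phi> t (rest y))))) *\<^sub>R fst (snd (\<phi> t (rest y))))"
proof -
  let ?w = "rest y"
  note c = bflowD(1)[OF b] and n = bflowD(9)[OF b w] and T = bflowD(4)[OF b]
  have sl: "sqrt l > 0" using l by simp
  have n': "nsol c (\<lambda>t. \<phi> t ?w) {0<..<T}" using n T unfolding nsol_def by auto
  have "\<exists>x. jsol_on x ((\<lambda>t. 0 + snd (snd (\<phi> t ?w)) / sqrt l) ` {0<..<T}) \<and>
     (\<forall>t\<in>{0<..<T}. x (0 + snd (snd (\<phi> t ?w)) / sqrt l) = cinv c (fst (\<phi> t ?w)) \<and> x (0 + snd (snd (\<phi> t ?w)) / sqrt l) \<in> cdom c \<and>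
       jconst x c (0 + snd (snd (\<phi> t ?w)) / sqrt l) = l \<and>
       state x c (0 + snd (snd (\<phi> t ?w)) / sqrt l) = (fst (\<phi> t ?w), (sqrt l / (E - Vc c (fst (\<phi> t ?w)))) *\<^sub>R fst (snd (\<phi> t ?w))))"
    by (rule newton_to_jacobi[OF c _ _ n' bflow_positive(3)[OF b w y] bflow_positive(1)[OF b w y] l]) auto
  then obtain x where x: "jsol_on x (s ` {0<..<T})"
    "\<And>t. t \<in> {0<..<T} \<Longrightarrow> x (s t) = cinv c (fst (\<phi> t ?w)) \<and> x (s t) \<in> cdom c \<and> jconst x c (s t) = l \<and>
       state x c (s t) = (fst (\<phi> t ?w), (sqrt l / (E - Vc c (fst (\<phi> t ?w)))) *\<^sub>R fst (snd (\<phi> t ?w)))"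
    unfolding s_def add_0_left by blast
  have onto: "\<exists>q. 0 < q \<and> q \<le> t \<and> r' = s q" if "t \<in> {0<..<T}" "0 < r'" "r' \<le> s t" for t r'
    using bflow_action_onto[OF b w that(1,2) _ l] that(3) unfolding s_def by blast
  have spos: "s t > 0" if "t \<in> {0<..<T}" for t
    using bflow_positive(2)[OF b w y that] sl by (simp add: s_def)
  show ?thesis
  proof (rule that[of x])
    show "jsol_on x (s ` {0<..<T})" by (rule x(1))
    show "s t > 0 \<and> {0<..s t} \<subseteq> s ` {0<..<T} \<and> x (s t) \<in> cdom c \<and> jconst x c (s t) = l \<and>
       state x c (s t) = (fst (\<phi> t ?w), (sqrt l / (E - Vc c (fst (\<phi> t ?w)))) *\<^sub>R fst (snd (\<phi> t ?w)))"
      if t: "t \<in> {0<..<T}" for t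
    proof -
      have "{0<..s t} \<subseteq> s ` {0<..<T}"
      proof
        fix r' assume "r' \<in> {0<..s t}"
        then obtain q where "0 < q" "q \<le> t" "r' = s q" using onto[OF t, of r'] by auto
        then show "r' \<in> s ` {0<..<T}" using t by auto
      qed
      then show ?thesis using spos[OF t] x(2)[OF t] by blast
    qed
    show "(x \<longlongrightarrow> cinv c y) (at_right 0)"
    proof (rule topological_tendstoI)
      fix S assume S: "open S" "cinv c y \<in> S"
      have "continuous_on {-T<..<T} (\<lambda>t. fst (\<phi> t ?w))"
        using has_vector_derivative_continuous[OF nsolD(2)[OF n]] by (intro continuous_at_imp_continuous_on ballI)
      then have "continuous_on {-T<..<T} (\<lambda>t. cinv c (fst (\<phi> t ?w)))"
        using nsolD(1)[OF n] by (intro continuous_on_compose2[OF continuous_on_cinv[OF chart[OF c]]]) auto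
      then have "open ({-T<..<T} \<inter> (\<lambda>t. cinv c (fst (\<phi> t ?w))) -` S)"
        by (rule continuous_open_preimage[OF _ open_greaterThanLessThan S(1)])
      moreover have "0 \<in> {-T<..<T} \<inter> (\<lambda>t. cinv c (fst (\<phi> t ?w))) -` S"
        using T S(2) by (simp add: bflowD(8)[OF b w])
      ultimately obtain e where e: "e > 0" "ball 0 e \<subseteq> {-T<..<T} \<inter> (\<lambda>t. cinv c (fst (\<phi> t ?w))) -` S"
        using openE by blast
      have eT: "e / 2 \<in> {0<..<T}"
      proof -
        have "e / 2 \<in> ball 0 e" using e(1) by (simp add: dist_real_def)
        then have "e / 2 \<in> {-T<..<T}" using e(2) by blast
        then show ?thesis using e(1) by simp
      qed
      have "x r' \<in> S" if r': "0 < r'" "r' < s (e / 2)" for r'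
      proof -
        obtain q where q: "0 < q" "q \<le> e / 2" "r' = s q" using onto[OF eT r'(1)] r'(2) by auto
        then have "q \<in> ball 0 e" "q \<in> {0<..<T}" using e(1) eT by (auto simp: dist_real_def)
        moreover from this have "cinv c (fst (\<phi> q ?w)) \<in> S" using e(2) by blast
        ultimately show ?thesis using x(2)[of q] q(3) by simp
      qed
      then show "eventually (\<lambda>r'. x r' \<in> S) (at_right 0)"
        unfolding eventually_at_right_field using spos[OF eT] by (intro exI[of _ "s (e / 2)"]) auto
    qed
  qed
qed

text \<open>By compactness of a ball times the unit sphere. This turns smallness of the kinetic energy into
  smallness of the velocity.\<close>

lemma metric_coercive:
  assumes c: "c \<in> A" and y: "y \<in> cimg c"
  obtains \<rho> \<mu> where "\<rho> > 0" "\<mu> > 0" "cball y \<rho> \<subseteq> cimg c" "\<And>z v. z \<in> cball y \<rho> \<Longrightarrow> \<mu> * (norm v)\<^sup>2 \<le> g c z v v"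
proof -
  obtain \<rho> where \<rho>: "\<rho> > 0" "cball y \<rho> \<subseteq> cimg c"
    using open_contains_cball_eq[OF chart_open(2)[OF chart[OF c]], rule_format, of y] y by auto
  let ?K = "cball y \<rho> \<times> sphere (0::'e) 1"
  have "C1_on (\<lambda>q. g c (fst q) (snd q) (snd q)) (cimg c \<times> UNIV)"
    by (intro metric_C1_on[OF c] C1_intros open_Times chart_open(2) chart c) auto
  then have "continuous_on (cimg c \<times> UNIV) (\<lambda>q. g c (fst q) (snd q) (snd q))" by (rule C1_on_continuous_on)
  then have "continuous_on ?K (\<lambda>q. g c (fst q) (snd q) (snd q))"
    by (rule continuous_on_subset) (use \<rho> in auto)
  moreover have "compact ?K" by (intro compact_Times compact_cball compact_sphere)
  moreover obtain e :: 'e where e: "norm e = 1" using norm_Basis SOME_Basis by blast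
  then have "?K \<noteq> {}" using \<rho>(1) by (auto intro!: exI[of _ e])
  ultimately obtain q where q: "q \<in> ?K" "\<And>p. p \<in> ?K \<Longrightarrow> g c (fst q) (snd q) (snd q) \<le> g c (fst p) (snd p) (snd p)"
    using continuous_attains_inf[of ?K "\<lambda>q. g c (fst q) (snd q) (snd q)"] by blast
  have qy: "fst q \<in> cimg c" "snd q \<noteq> 0" using q(1) \<rho> by auto
  define \<mu> where "\<mu> = g c (fst q) (snd q) (snd q)"
  have "\<mu> * (norm v)\<^sup>2 \<le> g c z v v" if z: "z \<in> cball y \<rho>" for z v
  proof (cases "v = 0")
    case True
    then show ?thesis using bilinear_lzero[OF metric_bilinear[OF c]] z \<rho>(2) by auto
  next
    case False
    have zc: "z \<in> cimg c" using z \<rho> by blast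
    define u where "u = (1 / norm v) *\<^sub>R v"
    have "norm u = 1" using False by (simp add: u_def)
    then have "\<mu> \<le> g c z u u" using q(2)[of "(z, u)"] z by (simp add: \<mu>_def)
    moreover have "g c z v v = (norm v)\<^sup>2 * g c z u u"
    proof -
      have "v = norm v *\<^sub>R u" using False by (simp add: u_def)
      then have "g c z v v = g c z (norm v *\<^sub>R u) (norm v *\<^sub>R u)" by simp
      then show ?thesis
        using bilinear_lmul[OF metric_bilinear[OF c zc]] bilinear_rmul[OF metric_bilinear[OF c zc]]
        by (simp add: power2_eq_square)
    qed
    ultimately show ?thesis
      using mult_right_mono[of \<mu> "g c z u u" "(norm v)\<^sup>2"] by (simp add: mult.commute)
  qed
  then show ?thesis using that[OF \<rho>(1) _ \<rho>(2)] metric_pos[OF c qy] unfolding \<mu>_def by blast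
qed

end

context boundary_setup
begin

text \<open>A Jacobi geodesic that converges to a boundary point is a reparameterized motion starting there at
  rest. To see this, restart Newton's equation at a small parameter value and run it backwards.
  Since E - V stays small along the geodesic while its second derivative along the motion is bounded
  below, the motion must reach the parameter value 0 within a uniformly bounded time; it arrives at the boundary
  point with velocity 0, by conservation of energy.\<close>

lemma boundary_unique:
  assumes b: "bflow c P T r m \<phi>" and x: "jsol_on x {0<..<B}" and B: "B > 0"
    and lim: "(x \<longlongrightarrow> P) (at_right 0)" and l: "l > 0"
    and jc: "\<And>s. s \<in> {0<..<B} \<Longrightarrow> x s \<in> cdom c \<Longrightarrow> jconst x c s = l"
  shows "\<exists>e>0. e < T \<and> (\<forall>t\<in>{0<..<e}. snd (snd (\<phi> t (rest (cmap c P)))) / sqrt l < B \<and>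
     x (snd (snd (\<phi> t (rest (cmap c P)))) / sqrt l) = cinv c (fst (\<phi> t (rest (cmap c P)))))"
proof -
  note c = bflowD(1)[OF b] and P = bflowD(2,3)[OF b] and T = bflowD(4)[OF b] and r = bflowD(5)[OF b] and m = bflowD(6)[OF b]
  let ?y0 = "cmap c P"
  have y0: "?y0 \<in> cimg c" by (rule cmap_in[OF chart[OF c] P(1)])
  define L where "L = sqrt l"
  have L: "L > 0" "L * L = l" using l by (simp_all add: L_def)
  define \<tau> where "\<tau> = T / 2"
  have \<tau>: "\<tau> > 0" "\<tau> < T" using T by (simp_all add: \<tau>_def)
  define \<kappa> where "\<kappa> = m * \<tau>\<^sup>2 / 8"
  have \<kappa>: "\<kappa> > 0" using m \<tau> by (simp add: \<kappa>_def)
  obtain \<rho> \<mu> where mu: "\<rho> > 0" "\<mu> > 0" "cball ?y0 \<rho> \<subseteq> cimg c" "\<And>z v. z \<in> cball ?y0 \<rho> \<Longrightarrow> \<mu> * (norm v)\<^sup>2 \<le> g c z v v"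
    by (rule metric_coercive[OF c y0]) (rule that)
  define \<rho>' where "\<rho>' = min \<rho> (r / 2)"
  define \<kappa>' where "\<kappa>' = min \<kappa> (\<mu> * (r / 2)\<^sup>2 / 2)"
  have pos': "\<rho>' > 0" "\<kappa>' > 0" using mu r \<kappa> by (simp_all add: \<rho>'_def \<kappa>'_def)
  have ev: "eventually (\<lambda>s. x s \<in> cdom c \<and> dist (cmap c (x s)) ?y0 < \<rho>' \<and> V (x s) > E - \<kappa>') (at_right 0)"
  proof (intro eventually_conj)
    show 1: "eventually (\<lambda>s. x s \<in> cdom c) (at_right 0)"
      using topological_tendstoD[OF lim chart_open(1)[OF chart[OF c]] P(1)] .
    have "isCont (cmap c) P"
      using continuous_on_cmap[OF chart[OF c]] chart_open(1)[OF chart[OF c]] P(1) continuous_on_eq_continuous_at by blast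
    from isCont_tendsto_compose[OF this lim] show "eventually (\<lambda>s. dist (cmap c (x s)) ?y0 < \<rho>') (at_right 0)"
      using pos'(1) by (rule tendstoD)
    have "isCont V P" using continuous_V by (simp add: continuous_on_eq_continuous_at)
    from isCont_tendsto_compose[OF this lim] have "((\<lambda>s. V (x s)) \<longlongrightarrow> E) (at_right 0)" by (simp add: P(2))
    then show "eventually (\<lambda>s. V (x s) > E - \<kappa>') (at_right 0)"
      by (rule order_tendstoD) (use pos' in simp)
  qed
  then obtain B1 where B1: "B1 > 0" "\<And>s. 0 < s \<Longrightarrow> s < B1 \<Longrightarrow> x s \<in> cdom c \<and> dist (cmap c (x s)) ?y0 < \<rho>' \<and> V (x s) > E - \<kappa>'"
    unfolding eventually_at_right_field by blast
  define s1 where "s1 = min B1 B / 2"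
  have s1: "0 < s1" "s1 < B" "s1 < B1" using B1(1) B by (auto simp: s1_def)
  have near: "x s \<in> cdom c" "dist (cmap c (x s)) ?y0 < \<rho>'" "V (x s) > E - \<kappa>'" "V (x s) < E" if "0 < s" "s \<le> s1" for s
    using B1(2)[of s] jsol_onD(4)[OF x, of s] that s1 by (auto simp: jsol_at_def)
  \<comment> \<open>Newton's equation is started at the point with parameter s1, with the velocity rescaled so that the energy is E.\<close>
  define y1 v1 k1 where "y1 = cmap c (x s1)" and "v1 = velocity x s1 c" and "k1 = E - V (x s1)"
  define u1 where "u1 = (k1 / L) *\<^sub>R v1"
  have x1: "x s1 \<in> cdom c" and y1: "y1 \<in> cimg c" "cinv c y1 = x s1"
    using near(1)[of s1] s1 cmap_in[OF chart[OF c]] cinv_cmap[OF chart[OF c]] by (auto simp: y1_def)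
  have k1: "k1 > 0" "k1 < \<kappa>'" using near(3,4)[of s1] s1(1) by (auto simp: k1_def)
  have gu: "g c y1 u1 u1 = 2 * k1"
  proof -
    have "jconst x c s1 = l" by (rule jc) (use s1 x1 in auto)
    then have j: "k1 / 2 * g c y1 v1 v1 = l"
      using cinv_cmap[OF chart[OF c] x1] by (simp add: jconst_def y1_def v1_def k1_def)
    have "g c y1 u1 u1 = (k1 / L) * ((k1 / L) * g c y1 v1 v1)"
      unfolding u1_def using bilinear_lmul[OF metric_bilinear[OF c y1(1)]] bilinear_rmul[OF metric_bilinear[OF c y1(1)]] by simp
    also have "\<dots> = 2 * k1 / (L * L) * (k1 / 2 * g c y1 v1 v1)" by (simp add: field_simps)
    also have "\<dots> = 2 * k1" using L l by (simp only: j) simp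
    finally show ?thesis .
  qed
  let ?w1 = "(y1, u1, 0) :: 'e \<times> 'e \<times> real"
  have w1: "?w1 \<in> ball (rest ?y0) r"
  proof -
    have d: "dist y1 ?y0 < \<rho>'" using near(2)[of s1] s1(1) by (simp add: y1_def)
    then have "y1 \<in> cball ?y0 \<rho>" by (simp add: \<rho>'_def dist_commute)
    from mu(4)[OF this, of u1] have "\<mu> * (norm u1)\<^sup>2 < \<mu> * (r / 2)\<^sup>2"
      using gu k1(2) by (simp add: \<kappa>'_def)
    then have "(norm u1)\<^sup>2 < (r / 2)\<^sup>2" using mu(2) by simp
    then have u: "norm u1 < r / 2" by (rule power2_less_imp_less) (use r in simp)
    have "dist (rest ?y0) ?w1 \<le> dist ?y0 y1 + dist (0::'e, 0::real) (u1, 0)"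
      by (simp add: dist_Pair_Pair sqrt_sum_squares_le_sum)
    also have "dist (0::'e, 0::real) (u1, 0) = norm u1" by (simp add: dist_Pair_Pair)
    finally show ?thesis using u d by (simp add: \<rho>'_def dist_commute)
  qed
  define w where "w t = \<phi> t ?w1" for t
  have w0: "w 0 = ?w1" unfolding w_def by (rule bflowD(8)[OF b w1])
  have n: "nsol c w {-T<..<T}" unfolding w_def by (rule bflowD(9)[OF b w1])
  define k where "k t = E - Vc c (fst (w t))" for t
  have Dk: "(k has_real_derivative accel c (w t)) (at t)" if "t \<in> {-T<..<T}" for t
    unfolding k_def w_def by (rule bflow_kinetic_derivative[OF b w1 that])
  have en: "energy c (w t) = E" if "t \<in> {-T<..<T}" for t
  proof -
    have "energy c ?w1 = E" using gu y1(2) by (simp add: energy_def k1_def diff_divide_distrib)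
    then show ?thesis using bflow_energy[OF b w1 that] by (simp add: w_def)
  qed
  have k0: "k 0 = k1" by (simp add: k_def w0 y1(2) k1_def)
  have knn: "k t \<ge> 0" if t: "t \<in> {-T<..<T}" for t
  proof -
    have "g c (fst (w t)) (fst (snd (w t))) (fst (snd (w t))) \<ge> 0"
      using metric_pos[OF c nsolD(1)[OF n t]] bilinear_lzero[OF metric_bilinear[OF c nsolD(1)[OF n t]]]
      by (metis less_eq_real_def)
    then show ?thesis using en[OF t] by (simp add: energy_def k_def)
  qed
  define s where "s t = s1 + snd (snd (w t)) / sqrt l" for t
  have s0: "s 0 = s1" by (simp add: s_def w0)
  have Ds: "(s has_real_derivative k t / L) (at t)" if "t \<in> {-T<..<T}" for t
    using DERIV_add[OF DERIV_const[of s1] DERIV_cdivide[OF nsolD(4)[OF n that], of "sqrt l"]]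
    by (simp add: s_def[abs_def] k_def L_def)
  have smono: "s a \<le> s q" if "-T < a" "a \<le> q" "q < T" for a q
  proof (rule DERIV_nonneg_imp_nondecreasing[OF that(2)])
    fix t assume "a \<le> t" "t \<le> q"
    then have "t \<in> {-T<..<T}" using that by auto
    then show "\<exists>y. (s has_real_derivative y) (at t) \<and> 0 \<le> y" using Ds knn L by (metis divide_nonneg_pos)
  qed
  have ck: "continuous_on {-T<..<T} k" and cs: "continuous_on {-T<..<T} s"
    by (intro continuous_at_imp_continuous_on ballI DERIV_isCont[OF Dk] DERIV_isCont[OF Ds], assumption)+
  \<comment> \<open>As long as it stays inside and has positive parameter, the motion runs along the geodesic.\<close>
  have follow: "x (s q) = cinv c (fst (w q))"
    if t: "-T < t" "t \<le> 0" and good: "\<And>q. t \<le> q \<Longrightarrow> q \<le> 0 \<Longrightarrow> k q > 0 \<and> s q > 0" and q: "t \<le> q" "q \<le> 0" for t q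
  proof -
    have "open ({-T<..<T} \<inter> k -` {0<..})"
      by (rule continuous_open_preimage[OF ck]) auto
    moreover have "t \<in> {-T<..<T} \<inter> k -` {0<..}" "0 \<in> {-T<..<T} \<inter> k -` {0<..}"
      using t good[of t] good[of 0] T by auto
    ultimately obtain e1 e2 where e: "e1 > 0" "ball t e1 \<subseteq> {-T<..<T} \<inter> k -` {0<..}"
      "e2 > 0" "ball 0 e2 \<subseteq> {-T<..<T} \<inter> k -` {0<..}"
      by (meson openE)
    define K where "K = {t - e1<..<e2}"
    have K: "open K" "is_interval K" "0 \<in> K" "q \<in> K" using e t q by (auto simp: K_def)
    have KT: "a \<in> {-T<..<T} \<and> k a > 0" if "a \<in> K" for a
    proof (cases "t \<le> a \<and> a \<le> 0")
      case True
      then show ?thesis using good[of a] t T by auto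
    next
      case False
      then have "a \<in> ball t e1 \<or> a \<in> ball 0 e2"
        using that t by (auto simp: K_def dist_real_def)
      then show ?thesis using e by auto
    qed
    have nK: "nsol c w K" using n KT unfolding nsol_def by blast
    have "\<exists>X. jsol_on X (s ` K) \<and> (\<forall>t\<in>K. X (s t) = cinv c (fst (w t)) \<and> X (s t) \<in> cdom c \<and> jconst X c (s t) = l \<and>
       state X c (s t) = (fst (w t), (sqrt l / (E - Vc c (fst (w t)))) *\<^sub>R fst (snd (w t))))"
      unfolding s_def by (rule newton_to_jacobi[OF c K(1,2) nK _ _ l]) (use en KT in \<open>auto simp: k_def\<close>)
    then obtain X where X: "jsol_on X (s ` K)" "\<And>t. t \<in> K \<Longrightarrow> X (s t) = cinv c (fst (w t)) \<and> X (s t) \<in> cdom c \<and>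
       state X c (s t) = (fst (w t), (sqrt l / (E - Vc c (fst (w t)))) *\<^sub>R fst (snd (w t)))" by blast
    have st: "state X c s1 = state x c s1"
    proof -
      have "state X c s1 = (y1, (L / k1) *\<^sub>R u1)" using X(2)[OF K(3)] k0 by (simp add: s0 w0 L_def k_def)
      also have "(L / k1) *\<^sub>R u1 = v1" using k1(1) L(1) by (simp add: u1_def)
      finally show ?thesis by (simp add: state_def y1_def v1_def)
    qed
    have "X (s q) = x (s q)"
    proof (rule jsol_agree[OF X(1) x _ _ c _ x1 st])
      show "s1 \<in> s ` K" using K(3) s0 by (metis imageI)
      show "s1 \<in> {0<..<B}" using s1 by simp
      show "X s1 \<in> cdom c" using X(2)[OF K(3)] unfolding s0 by blast
      show "s q \<in> s ` K" using K(4) by simp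
      show "s q \<in> {0<..<B}" using good[OF q] smono[of q 0] q t T s0 s1 by simp
    qed
    then show ?thesis using X(2)[OF K(4)] by simp
  qed
  \<comment> \<open>The times at which the motion is at the boundary or its parameter is not positive; ts will be the last one.\<close>
  let ?Bad = "{t \<in> {-\<tau>..0}. min (k t) (s t) \<le> 0}"
  have sub: "{-\<tau>..0} \<subseteq> {-T<..<T}" using \<tau> T by auto
  have "closed ?Bad"
  proof -
    have "continuous_on {-\<tau>..0} (\<lambda>t. min (k t) (s t))"
      by (intro continuous_on_min continuous_on_subset[OF ck sub] continuous_on_subset[OF cs sub])
    then have "closed ({-\<tau>..0} \<inter> (\<lambda>t. min (k t) (s t)) -` {..0})"
      by (rule continuous_closed_preimage) auto
    then show ?thesis by (simp add: Int_def vimage_def)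
  qed
  then have "compact ({-\<tau>..0} \<inter> ?Bad)" by (rule compact_Int_closed[OF compact_Icc])
  moreover have "{-\<tau>..0} \<inter> ?Bad = ?Bad" by auto
  ultimately have "compact ?Bad" by (simp only:)
  moreover have "?Bad \<noteq> {}"
  proof
    assume empty: "?Bad = {}"
    have good: "k q > 0 \<and> s q > 0" if "-\<tau> \<le> q" "q \<le> 0" for q
    proof -
      have "q \<notin> ?Bad" using empty by blast
      then show ?thesis using that by auto
    qed
    have kq: "k q < \<kappa>" if q: "-\<tau> \<le> q" "q \<le> 0" for q
    proof -
      have "x (s q) = cinv c (fst (w q))" by (rule follow[of "-\<tau>" q]) (use \<tau> good q in auto)
      moreover have "s q \<le> s1" using smono[of q 0] q \<tau> T s0 by simp
      ultimately show ?thesis using near(3)[of "s q"] good[OF q] by (simp add: k_def \<kappa>'_def)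
    qed
    have "k (- \<tau>) \<ge> k (- \<tau> / 2) + m * \<tau>\<^sup>2 / 8 \<or> k 0 \<ge> k (- \<tau> / 2) + m * \<tau>\<^sup>2 / 8"
      by (rule strictly_convex_endpoint[OF \<tau>(1), where h="\<lambda>t. accel c (w t)"])
         (use Dk sub bflowD(10)[OF b w1] in \<open>auto simp: w_def[symmetric]\<close>)
    then show False using kq[of "-\<tau>"] kq[of 0] good[of "-\<tau> / 2"] \<tau> by (auto simp: \<kappa>_def)
  qed
  ultimately obtain ts where ts: "ts \<in> ?Bad" "\<And>t. t \<in> ?Bad \<Longrightarrow> t \<le> ts"
    using compact_attains_sup[of ?Bad] by blast
  have ts0: "-\<tau> \<le> ts" "ts < 0"
  proof -
    show "-\<tau> \<le> ts" using ts(1) by simp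
    have "ts \<noteq> 0" using ts(1) k0 k1(1) s0 s1(1) by auto
    then show "ts < 0" using ts(1) by auto
  qed
  have tsT: "ts \<in> {-T<..<T}" using ts0 \<tau> T by auto
  have good: "k q > 0 \<and> s q > 0" if "ts < q" "q \<le> 0" for q
  proof -
    have "q \<notin> ?Bad" using ts(2)[of q] that by auto
    then show ?thesis using that ts0 by auto
  qed
  have fol: "x (s q) = cinv c (fst (w q))" if "ts < q" "q \<le> 0" for q
    by (rule follow[of q q]) (use that good ts0 \<tau> in auto)
  have ctn: "isCont s ts" "isCont k ts" by (rule DERIV_isCont[OF Ds[OF tsT]] DERIV_isCont[OF Dk[OF tsT]])+
  have evt: "eventually (\<lambda>q. ts < q \<and> q \<le> 0) (at_right ts)"
    unfolding eventually_at_right_field using ts0 by (intro exI[of _ 0]) auto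
  have sts: "(s \<longlongrightarrow> s ts) (at_right ts)"
    using ctn(1) unfolding isCont_def by (rule filterlim_mono) (auto simp: at_le)
  have sge: "s ts \<ge> 0"
    by (rule tendsto_lowerbound[OF sts]) (use evt good in \<open>auto elim!: eventually_mono simp: less_imp_le\<close>)
  have wts: "fst (w ts) \<in> cimg c" by (rule nsolD(1)[OF n tsT])
  have limw: "((\<lambda>q. cinv c (fst (w q))) \<longlongrightarrow> cinv c (fst (w ts))) (at_right ts)"
  proof -
    have "isCont (\<lambda>q. fst (w q)) ts" by (rule has_vector_derivative_continuous[OF nsolD(2)[OF n tsT]])
    moreover have "isCont (cinv c) (fst (w ts))"
      using continuous_on_cinv[OF chart[OF c]] chart_open(2)[OF chart[OF c]] wts continuous_on_eq_continuous_at by blast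
    ultimately have "isCont (\<lambda>q. cinv c (fst (w q))) ts" by (rule isCont_o2)
    then show ?thesis unfolding isCont_def by (rule filterlim_mono) (auto simp: at_le)
  qed
  have limx: "((\<lambda>q. x (s q)) \<longlongrightarrow> cinv c (fst (w ts))) (at_right ts)"
    using limw by (rule Lim_transform_eventually) (use evt fol in \<open>auto elim!: eventually_mono\<close>)
  have sz: "s ts = 0"
  proof (rule ccontr)
    assume "s ts \<noteq> 0"
    then have sp: "s ts > 0" using sge by simp
    have kz: "k ts = 0" using ts(1) sp knn[OF tsT] by auto
    have sB: "s ts \<in> {0<..<B}" using sp smono[of ts 0] tsT T ts0 s0 s1 by simp
    have "isCont x (s ts)"
      using jsol_onD(1,3)[OF x] sB continuous_on_eq_continuous_at by blast
    from isCont_tendsto_compose[OF this sts]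
    have "x (s ts) = cinv c (fst (w ts))"
      using limx tendsto_unique[OF trivial_limit_at_right_real] by blast
    then have "V (x (s ts)) = E" using kz by (simp add: k_def)
    then show False using jsol_onD(4)[OF x sB] by (simp add: jsol_at_def)
  qed
  have Pts: "cinv c (fst (w ts)) = P"
  proof -
    have "eventually (\<lambda>q. s q \<in> {0<..} \<and> s q \<noteq> 0) (at_right ts)"
      by (rule eventually_mono[OF evt]) (use good in force)
    then have "filterlim s (at_right 0) (at_right ts)"
      unfolding filterlim_at using sts unfolding sz by blast
    from filterlim_compose[OF lim this] have "((\<lambda>q. x (s q)) \<longlongrightarrow> P) (at_right ts)" .
    then show ?thesis using limx tendsto_unique[OF trivial_limit_at_right_real] by blast
  qed
  have wy: "fst (w ts) = ?y0" using Pts cmap_cinv[OF chart[OF c] wts] by simp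
  have "k ts = 0" using Pts P(2) by (simp add: k_def)
  then have "g c (fst (w ts)) (fst (snd (w ts))) (fst (snd (w ts))) = 0"
    using en[OF tsT] by (simp add: energy_def k_def)
  then have wv: "fst (snd (w ts)) = 0" using metric_pos[OF c wts] by fastforce
  let ?w0 = "rest ?y0"
  have w0b: "?w0 \<in> ball ?w0 r" using r by simp
  define \<sigma> where "\<sigma> = snd (snd (w ts))"
  have wts': "w ts = (?y0, 0, \<sigma>)" using wy wv by (simp add: \<sigma>_def prod_eq_iff)
  \<comment> \<open>Shifted in time and action, the motion starts at rest at the boundary point.\<close>
  define z where "z t = w (t + ts) - (0, 0, \<sigma>)" for t
  let ?J = "{-T<..<T} \<inter> {- T - ts<..<T - ts}"
  have zsol: "z t \<in> cimg c \<times> UNIV \<and> (z has_vector_derivative nfield c (z t)) (at t)" if t: "t \<in> ?J" for t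
  proof -
    have tt: "t + ts \<in> {-T<..<T}" using t by auto
    have "(w has_vector_derivative nfield c (w (t + ts))) (at (t + ts))"
      using n tt unfolding nsol_def by blast
    then have "((\<lambda>t. w (t + ts)) has_derivative (\<lambda>h. h *\<^sub>R nfield c (w (t + ts)))) (at t)"
      unfolding has_vector_derivative_def
      by (intro has_derivative_compose[where f="\<lambda>t. t + ts" and f'="\<lambda>h. h" and g=w]) (auto intro!: derivative_eq_intros)
    then have "((\<lambda>t. w (t + ts) - (0, 0, \<sigma>)) has_vector_derivative nfield c (w (t + ts))) (at t)"
      unfolding has_vector_derivative_def by (auto intro!: derivative_eq_intros)
    moreover have "nfield c (w (t + ts)) = nfield c (z t)" by (simp add: nfield_def z_def)
    moreover have "fst (z t) \<in> cimg c" using nsolD(1)[OF n tt] by (simp add: z_def)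
    ultimately show ?thesis unfolding z_def[abs_def] by (simp add: mem_Times_iff)
  qed
  have qsol: "\<phi> t ?w0 \<in> cimg c \<times> UNIV \<and> ((\<lambda>t. \<phi> t ?w0) has_vector_derivative nfield c (\<phi> t ?w0)) (at t)" if "t \<in> ?J" for t
    using bflowD(9)[OF b w0b] that unfolding nsol_def by (auto simp: mem_Times_iff)
  have eqz: "\<phi> t ?w0 = z t" if t: "t \<in> ?J" for t
  proof (rule ode_unique[OF nfield_C1[OF c] _ _ _ _ qsol zsol _ t, where ?t0.0 = 0])
    show "open (cimg c \<times> (UNIV :: ('e \<times> real) set))" by (intro open_Times chart_open(2) chart c open_UNIV)
    show "0 \<in> ?J" using T tsT by auto
    show "\<phi> 0 ?w0 = z 0" using bflowD(8)[OF b w0b] wts' by (simp add: z_def zero_prod_def)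
    show "connected ?J" by (simp add: Int_greaterThanLessThan)
  qed auto
  have main: "snd (snd (\<phi> t ?w0)) / sqrt l = s (t + ts)" "fst (\<phi> t ?w0) = fst (w (t + ts))" if t: "0 < t" "t < - ts" for t
  proof -
    have J: "t \<in> ?J" using t ts0 \<tau> T by auto
    show "fst (\<phi> t ?w0) = fst (w (t + ts))" by (simp add: eqz[OF J] z_def)
    have "s1 = - \<sigma> / sqrt l" using sz by (simp add: s_def \<sigma>_def)
    then show "snd (snd (\<phi> t ?w0)) / sqrt l = s (t + ts)"
      by (simp add: eqz[OF J] z_def s_def diff_divide_distrib)
  qed
  show ?thesis
  proof (intro exI[of _ "- ts"] conjI ballI)
    show "0 < - ts" "- ts < T" using ts0 \<tau> by auto
    fix t assume t: "t \<in> {0<..<- ts}"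
    have tt: "ts < t + ts" "t + ts \<le> 0" using t by auto
    show "snd (snd (\<phi> t ?w0)) / sqrt l < B"
      using main(1)[of t] t smono[of "t + ts" 0] tt tsT T s0 s1 by simp
    show "x (snd (snd (\<phi> t ?w0)) / sqrt l) = cinv c (fst (\<phi> t ?w0))"
      using main[of t] t fol[OF tt] by simp
  qed
qed

subsection \<open>The geodesic with given boundary point and constant\<close>

lemma geodesic_from_boundaryD:
  assumes "geodesic_from_boundary A g V E P l \<gamma>"
  shows "jsol_on (the \<circ> \<gamma>) (dom \<gamma>)" "\<exists>B>0. {0<..<B} \<subseteq> dom \<gamma>" "((the \<circ> \<gamma>) \<longlongrightarrow> P) (at_right 0)"
    "\<And>s c. s \<in> dom \<gamma> \<Longrightarrow> c \<in> A \<Longrightarrow> (the \<circ> \<gamma>) s \<in> cdom c \<Longrightarrow> jconst (the \<circ> \<gamma>) c s = l"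
    "\<And>s. s \<in> dom \<gamma> \<Longrightarrow> {0<..s} \<subseteq> dom \<gamma> \<and> s > 0"
proof -
  note G = assms[unfolded geodesic_from_boundary_def jacobi_geodesic_iff has_jacobi_constant_iff]
  obtain b :: ereal where b: "0 < b" "dom \<gamma> = {s. 0 < s \<and> ereal s < b}" using G by blast
  show "jsol_on (the \<circ> \<gamma>) (dom \<gamma>)" "((the \<circ> \<gamma>) \<longlongrightarrow> P) (at_right 0)" using G by blast+
  show "\<And>s c. s \<in> dom \<gamma> \<Longrightarrow> c \<in> A \<Longrightarrow> (the \<circ> \<gamma>) s \<in> cdom c \<Longrightarrow> jconst (the \<circ> \<gamma>) c s = l" using G by blast
  show "\<And>s. s \<in> dom \<gamma> \<Longrightarrow> {0<..s} \<subseteq> dom \<gamma> \<and> s > 0"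
    unfolding b(2) by (auto intro: le_less_trans[of "ereal _" "ereal _" b])
  obtain B where B: "ereal 0 < B" "B < b" using dense[of "ereal 0" b] b(1) by (auto simp: zero_ereal_def)
  then obtain B' where B': "B = ereal B'" by (cases B) auto
  have "{0<..<B'} \<subseteq> dom \<gamma>"
    unfolding b(2) using B(2) by (auto simp: B' intro: less_trans[of "ereal _" "ereal B'" b])
  then show "\<exists>B>0. {0<..<B} \<subseteq> dom \<gamma>" using B(1) B' by auto
qed

lemma geodesic_from_boundaryI:
  assumes x: "jsol_on x {0<..<B}" and B: "B > 0" and lim: "(x \<longlongrightarrow> P) (at_right 0)"
    and jc: "s0 \<in> {0<..<B}" "c \<in> A" "x s0 \<in> cdom c" "jconst x c s0 = l"
  defines "\<gamma> \<equiv> \<lambda>s. if 0 < s \<and> s < B then Some (x s) else None"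
  shows "geodesic_from_boundary A g V E P l \<gamma>"
proof -
  have d: "dom \<gamma> = {0<..<B}" by (auto simp: \<gamma>_def dom_def)
  have e: "(the \<circ> \<gamma>) s = x s" if "s \<in> {0<..<B}" for s using that by (simp add: \<gamma>_def)
  have "jsol_on (the \<circ> \<gamma>) (dom \<gamma>)" unfolding d by (rule jsol_on_cong[OF x]) (rule e[symmetric])
  moreover have "dom \<gamma> = {s. 0 < s \<and> ereal s < ereal B}" by (auto simp: d)
  moreover have "((the \<circ> \<gamma>) \<longlongrightarrow> P) (at_right 0)"
  proof (rule Lim_transform_eventually[OF lim])
    show "eventually (\<lambda>s. x s = (the \<circ> \<gamma>) s) (at_right 0)"
      unfolding eventually_at_right_field
    proof (intro exI[of _ B] conjI allI impI)
      fix s assume "0 < s" "s < B"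
      then show "x s = (the \<circ> \<gamma>) s" using e[of s] by simp
    qed (rule B)
  qed
  moreover have "jconst (the \<circ> \<gamma>) a s = l" if "s \<in> dom \<gamma>" "a \<in> A" "(the \<circ> \<gamma>) s \<in> cdom a" for s a
  proof -
    have s: "s \<in> {0<..<B}" using that(1) d by simp
    have "jconst (the \<circ> \<gamma>) a s = jconst x a s"
      by (rule jconst_cong[OF open_greaterThanLessThan s]) (rule e)
    also have "\<dots> = jconst x c s0"
      by (rule jconst_constant[OF x s that(2) _ jc(1-3)]) (use that(3) e[OF s] in simp)
    finally show ?thesis using jc(4) by simp
  qed
  ultimately show ?thesis
    unfolding geodesic_from_boundary_def jacobi_geodesic_iff has_jacobi_constant_iff using B
    by (metis ereal_less(2))
qed

lemma ex_geodesic_from_boundary: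
  assumes P: "V P = E" and l: "l > 0"
  shows "\<exists>\<gamma>. geodesic_from_boundary A g V E P l \<gamma>"
proof -
  obtain c where c: "c \<in> A" "P \<in> cdom c" using ex_chart by blast
  obtain T r m \<phi> where b: "bflow c P T r m \<phi>" using ex_bflow[OF c P] by blast
  have w: "rest (cmap c P) \<in> ball (rest (cmap c P)) r" using bflowD(5)[OF b] by simp
  have y: "Vc c (cmap c P) = E" using cinv_cmap[OF chart[OF c(1)] c(2)] P by simp
  define s where "s t = snd (snd (\<phi> t (rest (cmap c P)))) / sqrt l" for t
  obtain x where x: "jsol_on x (s ` {0<..<T})" "(x \<longlongrightarrow> cinv c (cmap c P)) (at_right 0)"
    "\<And>t. t \<in> {0<..<T} \<Longrightarrow> s t > 0 \<and> {0<..s t} \<subseteq> s ` {0<..<T} \<and> x (s t) \<in> cdom c \<and> jconst x c (s t) = l"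
    unfolding s_def by (rule boundary_curve[OF b w y l]) blast
  have T: "T / 2 \<in> {0<..<T}" using bflowD(4)[OF b] by simp
  define B where "B = s (T / 2)"
  have B: "B > 0" "{0<..B} \<subseteq> s ` {0<..<T}" using x(3)[OF T] by (auto simp: B_def)
  have sub: "{0<..<B} \<subseteq> s ` {0<..<T}" using B(2) by auto
  then have "B / 2 \<in> s ` {0<..<T}" using subsetD[OF sub, of "B / 2"] B(1) by simp
  then obtain t where t: "t \<in> {0<..<T}" "B / 2 = s t" by blast
  have lim: "(x \<longlongrightarrow> P) (at_right 0)" using x(2) cinv_cmap[OF chart[OF c(1)] c(2)] by simp
  have "jsol_on x {0<..<B}" by (rule jsol_on_subset[OF x(1) sub]) (auto simp: is_interval_oo)
  from geodesic_from_boundaryI[OF this B(1) lim, of "B / 2" c l] show ?thesis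
    using x(3)[OF t(1)] B(1) c(1) unfolding t(2)[symmetric] by auto
qed

text \<open>Near 0 both geodesics are the same reparameterized motion, and they agree from there on by
  uniqueness in the interior.\<close>

lemma geodesic_from_boundary_compatible:
  assumes P: "V P = E" and l: "l > 0"
  shows "compatible {\<gamma>. geodesic_from_boundary A g V E P l \<gamma>}"
  unfolding compatible_def
proof (intro ballI allI impI)
  fix \<gamma> \<eta> s assume gh: "\<gamma> \<in> {\<gamma>. geodesic_from_boundary A g V E P l \<gamma>}" "\<eta> \<in> {\<gamma>. geodesic_from_boundary A g V E P l \<gamma>}"
    and s: "s \<in> dom \<gamma>" "s \<in> dom \<eta>"
  obtain c where c: "c \<in> A" "P \<in> cdom c" using ex_chart by blast
  obtain T r m \<phi> where b: "bflow c P T r m \<phi>" using ex_bflow[OF c P] by blast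
  let ?q = "\<lambda>t. \<phi> t (rest (cmap c P))"
  have germ: "\<exists>e>0. e < T \<and> (\<forall>t\<in>{0<..<e}. snd (snd (?q t)) / sqrt l \<in> dom \<gamma> \<and>
     (the \<circ> \<gamma>) (snd (snd (?q t)) / sqrt l) = cinv c (fst (?q t)))"
    if "geodesic_from_boundary A g V E P l \<gamma>" for \<gamma>
  proof -
    note G = geodesic_from_boundaryD[OF that]
    obtain B where B: "B > 0" "{0<..<B} \<subseteq> dom \<gamma>" using G(2) by blast
    have J: "jsol_on (the \<circ> \<gamma>) {0<..<B}" by (rule jsol_on_subset[OF G(1) B(2)]) (auto simp: is_interval_oo)
    have "\<exists>e>0. e < T \<and> (\<forall>t\<in>{0<..<e}. snd (snd (?q t)) / sqrt l < B \<and> (the \<circ> \<gamma>) (snd (snd (?q t)) / sqrt l) = cinv c (fst (?q t)))"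
      by (rule boundary_unique[OF b J B(1) G(3) l]) (use G(4)[OF _ c(1)] B(2) in blast)
    then obtain e where e: "e > 0" "e < T" "\<forall>t\<in>{0<..<e}. snd (snd (?q t)) / sqrt l < B \<and> (the \<circ> \<gamma>) (snd (snd (?q t)) / sqrt l) = cinv c (fst (?q t))"
      by blast
    have "snd (snd (?q t)) / sqrt l \<in> dom \<gamma>" if t: "t \<in> {0<..<e}" for t
    proof -
      have "snd (snd (?q t)) > 0"
        by (rule bflow_positive(2)[OF b]) (use bflowD(5)[OF b] cinv_cmap[OF chart[OF c(1)] c(2)] P t e(2) in auto)
      then show ?thesis using e(3) t l B(2) by (auto simp: subset_iff)
    qed
    then show ?thesis using e by blast
  qed
  obtain e1 where e1: "e1 > 0" "e1 < T" "\<forall>t\<in>{0<..<e1}. snd (snd (?q t)) / sqrt l \<in> dom \<gamma> \<and>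
     (the \<circ> \<gamma>) (snd (snd (?q t)) / sqrt l) = cinv c (fst (?q t))"
    using germ[of \<gamma>] gh(1) by blast
  obtain e2 where e2: "e2 > 0" "e2 < T" "\<forall>t\<in>{0<..<e2}. snd (snd (?q t)) / sqrt l \<in> dom \<eta> \<and>
     (the \<circ> \<eta>) (snd (snd (?q t)) / sqrt l) = cinv c (fst (?q t))"
    using germ[of \<eta>] gh(2) by blast
  define t where "t = min e1 e2 / 2"
  have t: "t \<in> {0<..<e1}" "t \<in> {0<..<e2}" "t \<in> {0<..<T}" using e1 e2 by (auto simp: t_def)
  define B where "B = snd (snd (?q t)) / sqrt l"
  have w: "rest (cmap c P) \<in> ball (rest (cmap c P)) r" using bflowD(5)[OF b] by simp
  have y: "Vc c (cmap c P) = E" using cinv_cmap[OF chart[OF c(1)] c(2)] P by simp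
  have B: "B > 0" using bflow_positive(2)[OF b w y t(3)] l by (simp add: B_def)
  have agree: "s \<in> dom \<gamma> \<and> s \<in> dom \<eta> \<and> (the \<circ> \<gamma>) s = (the \<circ> \<eta>) s" if sB: "s \<in> {0<..<B}" for s
  proof -
    obtain q where q: "0 < q" "q \<le> t" "s = snd (snd (?q q)) / sqrt l"
      using bflow_action_onto[OF b w t(3) _ _ l, of s] sB unfolding B_def by auto
    then have "q \<in> {0<..<e1}" "q \<in> {0<..<e2}" using t by auto
    then show ?thesis using e1(3) e2(3) q(3) by metis
  qed
  have B2: "B / 2 \<in> {0<..<B}" using B by simp
  obtain d where d: "d \<in> A" "(the \<circ> \<gamma>) (B / 2) \<in> cdom d" using ex_chart by blast
  have st: "state (the \<circ> \<gamma>) d (B / 2) = state (the \<circ> \<eta>) d (B / 2)"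
    by (rule state_cong[OF open_greaterThanLessThan B2]) (use agree in blast)
  have "(the \<circ> \<gamma>) s = (the \<circ> \<eta>) s"
    by (rule jsol_agree[OF geodesic_from_boundaryD(1) geodesic_from_boundaryD(1) _ _ d _ st s])
       (use gh agree[OF B2] d in auto)
  then show "\<gamma> s = \<eta> s" using s by auto
qed

lemma gamma_maximal:
  assumes P: "V P = E" and l: "l > 0"
  shows "geodesic_from_boundary A g V E P l (gamma A g V E P l)"
    and "\<And>\<gamma>. geodesic_from_boundary A g V E P l \<gamma> \<Longrightarrow> \<gamma> \<subseteq>\<^sub>m gamma A g V E P l"
proof -
  let ?C = "{\<gamma>. geodesic_from_boundary A g V E P l \<gamma>}"
  note comp = geodesic_from_boundary_compatible[OF P l]
  obtain \<gamma>0 where g0: "\<gamma>0 \<in> ?C" using ex_geodesic_from_boundary[OF P l] by blast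
  define \<beta> where "\<beta> \<gamma> = (SOME b::ereal. 0 < b \<and> dom \<gamma> = {s. 0 < s \<and> ereal s < b})" for \<gamma> :: "real \<rightharpoonup> 'm"
  have \<beta>: "0 < \<beta> \<gamma>" "dom \<gamma> = {s. 0 < s \<and> ereal s < \<beta> \<gamma>}" if "\<gamma> \<in> ?C" for \<gamma>
  proof -
    have "\<exists>b::ereal. 0 < b \<and> dom \<gamma> = {s. 0 < s \<and> ereal s < b}"
      using that by (simp add: geodesic_from_boundary_def)
    from someI_ex[OF this] show "0 < \<beta> \<gamma>" "dom \<gamma> = {s. 0 < s \<and> ereal s < \<beta> \<gamma>}" unfolding \<beta>_def by blast+
  qed
  define b where "b = (SUP \<gamma>\<in>?C. \<beta> \<gamma>)"
  have un: "(\<Union>\<gamma>\<in>?C. dom \<gamma>) = {s. 0 < s \<and> ereal s < b}"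
    using \<beta>(2) by (auto simp: b_def less_SUP_iff)
  have b0: "0 < b" unfolding b_def using \<beta>(1)[OF g0] g0 by (auto simp: less_SUP_iff)
  have "is_interval (\<Union>\<gamma>\<in>?C. dom \<gamma>)"
    unfolding un is_interval_1 by (auto intro: le_less_trans[of "ereal _" "ereal _" b])
  then have J: "jacobi_geodesic A g V E (join ?C)"
    by (intro join_jacobi_geodesic[OF comp]) (auto simp: geodesic_from_boundary_def)
  have jeq: "join ?C s = \<gamma> s" if "\<gamma> \<in> ?C" "s \<in> dom \<gamma>" for \<gamma> s by (rule join_eq[OF comp that])
  have lim: "((the \<circ> join ?C) \<longlongrightarrow> P) (at_right 0)"
  proof -
    note G = geodesic_from_boundaryD[OF g0[simplified]]
    obtain B where B: "B > 0" "{0<..<B} \<subseteq> dom \<gamma>0" using G(2) by blast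
    show ?thesis
    proof (rule Lim_transform_eventually[OF G(3)])
      have "(the \<circ> \<gamma>0) s = (the \<circ> join ?C) s" if "s \<in> {0<..<B}" for s
        using jeq[OF g0 subsetD[OF B(2) that]] by simp
      then show "eventually (\<lambda>s. (the \<circ> \<gamma>0) s = (the \<circ> join ?C) s) (at_right 0)"
        unfolding eventually_at_right_field using B(1) by (intro exI[of _ B]) simp
    qed
  qed
  have "jconst (the \<circ> join ?C) c s = l" if s: "s \<in> dom (join ?C)" and c: "c \<in> A" "(the \<circ> join ?C) s \<in> cdom c" for s c
  proof -
    obtain \<gamma> where \<gamma>: "\<gamma> \<in> ?C" "s \<in> dom \<gamma>" using s unfolding dom_join[OF comp] by blast
    note G = geodesic_from_boundaryD[OF \<gamma>(1)[simplified]]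
    have "jconst (the \<circ> join ?C) c s = jconst (the \<circ> \<gamma>) c s"
      by (rule jconst_cong[OF jsol_onD(1)[OF G(1)] \<gamma>(2)]) (simp add: jeq[OF \<gamma>(1)])
    also have "\<dots> = l" by (rule G(4)[OF \<gamma>(2) c(1)]) (use c(2) jeq[OF \<gamma>] in simp)
    finally show ?thesis .
  qed
  then have jc: "has_jacobi_constant A g V E (join ?C) l" by (simp add: has_jacobi_constant_iff)
  have "dom (join ?C) = {s. 0 < s \<and> ereal s < b}" by (simp only: dom_join[OF comp] un)
  then have Q: "geodesic_from_boundary A g V E P l (join ?C)"
    by (intro iffD2[OF geodesic_from_boundary_def] conjI exI[of _ b] J b0 lim jc)
  have "gamma A g V E P l = join ?C" unfolding gamma_def by (rule maximal_curve_join(1)[OF comp Q])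
  then show "geodesic_from_boundary A g V E P l (gamma A g V E P l)"
    and "\<And>\<gamma>. geodesic_from_boundary A g V E P l \<gamma> \<Longrightarrow> \<gamma> \<subseteq>\<^sub>m gamma A g V E P l"
    using Q maximal_curve_join(2)[OF comp Q] by simp_all
qed

end

section \<open>Slice charts of the level set\<close>

context boundary_setup
begin

text \<open>Replacing one coordinate, along which V has non-zero derivative, by V - E straightens the level set. 
  The inverse is of class C^2 because its derivative is an explicit expression in the derivative of V.\<close>

lemma ex_slice_chart:
  assumes P: "V P = E"
  shows "\<exists>d b c. slice_chart 2 A {Q. V Q = E} d b \<and> P \<in> cdom d \<and> c \<in> A \<and> cdom d \<subseteq> cdom c \<and>
     C1_on (\<lambda>y. cmap c (cinv d y)) (cimg d)"
proof -
  obtain c where c: "c \<in> A" "P \<in> cdom c" using ex_chart by blast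
  note ch = chart[OF c(1)]
  let ?y0 = "cmap c P"
  have y0: "?y0 \<in> cimg c" by (rule cmap_in[OF ch c(2)])
  have linV: "linear (dV c y)" if "y \<in> cimg c" for y
    using Vc_differentiable[OF c(1) that] by (rule linear_frechet_derivative)
  have "\<exists>b\<in>Basis. dV c ?y0 b \<noteq> 0"
  proof (rule ccontr)
    assume "\<not> (\<exists>b\<in>Basis. dV c ?y0 b \<noteq> 0)"
    then have "dV c ?y0 u = 0" for u
      using linear_sum[OF linV[OF y0], of "\<lambda>i. (u \<bullet> i) *\<^sub>R i" Basis] linear_cmul[OF linV[OF y0]]
      by (simp add: euclidean_representation)
    then show False using regular P c unfolding regular_value_def by blast
  qed
  then obtain b where b: "b \<in> Basis" "dV c ?y0 b \<noteq> 0" by blast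
  have bb: "b \<bullet> b = 1" using b(1) by simp
  \<comment> \<open>The coordinate in the direction b is replaced by V - E.\<close>
  define \<psi> where "\<psi> y = y + (Vc c y - E - y \<bullet> b) *\<^sub>R b" for y
  define D where "D y h = h + (dV c y h - h \<bullet> b) *\<^sub>R b" for y h
  have D\<psi>: "(\<psi> has_derivative D y) (at y)" if "y \<in> cimg c" for y
  proof -
    have "(Vc c has_derivative dV c y) (at y)"
      using Vc_differentiable[OF c(1) that] by (simp add: frechet_derivative_works)
    then have "((\<lambda>y. y + (Vc c y - E - y \<bullet> b) *\<^sub>R b) has_derivative (\<lambda>h. h + (dV c y h - 0 - h \<bullet> b) *\<^sub>R b)) (at y)"
      by (intro has_derivative_add has_derivative_ident has_derivative_scaleR_left has_derivative_diff
          has_derivative_const has_derivative_inner_left)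
    then show ?thesis unfolding \<psi>_def[abs_def] D_def[abs_def] by simp
  qed
  have C1V: "C1_on (\<lambda>y. dV c (p y) (w y)) S" if "C1_on p S" "C1_on w S" "p ` S \<subseteq> cimg c" "open S" for p w and S :: "'e set"
    by (rule C1_on_frechet_derivative[OF Vc_C2[OF c(1)] chart_open(2)[OF ch] that])
  have f\<psi>: "frechet_derivative \<psi> (at y) = D y" if "y \<in> cimg c" for y
    using frechet_derivative_at[OF D\<psi>[OF that]] by simp
  have C2\<psi>: "Ck_on (Suc (Suc 0)) \<psi> (cimg c)"
    unfolding C2_iff
  proof (intro conjI ballI allI)
    show "\<psi> differentiable (at y)" if "y \<in> cimg c" for y using D\<psi>[OF that] by (auto simp: differentiable_def)
    show "C1_on (\<lambda>y. frechet_derivative \<psi> (at y) v) (cimg c)" for v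
    proof (rule C1_on_cong[OF _ chart_open(2)[OF ch]])
      show "C1_on (\<lambda>y. D y v) (cimg c)"
        unfolding D_def by (intro C1_intros C1V chart_open(2)[OF ch]) auto
    qed (simp add: f\<psi>)
  qed
  define U where "U = cimg c \<inter> (\<lambda>y. dV c y b) -` (- {0})"
  have U: "open U" "?y0 \<in> U"
  proof -
    have "C1_on (\<lambda>y. dV c y b) (cimg c)" by (intro C1V C1_intros chart_open(2)[OF ch]) auto
    then show "open U" unfolding U_def
      by (intro continuous_open_preimage C1_on_continuous_on chart_open(2)[OF ch]) auto
    show "?y0 \<in> U" using y0 b(2) by (simp add: U_def)
  qed
  have U_c: "U \<subseteq> cimg c" by (auto simp: U_def)
  have inj: "h = 0" if "D ?y0 h = 0" for h
  proof -
    have h: "h = (h \<bullet> b - dV c ?y0 h) *\<^sub>R b"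
    proof -
      have "h + (dV c ?y0 h - h \<bullet> b) *\<^sub>R b = 0" using that by (simp add: D_def)
      then have "h = - ((dV c ?y0 h - h \<bullet> b) *\<^sub>R b)" by (simp only: eq_neg_iff_add_eq_0)
      then show ?thesis by (simp add: algebra_simps)
    qed
    define t where "t = h \<bullet> b - dV c ?y0 h"
    have ht: "h = t *\<^sub>R b" using h by (simp add: t_def)
    have "dV c ?y0 h = t * dV c ?y0 b" unfolding ht using linear_cmul[OF linV[OF y0]] by simp
    moreover have "h \<bullet> b = t" unfolding ht by (simp add: bb)
    ultimately have "t * dV c ?y0 b = 0" using t_def by linarith
    then show ?thesis using b(2) ht by simp
  qed
  obtain U' W gi where I: "open U'" "U' \<subseteq> U" "?y0 \<in> U'" "open W" "\<psi> ?y0 \<in> W" "homeomorphism U' W \<psi> gi" "C1_on gi W"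
    by (rule C1_inverse_function[OF C1_on_subset[OF C2_imp_C1[OF C2\<psi>] U_c] U D\<psi>[OF y0] inj]) (assumption | rule that)+
  have h: "\<And>y. y \<in> U' \<Longrightarrow> \<psi> y \<in> W \<and> gi (\<psi> y) = y" "\<And>z. z \<in> W \<Longrightarrow> gi z \<in> U' \<and> \<psi> (gi z) = z"
    using I(6) unfolding homeomorphism_def by blast+
  have U'c: "U' \<subseteq> cimg c" using I(2) U_c by blast
  have giU: "gi ` W \<subseteq> cimg c" using h(2) U'c by blast
  have Dgi: "frechet_derivative gi (at z) k = (k - (k \<bullet> b) *\<^sub>R b) +
      ((k \<bullet> b - dV c (gi z) (k - (k \<bullet> b) *\<^sub>R b)) / dV c (gi z) b) *\<^sub>R b" if z: "z \<in> W" for z k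
  proof -
    let ?x = "gi z"
    have x: "?x \<in> cimg c" "dV c ?x b \<noteq> 0" using h(2)[OF z] I(2) by (auto simp: U_def)
    define e where "e = frechet_derivative gi (at z) k"
    have "(gi has_derivative frechet_derivative gi (at z)) (at z)"
      using C1_on_differentiable[OF I(7) z] by (simp add: frechet_derivative_works)
    from has_derivative_compose[OF this D\<psi>[OF x(1)]]
    have Dz: "((\<lambda>z. z) has_derivative (\<lambda>k. D ?x (frechet_derivative gi (at z) k))) (at z)"
      by (rule has_derivative_transform_within_open[OF _ I(4) z]) (simp add: h(2))
    have "D ?x e = k"
      using fun_cong[OF has_derivative_unique[OF has_derivative_ident Dz], of k] by (simp add: e_def)
    then have eq: "e + (dV c ?x e - e \<bullet> b) *\<^sub>R b = k" by (simp add: D_def)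
    then have Ve: "dV c ?x e = k \<bullet> b" by (auto simp: inner_add_left bb)
    have e: "e = (k - (k \<bullet> b) *\<^sub>R b) + (e \<bullet> b) *\<^sub>R b"
    proof -
      have "e = k - (dV c ?x e - e \<bullet> b) *\<^sub>R b" using eq by (simp only: eq_diff_eq)
      then show ?thesis unfolding Ve by (simp add: algebra_simps)
    qed
    have "dV c ?x e = dV c ?x (k - (k \<bullet> b) *\<^sub>R b) + (e \<bullet> b) * dV c ?x b"
      using linear_add[OF linV[OF x(1)], of "k - (k \<bullet> b) *\<^sub>R b" "(e \<bullet> b) *\<^sub>R b"] linear_cmul[OF linV[OF x(1)], of "e \<bullet> b" b] e
      by simp
    then have "e \<bullet> b = (k \<bullet> b - dV c ?x (k - (k \<bullet> b) *\<^sub>R b)) / dV c ?x b"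
      using Ve x(2) by (simp add: eq_divide_eq)
    then show ?thesis using e by (simp add: e_def)
  qed
  have C2gi: "Ck_on (Suc (Suc 0)) gi W"
    unfolding C2_iff
  proof (intro conjI ballI allI)
    show "gi differentiable (at z)" if "z \<in> W" for z by (rule C1_on_differentiable[OF I(7) that])
    show "C1_on (\<lambda>z. frechet_derivative gi (at z) k) W" for k
    proof (rule C1_on_cong[OF _ I(4) Dgi])
      show "C1_on (\<lambda>z. (k - (k \<bullet> b) *\<^sub>R b) +
        ((k \<bullet> b - dV c (gi z) (k - (k \<bullet> b) *\<^sub>R b)) / dV c (gi z) b) *\<^sub>R b) W"
      proof (intro C1_on_add C1_on_scaleR C1_on_divide C1_on_diff C1_on_const C1V I(7) giU I(4))
        show "dV c (gi z) b \<noteq> 0" if "z \<in> W" for z using h(2)[OF that] I(2) by (auto simp: U_def)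
      qed
    qed
  qed
  define d :: "('m, 'e) chart" where "d = ({p \<in> cdom c. cmap c p \<in> U'}, \<lambda>p. \<psi> (cmap c p))"
  have dd: "cdom d = {p \<in> cdom c. cmap c p \<in> U'}" "cmap d p = \<psi> (cmap c p)" for p
    by (simp_all add: d_def cdom_def cmap_def)
  have inD: "cinv c y \<in> cdom d" if "y \<in> U'" for y
    using that U'c cinv_in[OF ch] cmap_cinv[OF ch] by (auto simp: dd)
  have img: "cimg d = W"
  proof
    show "cimg d \<subseteq> W" unfolding cimg_def using h(1) by (auto simp: dd)
    show "W \<subseteq> cimg d"
    proof
      fix z assume z: "z \<in> W"
      have u: "gi z \<in> U'" "\<psi> (gi z) = z" using h(2)[OF z] by auto
      have "cmap d (cinv c (gi z)) = z" unfolding dd(2) cmap_cinv[OF ch subsetD[OF U'c u(1)]] by (rule u(2))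
      then show "z \<in> cimg d" unfolding cimg_def using inD[OF u(1)] by (metis imageI)
    qed
  qed
  have gid: "gi (cmap d p) = cmap c p" "cmap d p \<in> W" "p \<in> cdom c" if "p \<in> cdom d" for p
  proof -
    have p: "p \<in> cdom c" "cmap c p \<in> U'" using that unfolding dd(1) by blast+
    show "gi (cmap d p) = cmap c p" "cmap d p \<in> W" unfolding dd(2) using h(1)[OF p(2)] by blast+
    show "p \<in> cdom c" by (rule p(1))
  qed
  have injd: "inj_on (cmap d) (cdom d)"
  proof (rule inj_onI)
    fix p q assume pq: "p \<in> cdom d" "q \<in> cdom d" "cmap d p = cmap d q"
    have "cmap c p = cmap c q" using gid(1)[OF pq(1)] gid(1)[OF pq(2)] pq(3) by metis
    then show "p = q" using cinv_cmap[OF ch gid(3)[OF pq(1)]] cinv_cmap[OF ch gid(3)[OF pq(2)]] by metis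
  qed
  have inv: "cinv d z = cinv c (gi z)" if z: "z \<in> W" for z
  proof -
    have u: "gi z \<in> U'" "\<psi> (gi z) = z" using h(2)[OF z] by auto
    have "cmap d (cinv c (gi z)) = z" unfolding dd(2) cmap_cinv[OF ch subsetD[OF U'c u(1)]] by (rule u(2))
    then show ?thesis unfolding cinv_def[of d] using inv_into_f_f[OF injd inD[OF u(1)]] by metis
  qed
  have od: "open (cdom d)"
  proof -
    have "open (cdom c \<inter> cmap c -` U')"
      by (rule continuous_open_preimage[OF continuous_on_cmap[OF ch] chart_open(1)[OF ch] I(1)])
    then show ?thesis unfolding dd by (simp add: Int_def vimage_def)
  qed
  have chd: "is_chart d"
    unfolding is_chart_def
  proof (intro conjI)
    show "open (cdom d)" by (rule od)
    show "open (cimg d)" using I(4) img by simp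
    have c\<psi>: "continuous_on U' \<psi>" and cgi: "continuous_on W gi" using I(6) by (simp_all add: homeomorphism_def)
    have "continuous_on (cdom d) (cmap c)" by (rule continuous_on_subset[OF continuous_on_cmap[OF ch]]) (auto simp: dd)
    then have "continuous_on (cdom d) (\<lambda>p. \<psi> (cmap c p))"
      by (rule continuous_on_compose2[OF c\<psi>]) (auto simp: dd)
    then have cd: "continuous_on (cdom d) (cmap d)"
      by (rule continuous_on_eq) (simp only: dd(2))
    have "continuous_on W (\<lambda>z. cinv c (gi z))"
      by (rule continuous_on_compose2[OF continuous_on_cinv[OF ch] cgi giU])
    then have cid: "continuous_on W (cinv d)" by (rule continuous_on_eq) (simp add: inv)
    show "homeomorphism (cdom d) (cimg d) (cmap d) (cinv d)"
      unfolding img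
    proof (rule homeomorphismI[OF cd cid])
      show "cmap d ` cdom d \<subseteq> W" using gid(2) by blast
      show "cinv d ` W \<subseteq> cdom d"
      proof (rule image_subsetI)
        fix z assume z: "z \<in> W"
        show "cinv d z \<in> cdom d" unfolding inv[OF z] using inD h(2)[OF z] by blast
      qed
      show "cinv d (cmap d p) = p" if "p \<in> cdom d" for p
        unfolding inv[OF gid(2)[OF that]] gid(1)[OF that] by (rule cinv_cmap[OF ch gid(3)[OF that]])
      show "cmap d (cinv d z) = z" if z: "z \<in> W" for z
      proof -
        have u: "gi z \<in> cimg c" "\<psi> (gi z) = z" using h(2)[OF z] U'c by blast+
        show ?thesis unfolding inv[OF z] dd(2) cmap_cinv[OF ch u(1)] by (rule u(2))
      qed
    qed
  qed
  have comp: "Ck_compatible 2 e d" if e: "e \<in> A" for e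
    unfolding Ck_compatible_def numeral_2_eq_2
  proof
    note che = chart[OF e]
    let ?S = "cmap e ` (cdom e \<inter> cdom d)" and ?S' = "cmap d ` (cdom e \<inter> cdom d)"
    have S: "open ?S" using open_overlap[OF che chd] by (simp add: overlap_def)
    have S': "open ?S'" using open_overlap[OF chd che] by (simp add: overlap_def Int_commute)
    have sub: "?S \<subseteq> overlap e c" by (auto simp: overlap_def dd)
    have "Ck_on (Suc (Suc 0)) (\<psi> \<circ> (cmap c \<circ> cinv e)) ?S"
    proof (rule C2_compose[OF Ck_on_mono_set[OF C2\<psi> U'c] Ck_on_mono_set[OF transition_C2[OF e c(1)] sub] _ S I(1)])
      show "(cmap c \<circ> cinv e) ` ?S \<subseteq> U'" using cinv_cmap[OF che] by (auto simp: dd)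
    qed
    then show "Ck_on (Suc (Suc 0)) (cmap d \<circ> cinv e) ?S"
      by (rule Ck_on_cong[OF S, rotated]) (simp add: dd)
    have S'W: "?S' \<subseteq> W" using img unfolding cimg_def by blast
    have "Ck_on (Suc (Suc 0)) ((cmap e \<circ> cinv c) \<circ> gi) ?S'"
    proof (rule C2_compose[OF transition_C2[OF c(1) e] Ck_on_mono_set[OF C2gi S'W] _ S' open_overlap[OF ch che]])
      show "gi ` ?S' \<subseteq> overlap c e"
      proof
        fix y assume "y \<in> gi ` ?S'"
        then obtain p where p: "p \<in> cdom e" "p \<in> cdom d" "y = gi (\<psi> (cmap c p))" by (auto simp: dd)
        then have "y = cmap c p" using gid(1)[OF p(2)] unfolding dd(2) by metis
        then show "y \<in> overlap c e" using p(1) gid(3)[OF p(2)] unfolding overlap_def by blast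
      qed
    qed
    then show "Ck_on (Suc (Suc 0)) (cmap e \<circ> cinv d) ?S'"
      by (rule Ck_on_cong[OF S', rotated]) (use inv S'W in auto)
  qed
  have "slice_chart 2 A {Q. V Q = E} d b"
    unfolding slice_chart_def
  proof (intro conjI ballI)
    show "cdom d \<inter> {Q. V Q = E} = {p \<in> cdom d. cmap d p \<bullet> b = 0}"
    proof -
      have "cmap d p \<bullet> b = V p - E" if "p \<in> cdom d" for p
        using that cinv_cmap[OF ch, of p] by (simp add: dd \<psi>_def inner_add_left bb)
      then show ?thesis by auto
    qed
  qed (use chd comp b in auto)
  moreover have "P \<in> cdom d" using c I(3) by (simp add: dd)
  moreover have "cdom d \<subseteq> cdom c" by (auto simp: dd)
  moreover have "C1_on (\<lambda>y. cmap c (cinv d y)) (cimg d)"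
    unfolding img
  proof (rule C1_on_cong[OF I(7,4)])
    show "cmap c (cinv d z) = gi z" if "z \<in> W" for z
      using inv[OF that] h(2)[OF that] U'c cmap_cinv[OF ch] by auto
  qed
  ultimately show ?thesis using c(1) by blast
qed

end

section \<open>Differentiability of the normal exponential map\<close>

context boundary_setup
begin

lemma bflow_action_mono:
  assumes b: "bflow c P T r m \<phi>" and w: "rest y \<in> ball (rest (cmap c P)) r" and y: "Vc c y = E"
    and t: "0 < t" "t < t'" "t' < T"
  shows "snd (snd (\<phi> t (rest y))) < snd (snd (\<phi> t' (rest y)))"
proof (rule DERIV_pos_imp_increasing[OF t(2), where f="\<lambda>t. snd (snd (\<phi> t (rest y)))"])
  fix q assume q: "t \<le> q" "q \<le> t'"
  have "q \<in> {0<..<T}" "q \<in> {-T<..<T}" using q t by auto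
  then show "\<exists>D. ((\<lambda>t. snd (snd (\<phi> t (rest y)))) has_real_derivative D) (at q) \<and> 0 < D"
    using nsolD(4)[OF bflowD(9)[OF b w], of q] bflow_positive(1)[OF b w y, of q] by (intro exI conjI) auto
qed

text \<open>The reparameterized motion is one of the geodesics whose union is the maximal one.\<close>

lemma gamma_near_boundary:
  assumes b: "bflow c P T r m \<phi>" and w: "rest y \<in> ball (rest (cmap c P)) r" and y: "Vc c y = E"
    and l: "l > 0" and t: "t \<in> {0<..<T}"
  defines "s \<equiv> snd (snd (\<phi> t (rest y))) / sqrt l" and "x \<equiv> the \<circ> gamma A g V E (cinv c y) l"
  shows "s > 0" "s \<in> dom (gamma A g V E (cinv c y) l)" "x s \<in> cdom c"
    "state x c s = (fst (\<phi> t (rest y)), (sqrt l / (E - Vc c (fst (\<phi> t (rest y))))) *\<^sub>R fst (snd (\<phi> t (rest y))))"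
proof -
  note c = bflowD(1)[OF b] and T = bflowD(4)[OF b]
  let ?s = "\<lambda>t. snd (snd (\<phi> t (rest y))) / sqrt l" and ?\<gamma> = "gamma A g V E (cinv c y) l"
  obtain X where X: "jsol_on X (?s ` {0<..<T})" "(X \<longlongrightarrow> cinv c y) (at_right 0)"
    "\<And>t. t \<in> {0<..<T} \<Longrightarrow> ?s t > 0 \<and> {0<..?s t} \<subseteq> ?s ` {0<..<T} \<and> X (?s t) \<in> cdom c \<and> jconst X c (?s t) = l \<and>
       state X c (?s t) = (fst (\<phi> t (rest y)), (sqrt l / (E - Vc c (fst (\<phi> t (rest y))))) *\<^sub>R fst (snd (\<phi> t (rest y))))"
    by (rule boundary_curve[OF b w y l]) (rule that)
  define t' where "t' = (t + T) / 2"
  have t': "t' \<in> {0<..<T}" "t < t'" using t by (auto simp: t'_def)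
  define B where "B = ?s t'"
  have sB: "s \<in> {0<..<B}"
    using X(3)[OF t] bflow_action_mono[OF b w y, of t t'] t t' l by (simp add: s_def B_def divide_strict_right_mono)
  have B: "B > 0" "{0<..<B} \<subseteq> ?s ` {0<..<T}" using X(3)[OF t'(1)] by (auto simp: B_def)
  define \<gamma>' where "\<gamma>' = (\<lambda>s. if 0 < s \<and> s < B then Some (X s) else None)"
  have J: "jsol_on X {0<..<B}" by (rule jsol_on_subset[OF X(1) B(2)]) (auto simp: is_interval_oo)
  have Xs: "X s \<in> cdom c" "jconst X c s = l" using X(3)[OF t] unfolding s_def by blast+
  have gb: "geodesic_from_boundary A g V E (cinv c y) l \<gamma>'"
    unfolding \<gamma>'_def by (rule geodesic_from_boundaryI[OF J B(1) X(2) sB c Xs])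
  have VP: "V (cinv c y) = E" using y by simp
  have le: "\<gamma>' \<subseteq>\<^sub>m ?\<gamma>" by (rule gamma_maximal(2)[OF VP l gb])
  have eq: "?\<gamma> q = Some (X q)" if "q \<in> {0<..<B}" for q
  proof -
    have "\<gamma>' q = Some (X q)" using that by (simp add: \<gamma>'_def)
    then show ?thesis using le unfolding map_le_def by (metis domI)
  qed
  show "s > 0" using sB by simp
  show "s \<in> dom ?\<gamma>" using eq[OF sB] by blast
  show "x s \<in> cdom c" using eq[OF sB] Xs(1) by (simp add: x_def)
  have "state x c s = state X c s"
    by (rule state_cong[OF open_greaterThanLessThan sB]) (simp add: x_def eq)
  then show "state x c s = (fst (\<phi> t (rest y)), (sqrt l / (E - Vc c (fst (\<phi> t (rest y))))) *\<^sub>R fst (snd (\<phi> t (rest y))))"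
    using X(3)[OF t] unfolding s_def by metis
qed

text \<open>The solution w is glued to the geodesic, and the maximal geodesic contains the glued curve.\<close>

lemma gamma_prolong:
  assumes P: "V P = E" and l: "l > 0" and s1: "s1 \<in> dom (gamma A g V E P l)" "s1 \<le> s"
    and w: "jsol_on w J" "{s1..s} \<subseteq> J" and c: "c \<in> A" "(the \<circ> gamma A g V E P l) s1 \<in> cdom c" "w s1 \<in> cdom c"
    and eq: "state (the \<circ> gamma A g V E P l) c s1 = state w c s1"
  shows "gamma A g V E P l s = Some (w s)"
proof -
  let ?\<gamma> = "gamma A g V E P l" and ?x = "the \<circ> gamma A g V E P l"
  note G = geodesic_from_boundaryD[OF gamma_maximal(1)[OF P l]]
  have s10: "s1 > 0" using G(5)[OF s1(1)] by simp
  let ?J = "J \<inter> {0<..}"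
  have iJ: "is_interval ?J" by (intro is_interval_Int jsol_onD(2)[OF w(1)] is_interval_io is_interval_oi) 
  have wJ: "jsol_on w ?J" by (rule jsol_on_subset[OF w(1)]) (use jsol_onD(1)[OF w(1)] iJ in auto)
  have s1J: "s1 \<in> ?J" and sJ: "s \<in> ?J" using w(2) s1(2) s10 by auto
  have agree: "?x q = w q" if "q \<in> dom ?\<gamma>" "q \<in> ?J" for q
    by (rule jsol_agree[OF G(1) wJ s1(1) s1J c eq that])
  define u where "u = (\<lambda>q. if q \<in> dom ?\<gamma> then ?x q else w q)"
  have u: "jsol_on u (dom ?\<gamma> \<union> ?J)"
    unfolding u_def by (rule jsol_glue(1)[OF G(1) wJ s1(1) s1J agree])
  have ux: "u q = ?x q" if "q \<in> dom ?\<gamma>" for q using that by (simp add: u_def)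
  have uw: "u q = w q" if "q \<in> ?J" for q using that agree[of q] by (simp add: u_def)
  obtain e where e: "e > 0" "ball s e \<subseteq> ?J" using jsol_onD(1)[OF wJ] sJ openE by blast
  define B where "B = s + e"
  have B: "B > 0" "s \<in> {0<..<B}" "s1 \<in> {0<..<B}" using e(1) s1(2) s10 by (auto simp: B_def)
  have sub: "{0<..<B} \<subseteq> dom ?\<gamma> \<union> ?J"
  proof
    fix q assume q: "q \<in> {0<..<B}"
    consider "q \<le> s1" | "s1 \<le> q" "q \<le> s" | "s < q" by linarith
    then show "q \<in> dom ?\<gamma> \<union> ?J"
    proof cases
      case 1
      then show ?thesis using G(5)[OF s1(1)] q by auto
    next
      case 2
      then show ?thesis using w(2) q by auto
    next
      case 3
      then have "q \<in> ball s e" using q by (auto simp: B_def dist_real_def)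
      then show ?thesis using e(2) by blast
    qed
  qed
  have uB: "jsol_on u {0<..<B}" by (rule jsol_on_subset[OF u sub]) (auto simp: is_interval_oo)
  have lim: "(u \<longlongrightarrow> P) (at_right 0)"
  proof (rule Lim_transform_eventually[OF G(3)])
    show "eventually (\<lambda>q. ?x q = u q) (at_right 0)"
      unfolding eventually_at_right_field
    proof (intro exI[of _ s1] conjI allI impI)
      fix q assume "0 < q" "q < s1"
      then have "q \<in> {0<..s1}" by simp
      then have "q \<in> dom ?\<gamma>" using G(5)[OF s1(1)] by blast
      then show "?x q = u q" by (simp add: ux)
    qed (rule s10)
  qed
  have us1: "u s1 \<in> cdom c" using c(2) ux[OF s1(1)] by simp
  have "jconst u c s1 = jconst ?x c s1" by (rule jconst_cong[OF jsol_onD(1)[OF G(1)] s1(1) ux])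
  then have ul: "jconst u c s1 = l" using G(4)[OF s1(1) c(1,2)] by simp
  define \<gamma>' where "\<gamma>' = (\<lambda>s. if 0 < s \<and> s < B then Some (u s) else None)"
  have gb: "geodesic_from_boundary A g V E P l \<gamma>'"
    unfolding \<gamma>'_def by (rule geodesic_from_boundaryI[OF uB B(1) lim B(3) c(1) us1 ul])
  have "\<gamma>' \<subseteq>\<^sub>m ?\<gamma>" by (rule gamma_maximal(2)[OF P l gb])
  moreover have "\<gamma>' s = Some (w s)" using B(2) uw[OF sJ] by (simp add: \<gamma>'_def)
  ultimately show ?thesis unfolding map_le_def by (metis domI)
qed

text \<open>The exponential map is a composition of maps of class C^1: the state of the geodesic at a small
  parameter value s1 is given by the flow of Newton's equation at the time, an implicit function, when the
  action takes the value s1 times the square root of l, and the interior flow carries it from s1 to s.\<close>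

lemma exp_perp_C1:
  assumes s: "s > 0"
  shows "C1_map_hypersurface_real A {P. V P = E} (\<lambda>(P, l). exp_perp A g V E (P, l) s)"
  unfolding C1_map_hypersurface_real_def
proof (intro conjI ballI)
  let ?f = "\<lambda>(P, l). exp_perp A g V E (P, l) s"
  show "dom ?f \<subseteq> {P. V P = E} \<times> UNIV" by (auto simp: exp_perp_def dom_def split: if_splits)
  fix Pl assume Pl: "Pl \<in> dom ?f"
  obtain P0 l0 where eqPl: "Pl = (P0, l0)" by (cases Pl)
  have P0: "V P0 = E" and l0: "l0 > 0" and sdom: "s \<in> dom (gamma A g V E P0 l0)"
    using Pl unfolding eqPl by (auto simp: exp_perp_def dom_def split: if_splits)
  obtain d b c where d: "slice_chart 2 A {Q. V Q = E} d b" "P0 \<in> cdom d" "c \<in> A" "cdom d \<subseteq> cdom c"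
    "C1_on (\<lambda>y. cmap c (cinv d y)) (cimg d)"
    using ex_slice_chart[OF P0] by blast
  have chd: "is_chart d" and bB: "b \<in> Basis" and slice: "cdom d \<inter> {Q. V Q = E} = {p \<in> cdom d. cmap d p \<bullet> b = 0}"
    using d(1) by (auto simp: slice_chart_def)
  have P0c: "P0 \<in> cdom c" using d by blast
  note c = d(3) and ch = chart[OF d(3)]
  let ?y0 = "cmap c P0"
  have y0: "cinv c ?y0 = P0" by (rule cinv_cmap[OF ch P0c])
  have Vy0: "Vc c ?y0 = E" using y0 P0 by simp
  obtain T r m \<phi> where bf: "bflow c P0 T r m \<phi>" using ex_bflow[OF c P0c P0] by blast
  note T = bflowD(4)[OF bf]
  have w0: "rest ?y0 \<in> ball (rest ?y0) r" using bflowD(5)[OF bf] by simp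
  let ?\<sigma> = "\<lambda>t y. snd (snd (\<phi> t (rest y)))"
  have T2: "T / 2 \<in> {0<..<T}" using T by simp
  define s1 where "s1 = min (s / 2) (?\<sigma> (T / 2) ?y0 / sqrt l0)"
  have s1: "0 < s1" "s1 < s"
    using s bflow_positive(2)[OF bf w0 Vy0 T2] l0 by (auto simp: s1_def)
  obtain t1 where t1: "0 < t1" "t1 \<le> T / 2" "s1 = ?\<sigma> t1 ?y0 / sqrt l0"
    using bflow_action_onto[OF bf w0 T2 s1(1) _ l0] by (auto simp: s1_def)
  have t1T: "t1 \<in> {0<..<T}" using t1 T by auto
  \<comment> \<open>The zeros of \<Phi> are the times at which the action takes the value that corresponds to s1.\<close>
  define \<Phi> where "\<Phi> q = ?\<sigma> (snd q) (fst (fst q)) - sqrt (snd (fst q)) * s1" for q :: "('e \<times> real) \<times> real"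
  define W where "W = {q :: ('e \<times> real) \<times> real. rest (fst (fst q)) \<in> ball (rest ?y0) r \<and> 0 < snd (fst q) \<and> 0 < snd q \<and> snd q < T}"
  have oW: "open W"
  proof -
    have "W = (\<lambda>q. rest (fst (fst q))) -` ball (rest ?y0) r \<inter> (\<lambda>q. snd (fst q)) -` {0<..} \<inter> snd -` {0<..<T}"
      by (auto simp: W_def)
    moreover have "open \<dots>" by (intro open_Int open_vimage continuous_intros) auto
    ultimately show ?thesis by simp
  qed
  have C\<phi>: "C1_on (\<lambda>q. \<phi> (\<tau> q) (rest (\<eta> q))) S"
    if "C1_on \<tau> S" "C1_on \<eta> S" "\<And>q. q \<in> S \<Longrightarrow> \<tau> q \<in> {-T<..<T} \<and> rest (\<eta> q) \<in> ball (rest ?y0) r"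
    for \<tau> \<eta> and S :: "'x::real_normed_vector set"
  proof -
    have "(\<lambda>q. (\<tau> q, rest (\<eta> q))) ` S \<subseteq> {-T<..<T} \<times> ball (rest ?y0) r"
      by (intro image_subsetI SigmaI) (use that(3) in blast)+
    moreover have "C1_on (\<lambda>q. (\<tau> q, rest (\<eta> q))) S" by (intro C1_on_Pair that C1_on_const)
    ultimately show ?thesis using C1_on_compose[OF bflowD(7)[OF bf], of "\<lambda>q. (\<tau> q, rest (\<eta> q))" S] by simp
  qed
  have C\<Phi>: "C1_on \<Phi> W"
    unfolding \<Phi>_def
    by (intro C1_on_diff C1_on_mult C1_on_snd C\<phi> C1_on_fst C1_on_id C1_on_const C1_on_sqrt) (auto simp: W_def)
  have qW: "((?y0, l0), t1) \<in> W" using w0 l0 t1T by (simp add: W_def)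
  define D where "D h = h * (E - Vc c (fst (\<phi> t1 (rest ?y0))))" for h
  have "((\<lambda>t. ?\<sigma> t ?y0 - sqrt l0 * s1) has_real_derivative E - Vc c (fst (\<phi> t1 (rest ?y0))) - 0) (at t1)"
    by (intro DERIV_diff DERIV_const nsolD(4)[OF bflowD(9)[OF bf w0]]) (use t1T T in auto)
  then have D1: "((\<lambda>z. \<Phi> ((?y0, l0), z)) has_derivative D) (at t1)"
    by (simp add: has_field_derivative_def \<Phi>_def D_def[abs_def] mult_commute_abs)
  have D2: "h = 0" if "D h = 0" for h
    using that bflow_positive(1)[OF bf w0 Vy0 t1T] by (simp add: D_def)
  obtain Pn \<zeta> where I: "open Pn" "(?y0, l0) \<in> Pn" "C1_on \<zeta> Pn" "\<zeta> (?y0, l0) = t1"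
    "\<And>p. p \<in> Pn \<Longrightarrow> (p, \<zeta> p) \<in> W \<and> \<Phi> (p, \<zeta> p) = \<Phi> ((?y0, l0), t1)"
    by (rule C1_implicit_function[OF C\<Phi> oW qW D1 D2]) (assumption | rule that)+
  have \<Phi>0: "\<Phi> ((?y0, l0), t1) = 0" using t1(3) l0 by (simp add: \<Phi>_def)
  have pW: "rest (fst p) \<in> ball (rest ?y0) r" "snd p > 0" "\<zeta> p \<in> {0<..<T}" "?\<sigma> (\<zeta> p) (fst p) / sqrt (snd p) = s1"
    if "p \<in> Pn" for p
    using I(5)[OF that] \<Phi>0 by (auto simp: W_def \<Phi>_def)
  define ph where "ph p = \<phi> (\<zeta> p) (rest (fst p))" for p :: "'e \<times> real"
  have Cph: "C1_on ph Pn"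
    unfolding ph_def
  proof (rule C\<phi>[OF I(3) C1_on_fst[OF C1_on_id]])
    show "\<zeta> q \<in> {-T<..<T} \<and> rest (fst q) \<in> ball (rest ?y0) r" if "q \<in> Pn" for q
      using pW(1,3)[OF that] T by simp
  qed
  have phc: "fst (ph p) \<in> cimg c" if "p \<in> Pn" for p
    unfolding ph_def by (rule nsolD(1)[OF bflowD(9)[OF bf pW(1)[OF that]]]) (use pW(3)[OF that] T in auto)
  have CV: "C1_on (\<lambda>p. Vc c (fst (ph p))) Pn"
    by (rule C1_on_compose[OF Vc_C1[OF c] C1_on_fst[OF Cph]]) (use phc in blast)
  define Pm where "Pm = Pn \<inter> (\<lambda>p. Vc c (fst (ph p))) -` {..<E}"
  have oPm: "open Pm" unfolding Pm_def by (rule continuous_open_preimage[OF C1_on_continuous_on[OF CV] I(1)]) simp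
  have Pm: "Pm \<subseteq> Pn" "\<And>p. p \<in> Pm \<Longrightarrow> Vc c (fst (ph p)) < E" by (auto simp: Pm_def)
  define Z where "Z p = (fst (ph p), (sqrt (snd p) / (E - Vc c (fst (ph p)))) *\<^sub>R fst (snd (ph p)))" for p
  have CZ: "C1_on Z Pm"
  proof -
    have 1: "C1_on ph Pm" "C1_on (\<lambda>p. Vc c (fst (ph p))) Pm"
      by (rule C1_on_subset[OF Cph Pm(1)] C1_on_subset[OF CV Pm(1)])+
    show ?thesis
      unfolding Z_def
    proof (intro C1_on_Pair C1_on_scaleR C1_on_divide C1_on_fst C1_on_snd C1_on_diff C1_on_const C1_on_sqrt C1_on_id 1)
      show "snd p > 0" if "p \<in> Pm" for p using pW(2) that Pm(1) by blast
      show "E - Vc c (fst (ph p)) \<noteq> 0" if "p \<in> Pm" for p using Pm(2)[OF that] by simp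
    qed
  qed
  \<comment> \<open>The state at s1 of the geodesics near the given one.\<close>
  have near: "s1 \<in> dom (gamma A g V E (cinv c y) l)" "(the \<circ> gamma A g V E (cinv c y) l) s1 \<in> cdom c"
    "state (the \<circ> gamma A g V E (cinv c y) l) c s1 = Z (y, l)" if p: "(y, l) \<in> Pn" and y: "Vc c y = E" for y l
  proof -
    note q = pW[OF p, unfolded fst_conv snd_conv]
    show "s1 \<in> dom (gamma A g V E (cinv c y) l)" "(the \<circ> gamma A g V E (cinv c y) l) s1 \<in> cdom c"
      "state (the \<circ> gamma A g V E (cinv c y) l) c s1 = Z (y, l)"
      using gamma_near_boundary(2-4)[OF bf q(1) y q(2,3)] unfolding q(4) by (simp_all add: Z_def ph_def)
  qed
  let ?x0 = "the \<circ> gamma A g V E P0 l0"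
  note G0 = geodesic_from_boundaryD[OF gamma_maximal(1)[OF P0 l0]]
  have near0: "s1 \<in> dom (gamma A g V E P0 l0)" "?x0 s1 \<in> cdom c" "state ?x0 c s1 = Z (?y0, l0)"
    using near[OF I(2) Vy0] unfolding y0 by auto
  have "{s1..s} \<subseteq> {0<..s}" using s1 by auto
  then have sub0: "{s1..s} \<subseteq> dom (gamma A g V E P0 l0)" using G0(5)[OF sdom] by blast
  obtain c' where c': "c' \<in> A" "?x0 s \<in> cdom c'" using ex_chart by blast
  have "flowbox ?x0 s1 c s c'"
    by (rule flowbox_along[OF G0(1) _ sub0 c c'(1) near0(2) c'(2)]) (use s1 in simp)
  then obtain B F where F: "open B" "state ?x0 c s1 \<in> B" "C1_on F B"
    "\<And>z. z \<in> B \<Longrightarrow> \<exists>y J. jsol_on y J \<and> {s1..s} \<subseteq> J \<and> y s1 \<in> cdom c \<and> state y c s1 = z \<and> y s \<in> cdom c' \<and> state y c' s = F z"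
    unfolding flowbox_def by blast
  define R where "R = Pm \<inter> Z -` B"
  have oR: "open R" unfolding R_def by (rule continuous_open_preimage[OF C1_on_continuous_on[OF CZ] oPm F(1)])
  have expR: "\<exists>q\<in>cdom c'. exp_perp A g V E (cinv c y, l) s = Some q \<and> cmap c' q = fst (F (Z (y, l)))"
    if R: "(y, l) \<in> R" and y: "Vc c y = E" for y l
  proof -
    have p: "(y, l) \<in> Pn" and zB: "Z (y, l) \<in> B" using R Pm(1) by (auto simp: R_def)
    have l: "l > 0" using pW(2)[OF p] by simp
    have VP: "V (cinv c y) = E" using y by simp
    obtain w J where w: "jsol_on w J" "{s1..s} \<subseteq> J" "w s1 \<in> cdom c" "state w c s1 = Z (y, l)" "w s \<in> cdom c'" "state w c' s = F (Z (y, l))"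
      using F(4)[OF zB] by blast
    have "gamma A g V E (cinv c y) l s = Some (w s)"
      by (rule gamma_prolong[OF VP l near(1)[OF p y] _ w(1,2) c near(2)[OF p y] w(3)])
         (use s1 near(3)[OF p y] w(4) in auto)
    then have "exp_perp A g V E (cinv c y, l) s = Some (w s)" using VP l by (simp add: exp_perp_def)
    moreover have "cmap c' (w s) = fst (F (Z (y, l)))" using w(6) by (metis state_def fst_conv)
    ultimately show ?thesis using w(5) by blast
  qed
  have projC: "C1_on (\<lambda>q. hyperplane_proj b (fst q)) S" for S :: "('e \<times> real) set"
    unfolding hyperplane_proj_def by (intro C1_intros)
  define N1 where "N1 = (\<lambda>q :: 'e \<times> real. hyperplane_proj b (fst q)) -` cimg d"
  have oN1: "open N1"
    unfolding N1_def hyperplane_proj_def by (intro open_vimage continuous_intros chart_open(2)[OF chd])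
  define Y where "Y q = (cmap c (cinv d (hyperplane_proj b (fst q))), snd q)" for q :: "'e \<times> real"
  have CY: "C1_on Y N1"
    unfolding Y_def
    by (intro C1_on_Pair C1_on_compose[OF d(5) projC] C1_on_snd C1_on_id) (auto simp: N1_def)
  define N where "N = N1 \<inter> Y -` R"
  have oN: "open N" unfolding N_def by (rule continuous_open_preimage[OF C1_on_continuous_on[OF CY] oN1 oR])
  have inN: "hyperplane_proj b y \<in> cimg d \<and>
      (\<exists>q\<in>cdom c'. exp_perp A g V E (cinv d (hyperplane_proj b y), u) s = Some q \<and> cmap c' q = fst (F (Z (Y (y, u)))))"
    if "(y, u) \<in> N" for y u
  proof -
    let ?z = "hyperplane_proj b y"
    have z: "?z \<in> cimg d" "Y (y, u) \<in> R" using that by (auto simp: N_def N1_def)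
    have zb: "?z \<bullet> b = 0" using bB by (simp add: hyperplane_proj_def inner_diff_left)
    have zd: "cinv d ?z \<in> cdom d" by (rule cinv_in[OF chd z(1)])
    have "cmap d (cinv d ?z) \<bullet> b = 0" using cmap_cinv[OF chd z(1)] zb by simp
    then have Vz: "V (cinv d ?z) = E" using slice zd by blast
    have cc: "cinv c (cmap c (cinv d ?z)) = cinv d ?z" by (rule cinv_cmap[OF ch]) (use zd d(4) in blast)
    have "(cmap c (cinv d ?z), u) \<in> R" using z(2) by (simp add: Y_def)
    from expR[OF this] show ?thesis using z(1) Vz cc by (simp add: Y_def)
  qed
  have "(cmap d P0, l0) \<in> N"
  proof -
    have "cmap d P0 \<bullet> b = 0" using slice d(2) P0 by blast
    then have pr: "hyperplane_proj b (cmap d P0) = cmap d P0" by (simp add: hyperplane_proj_def)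
    have "Y (cmap d P0, l0) = (?y0, l0)" by (simp add: Y_def pr cinv_cmap[OF chd d(2)])
    moreover have "(?y0, l0) \<in> R"
      using I(2,4) near0(3) F(2) bflow_positive(1)[OF bf w0 Vy0 t1T] by (simp add: R_def Pm_def ph_def)
    ultimately show ?thesis using cmap_in[OF chd d(2)] by (simp add: N_def N1_def pr)
  qed
  moreover have "Ck_on 1 (\<lambda>(y, u). cmap c' (the (?f (cinv d (hyperplane_proj b y), u)))) N"
  proof -
    have "C1_on (\<lambda>q. fst (F (Z (Y q)))) N"
    proof (intro C1_on_fst C1_on_compose[OF F(3)] C1_on_compose[OF CZ] C1_on_subset[OF CY])
      show "N \<subseteq> N1" "Y ` N \<subseteq> Pm" "(\<lambda>q. Z (Y q)) ` N \<subseteq> B" by (auto simp: N_def R_def)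
    qed
    then have "C1_on (\<lambda>(y, u). cmap c' (the (?f (cinv d (hyperplane_proj b y), u)))) N"
    proof (rule C1_on_cong[OF _ oN])
      fix q assume "q \<in> N"
      then obtain y u where q: "q = (y, u)" "(y, u) \<in> N" by (cases q) auto
      show "(case q of (y, u) \<Rightarrow> cmap c' (the (?f (cinv d (hyperplane_proj b y), u)))) = fst (F (Z (Y q)))"
        using inN[OF q(2)] unfolding q(1) by auto
    qed
    then show ?thesis by (simp add: C1_on_iff_Ck_on)
  qed
  moreover have "\<forall>(y, u)\<in>N. hyperplane_proj b y \<in> cimg d \<and> (\<exists>q\<in>cdom c'. ?f (cinv d (hyperplane_proj b y), u) = Some q)"
    using inN by (auto split: prod.splits) 
  ultimately show "case Pl of (P, r) \<Rightarrow> \<exists>d b c N. slice_chart 2 A {P. V P = E} d b \<and> P \<in> cdom d \<and> c \<in> A \<and>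
        open N \<and> (cmap d P, r) \<in> N \<and>
        (\<forall>(y, u)\<in>N. hyperplane_proj b y \<in> cimg d \<and> (\<exists>q\<in>cdom c. ?f (cinv d (hyperplane_proj b y), u) = Some q)) \<and>
        Ck_on 1 (\<lambda>(y, u). cmap c (the (?f (cinv d (hyperplane_proj b y), u)))) N"
    unfolding eqPl prod.case using d(1,2) c'(1) oN by blast
qed

end

theorem proposition2p3:
  fixes A :: "('m::{t2_space, second_countable_topology}, 'e::euclidean_space) chart set"
    and g :: "('m, 'e) metric" and V :: "'m \<Rightarrow> real" and E \<delta> :: real
  assumes "Ck_atlas 3 A" and "riemannian_metric 2 A g" and "Ck_function 2 A V"
    and "(INF p. ereal (V p)) < ereal E"
    and "regular_value A V E"
    and "compact {p. V p \<le> E}"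
    and "\<delta> > 0"
    and "Ck_hypersurface 2 A {Q. V Q < E \<and> jacobi_dist A g V E Q = ennreal \<delta>}"
  shows "(\<forall>P l. V P = E \<and> l > 0 \<and> \<delta> / sqrt l \<in> dom (gamma A g V E P l) \<longrightarrow>
            (\<forall>s \<in> dom (gamma A g V E P l).
               gamma A g V E P l s = gamma_delta A g V E \<delta> P l (s - \<delta> / sqrt l)))
         \<and> (\<forall>s>0. C1_map_hypersurface_real A {P. V P = E} (\<lambda>(P, l). exp_perp A g V E (P, l) s))"
proof (intro conjI allI impI ballI)
  interpret boundary_setup A g V E
    using assms(1-3,5) by unfold_locales
  show "C1_map_hypersurface_real A {P. V P = E} (\<lambda>(P, l). exp_perp A g V E (P, l) s)" if "s > 0" for s
    by (rule exp_perp_C1[OF that])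
  fix P l s
  assume P: "V P = E \<and> l > 0 \<and> \<delta> / sqrt l \<in> dom (gamma A g V E P l)" and s: "s \<in> dom (gamma A g V E P l)"
  have "jacobi_geodesic A g V E (gamma A g V E P l)"
    using gamma_maximal(1)[of P l] P by (simp add: geodesic_from_boundary_def)
  from jacobi_geodesic_restart[OF this _ s] P
  show "gamma A g V E P l s = gamma_delta A g V E \<delta> P l (s - \<delta> / sqrt l)"
    by (simp add: gamma_delta_def Let_def)
qed

end
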